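(* Let $(c,\mu)$ be the exact solution of the classical convex-splitting step (CS), and let $(c_h,\mu_h)\in V_h\times V_h$ be the corresponding conforming finite element solution, i.e. the solution of (CS$_h$), where $c_h^n\in V_h$ is a given approximation of $c^n$ with $\int_\Omega c_h^n\,dx=\int_\Omega c^n\,dx$. Let $I\subset\mathbb R$ be an interval containing the essential ranges of $c,c_h,c^n,c_h^n$, and assume that $f_c$ is convex and that there is $L_I>0$ with $$|f_c'(r)-f_c'(s)|+|f_e'(r)-f_e'(s)|\le L_I|r-s|\qquad\forall r,s\in I.$$ Let $c,\mu\in H^{r_c+1}(\Omega)$, $c\in H^2(\Omega)$, $\partial_n c=0$ on $\partial\Omega$. Let $(p,\boldsymbol u)\in Q_0\times\boldsymbol U$ be the continuous auxiliary pair (AUX) with right-hand side $-\Delta c$, let $r_h\in Q_h$ be defined by $(r_h,q_h)=(\nabla c_h,\nabla q_h)$ for all $q_h\in Q_h$, let $(p_h,\boldsymbol u_h)\in Q_h\times\boldsymbol U_h$ be the discrete auxiliary pair (AUX$_h$) with right-hand side $r_h$, and assume $$p\in H^{r_p+1}(\Omega)\cap L^2_0(\Omega),\qquad \boldsymbol u\in[H^{r_u+1}(\Omega)]^2\cap[H^1_0(\Omega)]^2.$$ Then there exists a constant $C>0$, independent of $h$, but possibly depending on $\Omega$, $m$, $\tau$, $\varepsilon$ and the interval $I$, such that $$\begin{aligned}&\|c-c_h\|_{-1,h}+\|c-c_h\|_{H^1(\Omega)}+\|\mu-\mu_h\|_{H^1(\Omega)}+\|p-p_h\|_{L^2(\Omega)}+\|\boldsymbol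 u-\boldsymbol u_h\|_{H^1(\Omega)}\\&\le C\Big(h^{r_c}\|c\|_{H^{r_c+1}(\Omega)}+h^{r_c}\|\mu\|_{H^{r_c+1}(\Omega)}+h^{r_p+1}\|p\|_{H^{r_p+1}(\Omega)}+h^{r_u}\|\boldsymbol u\|_{H^{r_u+1}(\Omega)}\\&\qquad+\|c^n-c_h^n\|_{-1,h}+\|c^n-c_h^n\|_{L^2(\Omega)}+\eta_{\Delta,h}\Big),\end{aligned}$$ where $\eta_{\Delta,h}:=\|-\Delta c-r_h\|_{L^2(\Omega)}$.
   Context: $\Omega\subset\mathbb R^2$ is a bounded, connected, convex polygonal domain with outer unit normal $n$; $m,\varepsilon,\tau>0$ are constants; $f=f_c-f_e$ with $f_c,f_e\in C^1(\mathbb R)$ convex; $c^n\in H^1(\Omega)$. $(\cdot,\cdot)$ is the $L^2(\Omega)$ inner product (Frobenius product for matrix fields). $G^n(c):=f_c'(c)-f_e'(c^n)$ and $G_h^n(c_h):=f_c'(c_h)-f_e'(c_h^n)$. $Q_0:=L^2_0(\Omega)=\{q\in L^2(\Omega):\int_\Omega q\,dx=0\}$, $\boldsymbol U:=[H^1_0(\Omega)]^2$, $\mathbf D\boldsymbol v:=\frac12(\nabla\boldsymbol v+(\nabla\boldsymbol v)^T)$. (CS): $(c,\mu)\in H^1(\Omega)\times H^1(\Omega)$ satisfies $\big(\frac{c-c^n}{\tau},v\big)+m(\nabla\mu,\nabla v)=0$ for all $v\in H^1(\Omega)$ and $(\mu,w)-\varepsilon^2(\nabla c,\nabla w)-(G^n(c),w)=0$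 for all $w\in H^1(\Omega)$. $\{\mathcal T_h\}_{h>0}$ is a shape-regular family of conforming triangulations of $\Omega$, and $\mathbb V_h^k\subset H^1(\Omega)$ is the conforming Lagrange finite element space of degree $k\ge1$ on $\mathcal T_h$. For $r_c,r_p,r_u\ge1$: $V_h:=\mathbb V_h^{r_c}$, $Q_h:=\mathbb V_h^{r_p}\cap L^2_0(\Omega)$, $\boldsymbol U_h:=[\mathbb V_h^{r_u}\cap H^1_0(\Omega)]^2$. The standard approximation properties are assumed, with $C$ independent of $h$ and of the approximated function: $\inf_{v_h\in V_h}\|v-v_h\|_{H^1(\Omega)}\le Ch^{r_c}\|v\|_{H^{r_c+1}(\Omega)}$, $\inf_{q_h\in Q_h}\|q-q_h\|_{L^2(\Omega)}\le Ch^{r_p+1}\|q\|_{H^{r_p+1}(\Omega)}$ (for mean-zero $q$), $\inf_{\boldsymbol z_h\in\boldsymbol U_h}\|\boldsymbol z-\boldsymbol z_h\|_{H^1(\Omega)}\le Ch^{r_u}\|\boldsymbol z\|_{H^{r_u+1}(\Omega)}$ (for $\boldsymbol z$ with zero trace). (CS$_h$): $(c_h,\mu_h)\in V_h\times V_h$ satisfies $\big(\frac{c_h-c_h^n}{\tau},v_h\big)+m(\nabla\mu_h,\nabla v_h)=0$ for all $v_h\in V_h$ and $(\mu_h,w_h)-\varepsilon^2(\nabla c_h,\nabla w_h)-(G_h^n(c_h),w_h)=0$ for all $w_h\in V_h$. (AUX) with right-hand side $r\in Q_0$: $(2p+\operatorname{div}\boldsymbol u,q)=(r,q)$ for all $q\in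 Q_0$ and $(\mathbf D\boldsymbol u,\mathbf D\boldsymbol z)+(p,\operatorname{div}\boldsymbol z)=0$ for all $\boldsymbol z\in\boldsymbol U$. (AUX$_h$) with right-hand side $r_h\in Q_h$: $(2p_h+\operatorname{div}\boldsymbol u_h,q_h)=(r_h,q_h)$ for all $q_h\in Q_h$ and $(\mathbf D\boldsymbol u_h,\mathbf D\boldsymbol z_h)+(p_h,\operatorname{div}\boldsymbol z_h)=0$ for all $\boldsymbol z_h\in\boldsymbol U_h$. $V_{h,0}:=V_h\cap L^2_0(\Omega)$. For $g\in L^2_0(\Omega)$, $\mathcal N_hg\in V_{h,0}$ is defined by $(\nabla\mathcal N_hg,\nabla v_h)=(g,v_h)$ for all $v_h\in V_{h,0}$, and $\|g\|_{-1,h}:=\|\nabla\mathcal N_hg\|_{L^2(\Omega)}$ (a norm on $V_{h,0}$, a seminorm on $L^2_0(\Omega)$). *)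

theory Defs
  imports "HOL-Analysis.Analysis"
begin

section \<open>Lebesgue spaces\<close>

text \<open>Elements of function spaces are represented by functions on the whole type; only their
  values on the given set (up to null sets) matter.\<close>

definition L2 :: "'a::euclidean_space set \<Rightarrow> ('a \<Rightarrow> 'b::euclidean_space) set" where
  "L2 S = {f \<in> borel_measurable (lebesgue_on S).
             integrable (lebesgue_on S) (\<lambda>x. (norm (f x))\<^sup>2)}"

text \<open>For values in \<open>real ^ 2 ^ 2\<close> the inner product is the Frobenius product.\<close>

definition L2_inner ::
    "'a::euclidean_space set \<Rightarrow> ('a \<Rightarrow> 'b::euclidean_space) \<Rightarrow> ('a \<Rightarrow> 'b) \<Rightarrow> real" where
  "L2_inner S f g = (LINT x|lebesgue_on S. f x \<bullet> g x)"

definition L2_norm :: "'a::euclidean_space set \<Rightarrow> ('a \<Rightarrow> 'b::euclidean_space) \<Rightarrow> real" where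
  "L2_norm S f = sqrt (L2_inner S f f)"

definition L20 :: "(real^2) set \<Rightarrow> (real^2 \<Rightarrow> real) set" where
  "L20 \<Omega> = {q \<in> L2 \<Omega>. (LINT x|lebesgue_on \<Omega>. q x) = 0}"

definition ess_range :: "(real^2) set \<Rightarrow> (real^2 \<Rightarrow> real) \<Rightarrow> real set" where
  "ess_range \<Omega> f = {y. \<forall>e>0. emeasure (lebesgue_on \<Omega>) {x \<in> \<Omega>. \<bar>f x - y\<bar> < e} > 0}"

section \<open>Weak derivatives and Sobolev spaces\<close>

definition partial_deriv :: "2 \<Rightarrow> (real^2 \<Rightarrow> real) \<Rightarrow> real^2 \<Rightarrow> real" where
  "partial_deriv i f x = frechet_derivative f (at x) (axis i 1)"

primrec C_k :: "nat \<Rightarrow> (real^2 \<Rightarrow> real) \<Rightarrow> bool" where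
  "C_k 0 f \<longleftrightarrow> continuous_on UNIV f"
| "C_k (Suc k) f \<longleftrightarrow> (\<forall>x. f differentiable (at x)) \<and> (\<forall>i. C_k k (partial_deriv i f))"

definition smooth :: "(real^2 \<Rightarrow> real) \<Rightarrow> bool" where
  "smooth f \<longleftrightarrow> (\<forall>k. C_k k f)"

definition test_functions :: "(real^2) set \<Rightarrow> (real^2 \<Rightarrow> real) set" where
  "test_functions \<Omega> = {\<phi>. smooth \<phi> \<and> compact (closure {x. \<phi> x \<noteq> 0}) \<and> closure {x. \<phi> x \<noteq> 0} \<subseteq> \<Omega>}"

type_synonym multi_index = "2 \<Rightarrow> nat"

definition mi_order :: "multi_index \<Rightarrow> nat" where
  "mi_order \<alpha> = (\<Sum>i\<in>UNIV. \<alpha> i)"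

text \<open>The multi-index \<open>k e\<^sub>i\<close>.\<close>

definition mi_single :: "nat \<Rightarrow> 2 \<Rightarrow> multi_index" where
  "mi_single k i = (\<lambda>j. if j = i then k else 0)"

definition mi_deriv :: "multi_index \<Rightarrow> (real^2 \<Rightarrow> real) \<Rightarrow> real^2 \<Rightarrow> real" where
  "mi_deriv \<alpha> \<phi> = (partial_deriv 1 ^^ \<alpha> 1) ((partial_deriv 2 ^^ \<alpha> 2) \<phi>)"

definition has_weak_deriv ::
    "(real^2) set \<Rightarrow> multi_index \<Rightarrow> (real^2 \<Rightarrow> real) \<Rightarrow> (real^2 \<Rightarrow> real) \<Rightarrow> bool" where
  "has_weak_deriv \<Omega> \<alpha> u g \<longleftrightarrow>
     (\<forall>\<phi>\<in>test_functions \<Omega>.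
        L2_inner \<Omega> u (mi_deriv \<alpha> \<phi>) = (-1) ^ mi_order \<alpha> * L2_inner \<Omega> g \<phi>)"

text \<open>A representative of the weak derivative, unique up to null sets and meaningful only if a
  square-integrable weak derivative exists.\<close>

definition weak_deriv :: "(real^2) set \<Rightarrow> multi_index \<Rightarrow> (real^2 \<Rightarrow> real) \<Rightarrow> real^2 \<Rightarrow> real" where
  "weak_deriv \<Omega> \<alpha> u = (SOME g. g \<in> L2 \<Omega> \<and> has_weak_deriv \<Omega> \<alpha> u g)"

definition Hk :: "nat \<Rightarrow> (real^2) set \<Rightarrow> (real^2 \<Rightarrow> real) set" where
  "Hk k \<Omega> = {u \<in> L2 \<Omega>. \<forall>\<alpha>. mi_order \<alpha> \<le> k \<longrightarrow> (\<exists>g\<in>L2 \<Omega>. has_weak_deriv \<Omega> \<alpha> u g)}"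

definition Hk_norm :: "nat \<Rightarrow> (real^2) set \<Rightarrow> (real^2 \<Rightarrow> real) \<Rightarrow> real" where
  "Hk_norm k \<Omega> u = sqrt (\<Sum>\<alpha>\<in>{\<alpha>. mi_order \<alpha> \<le> k}. (L2_norm \<Omega> (weak_deriv \<Omega> \<alpha> u))\<^sup>2)"

definition H10 :: "(real^2) set \<Rightarrow> (real^2 \<Rightarrow> real) set" where
  "H10 \<Omega> = {u \<in> Hk 1 \<Omega>. \<forall>e>0. \<exists>\<phi>\<in>test_functions \<Omega>. Hk_norm 1 \<Omega> (\<lambda>x. u x - \<phi> x) < e}"

definition vec_space :: "(real^2 \<Rightarrow> real) set \<Rightarrow> (real^2 \<Rightarrow> real^2) set" where
  "vec_space X = {u. \<forall>i. (\<lambda>x. u x $ i) \<in> X}"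

definition Hk_norm_vec :: "nat \<Rightarrow> (real^2) set \<Rightarrow> (real^2 \<Rightarrow> real^2) \<Rightarrow> real" where
  "Hk_norm_vec k \<Omega> u = sqrt (\<Sum>i\<in>UNIV. (Hk_norm k \<Omega> (\<lambda>x. u x $ i))\<^sup>2)"

definition grad :: "(real^2) set \<Rightarrow> (real^2 \<Rightarrow> real) \<Rightarrow> real^2 \<Rightarrow> real^2" where
  "grad \<Omega> u x = (\<chi> i. weak_deriv \<Omega> (mi_single 1 i) u x)"

definition laplace :: "(real^2) set \<Rightarrow> (real^2 \<Rightarrow> real) \<Rightarrow> real^2 \<Rightarrow> real" where
  "laplace \<Omega> u x = (\<Sum>i\<in>UNIV. weak_deriv \<Omega> (mi_single 2 i) u x)"

definition jacobian :: "(real^2) set \<Rightarrow> (real^2 \<Rightarrow> real^2) \<Rightarrow> real^2 \<Rightarrow> real^2^2" where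
  "jacobian \<Omega> u x = (\<chi> i. grad \<Omega> (\<lambda>y. u y $ i) x)"

definition sym_grad :: "(real^2) set \<Rightarrow> (real^2 \<Rightarrow> real^2) \<Rightarrow> real^2 \<Rightarrow> real^2^2" where
  "sym_grad \<Omega> u x = (1/2) *\<^sub>R (jacobian \<Omega> u x + transpose (jacobian \<Omega> u x))"

definition divergence :: "(real^2) set \<Rightarrow> (real^2 \<Rightarrow> real^2) \<Rightarrow> real^2 \<Rightarrow> real" where
  "divergence \<Omega> u x = (\<Sum>i\<in>UNIV. grad \<Omega> (\<lambda>y. u y $ i) x $ i)"

section \<open>Convex polygons and boundary conditions\<close>

definition convex_polygonal_domain :: "(real^2) set \<Rightarrow> bool" where
  "convex_polygonal_domain \<Omega> \<longleftrightarrow>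
     open \<Omega> \<and> \<Omega> \<noteq> {} \<and> bounded \<Omega> \<and> connected \<Omega> \<and> convex \<Omega> \<and> polytope (closure \<Omega>)"

definition outer_unit_normal :: "(real^2) set \<Rightarrow> (real^2) set \<Rightarrow> real^2 \<Rightarrow> bool" where
  "outer_unit_normal \<Omega> E \<nu> \<longleftrightarrow>
     norm \<nu> = 1 \<and> (\<exists>b. (\<forall>x\<in>E. \<nu> \<bullet> x = b) \<and> (\<forall>x\<in>\<Omega>. \<nu> \<bullet> x \<le> b))"

text \<open>\<open>g\<close> is the trace of \<open>v \<in> H\<^sup>1(\<Omega>)\<close> on the boundary segment from \<open>a\<close> to \<open>b\<close>: the trace
  operator is the \<open>H\<^sup>1\<close>-\<open>L\<^sup>2\<close> continuous extension of the restriction of functions that are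
  smooth up to the boundary. The constant arc length factor is dropped, as it
  does not affect convergence.\<close>

definition has_edge_trace ::
    "(real^2) set \<Rightarrow> real^2 \<Rightarrow> real^2 \<Rightarrow> (real^2 \<Rightarrow> real) \<Rightarrow> (real^2 \<Rightarrow> real) \<Rightarrow> bool" where
  "has_edge_trace \<Omega> a b v g \<longleftrightarrow>
     v \<in> Hk 1 \<Omega> \<and> (\<lambda>t. g (linepath a b t)) \<in> L2 {0..1} \<and>
     (\<exists>\<phi> :: nat \<Rightarrow> real^2 \<Rightarrow> real. (\<forall>n. smooth (\<phi> n)) \<and>
        (\<lambda>n. Hk_norm 1 \<Omega> (\<lambda>x. v x - \<phi> n x)) \<longlonglongrightarrow> 0 \<and>
        (\<lambda>n. L2_norm {0..1} (\<lambda>t. g (linepath a b t) - \<phi> n (linepath a b t))) \<longlonglongrightarrow> 0)"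

definition normal_deriv_zero :: "(real^2) set \<Rightarrow> (real^2 \<Rightarrow> real) \<Rightarrow> bool" where
  "normal_deriv_zero \<Omega> c \<longleftrightarrow>
     (\<forall>a b \<nu>. closed_segment a b edge_of closure \<Omega> \<longrightarrow>
        outer_unit_normal \<Omega> (closed_segment a b) \<nu> \<longrightarrow>
        has_edge_trace \<Omega> a b (\<lambda>x. \<nu> \<bullet> grad \<Omega> c x) (\<lambda>_. 0))"

section \<open>Triangulations and Lagrange finite elements\<close>

text \<open>The library's \<^const>\<open>triangulation\<close> already demands that two cells meet in a common face.\<close>

definition conforming_triangulation :: "(real^2) set \<Rightarrow> (real^2) set set \<Rightarrow> bool" where
  "conforming_triangulation \<Omega> T \<longleftrightarrow>
     triangulation T \<and> (\<forall>K\<in>T. 2 simplex K) \<and> \<Union>T = closure \<Omega>"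

definition inradius :: "(real^2) set \<Rightarrow> real" where
  "inradius K = Sup {r. 0 \<le> r \<and> (\<exists>x. cball x r \<subseteq> K)}"

text \<open>A family indexed by an arbitrary set \<open>H\<close> of positive mesh parameters. The parameter
  only bounds the diameters of the cells, so that both \<open>h = max diam K\<close> and families indexed by
  all \<open>h > 0\<close> are covered.\<close>

definition shape_regular_family ::
    "(real^2) set \<Rightarrow> real set \<Rightarrow> (real \<Rightarrow> (real^2) set set) \<Rightarrow> bool" where
  "shape_regular_family \<Omega> H T \<longleftrightarrow>
     (\<forall>h\<in>H. 0 < h \<and> conforming_triangulation \<Omega> (T h) \<and> (\<forall>K\<in>T h. diameter K \<le> h)) \<and>
     (\<exists>\<sigma>>0. \<forall>h\<in>H. \<forall>K\<in>T h. diameter K \<le> \<sigma> * inradius K)"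

definition poly_deg_le :: "nat \<Rightarrow> (real^2 \<Rightarrow> real) set" where
  "poly_deg_le k =
     {p. \<exists>a :: multi_index \<Rightarrow> real.
           p = (\<lambda>x. \<Sum>\<alpha>\<in>{\<alpha>. mi_order \<alpha> \<le> k}. a \<alpha> * (\<Prod>i\<in>UNIV. (x $ i) ^ \<alpha> i))}"

definition lagrange_space ::
    "(real^2) set \<Rightarrow> (real^2) set set \<Rightarrow> nat \<Rightarrow> (real^2 \<Rightarrow> real) set" where
  "lagrange_space \<Omega> T k =
     {v. continuous_on (closure \<Omega>) v \<and> (\<forall>K\<in>T. \<exists>p\<in>poly_deg_le k. \<forall>x\<in>K. v x = p x)}"

definition Vh0 :: "(real^2) set \<Rightarrow> (real^2) set set \<Rightarrow> nat \<Rightarrow> (real^2 \<Rightarrow> real) set" where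
  "Vh0 \<Omega> T k = lagrange_space \<Omega> T k \<inter> L20 \<Omega>"

definition Uh :: "(real^2) set \<Rightarrow> (real^2) set set \<Rightarrow> nat \<Rightarrow> (real^2 \<Rightarrow> real^2) set" where
  "Uh \<Omega> T k = vec_space (lagrange_space \<Omega> T k \<inter> H10 \<Omega>)"

definition approximation_properties ::
    "(real^2) set \<Rightarrow> real set \<Rightarrow> (real \<Rightarrow> (real^2) set set) \<Rightarrow> nat \<Rightarrow> nat \<Rightarrow> nat \<Rightarrow> bool" where
  "approximation_properties \<Omega> H T rc rp ru \<longleftrightarrow>
     (\<exists>C. \<forall>h\<in>H.
        (\<forall>v\<in>Hk (rc + 1) \<Omega>.
           (INF vh\<in>lagrange_space \<Omega> (T h) rc. Hk_norm 1 \<Omega> (\<lambda>x. v x - vh x))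
             \<le> C * h ^ rc * Hk_norm (rc + 1) \<Omega> v) \<and>
        (\<forall>q\<in>Hk (rp + 1) \<Omega> \<inter> L20 \<Omega>.
           (INF qh\<in>Vh0 \<Omega> (T h) rp. L2_norm \<Omega> (\<lambda>x. q x - qh x))
             \<le> C * h ^ (rp + 1) * Hk_norm (rp + 1) \<Omega> q) \<and>
        (\<forall>z\<in>vec_space (Hk (ru + 1) \<Omega> \<inter> H10 \<Omega>).
           (INF zh\<in>Uh \<Omega> (T h) ru. Hk_norm_vec 1 \<Omega> (\<lambda>x. z x - zh x))
             \<le> C * h ^ ru * Hk_norm_vec (ru + 1) \<Omega> z))"

text \<open>The discrete inverse Laplacian; its value is unique on \<open>closure \<Omega>\<close> only.\<close>

definition disc_inv_laplace ::
    "(real^2) set \<Rightarrow> (real^2) set set \<Rightarrow> nat \<Rightarrow> (real^2 \<Rightarrow> real) \<Rightarrow> real^2 \<Rightarrow> real" where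
  "disc_inv_laplace \<Omega> T k g =
     (SOME w. w \<in> Vh0 \<Omega> T k \<and>
        (\<forall>v\<in>Vh0 \<Omega> T k. L2_inner \<Omega> (grad \<Omega> w) (grad \<Omega> v) = L2_inner \<Omega> g v))"

definition disc_neg_norm ::
    "(real^2) set \<Rightarrow> (real^2) set set \<Rightarrow> nat \<Rightarrow> (real^2 \<Rightarrow> real) \<Rightarrow> real" where
  "disc_neg_norm \<Omega> T k g = L2_norm \<Omega> (grad \<Omega> (disc_inv_laplace \<Omega> T k g))"

section \<open>Convex-splitting step and auxiliary problem\<close>

text \<open>Trial and test space are both \<open>X\<close>: \<open>X = H\<^sup>1(\<Omega>)\<close> gives the continuous scheme and
  \<open>X = V\<^sub>h\<close> the discrete one.\<close>

definition convex_splitting_step ::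
    "(real^2) set \<Rightarrow> (real^2 \<Rightarrow> real) set \<Rightarrow> real \<Rightarrow> real \<Rightarrow> real \<Rightarrow> (real \<Rightarrow> real) \<Rightarrow> (real \<Rightarrow> real) \<Rightarrow>
     (real^2 \<Rightarrow> real) \<Rightarrow> (real^2 \<Rightarrow> real) \<Rightarrow> (real^2 \<Rightarrow> real) \<Rightarrow> bool" where
  "convex_splitting_step \<Omega> X m \<epsilon> \<tau> fc fe cn c \<mu> \<longleftrightarrow>
     c \<in> X \<and> \<mu> \<in> X \<and>
     (\<forall>v\<in>X. L2_inner \<Omega> (\<lambda>x. (c x - cn x) / \<tau>) v
             + m * L2_inner \<Omega> (grad \<Omega> \<mu>) (grad \<Omega> v) = 0) \<and>
     (\<forall>w\<in>X. L2_inner \<Omega> \<mu> w - \<epsilon>\<^sup>2 * L2_inner \<Omega> (grad \<Omega> c) (grad \<Omega> w)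
             - L2_inner \<Omega> (\<lambda>x. deriv fc (c x) - deriv fe (cn x)) w = 0)"

text \<open>Likewise \<open>Q = L\<^sup>2\<^sub>0(\<Omega>)\<close>, \<open>U = [H\<^sup>1\<^sub>0(\<Omega>)]\<^sup>2\<close> for the continuous problem and
  \<open>Q = Q\<^sub>h\<close>, \<open>U = U\<^sub>h\<close> for the discrete one.\<close>

definition auxiliary_pair ::
    "(real^2) set \<Rightarrow> (real^2 \<Rightarrow> real) set \<Rightarrow> (real^2 \<Rightarrow> real^2) set \<Rightarrow> (real^2 \<Rightarrow> real) \<Rightarrow>
     (real^2 \<Rightarrow> real) \<Rightarrow> (real^2 \<Rightarrow> real^2) \<Rightarrow> bool" where
  "auxiliary_pair \<Omega> Q U r p u \<longleftrightarrow>
     p \<in> Q \<and> u \<in> U \<and>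
     (\<forall>q\<in>Q. L2_inner \<Omega> (\<lambda>x. 2 * p x + divergence \<Omega> u x) q = L2_inner \<Omega> r q) \<and>
     (\<forall>z\<in>U. L2_inner \<Omega> (sym_grad \<Omega> u) (sym_grad \<Omega> z) + L2_inner \<Omega> p (divergence \<Omega> z) = 0)"

end

theory Submission
  imports Defs "HOL-Computational_Algebra.Polynomial" "HOL-Library.Function_Algebras"
begin

text \<open>
  The differences of the two schemes satisfy Galerkin orthogonality, and the theorem follows from two
  energy estimates for the distance of the discrete solutions to arbitrary elements \<open>c\<^sup>*, \<mu>\<^sup>*, q\<^sub>h, z\<^sub>h\<close> of
  the finite element spaces. For the convex splitting step one tests the evolution equation with
  \<open>\<mu>\<^sup>* - \<mu>\<^sub>h\<close> and the potential equation with \<open>c\<^sup>* - c\<^sub>h\<close>; monotonicity of \<open>f\<^sub>c'\<close> and the Lipschitz bound on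
  \<open>I\<close> control the nonlinearity, and conservation of mass makes the Poincare inequality applicable. For the
  auxiliary problem coercivity comes from Korn's identity \<open>2 \<parallel>Dz\<parallel>\<^sup>2 = \<parallel>\<nabla>z\<parallel>\<^sup>2 + \<parallel>div z\<parallel>\<^sup>2\<close> on \<open>H\<^sup>1\<^sub>0\<close>,
  which needs no discrete inf-sup condition.

  The weak derivatives of a finite element function are obtained from its Lipschitz continuity: difference
  quotients converge almost everywhere and boundedly, and translation invariance of the integral
  replaces integration by parts. The same device proves Poincare's inequality, since
  \<open>\<parallel>v(\<cdot> + a) - v\<parallel> \<le> |a| \<parallel>\<nabla>v\<parallel>\<close> integrated over all \<open>a\<close> bounds the double integral of \<open>(v(y) - v(x))\<^sup>2\<close>.
  The norm \<open>\<parallel>\<cdot>\<parallel>\<^sub>-\<^sub>1\<^sub>,\<^sub>h\<close> of the error is bounded by its \<open>L\<^sup>2\<close> norm, so that the negative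
  norm on the right-hand side is only used as a nonnegative quantity.
\<close>

text \<open>Functions are total and matter only on \<Omega> up to null sets, while
  \<open>weak_deriv\<close> and \<open>disc_inv_laplace\<close> are choices. So the gradient is
  linear only almost everywhere, which rests on uniqueness of weak derivatives, and each choice
  needs an existence proof. For the inverse Laplacian this is finite-dimensional linear algebra,
  although a finite element space of total functions is not finite-dimensional: its members are
  arbitrary off the closure of \<Omega>.

  Constants must not see the mesh, hence Poincare's inequality is proved for all Lipschitz functions
  at once, with a constant made of the diameter and the measure of \<Omega>. It reaches only
  mean-free functions: the approximation of \<open>c\<close> is shifted by a constant, and the mean
  of the error of \<mu> is recovered by testing the potential equation with 1.

  In the auxiliary problem the two coupling terms add up instead of cancelling. With a and b the
  norms of the discrete errors in p and Du, the tested equations leave 2 a^2 - 2 a b + b^2 = a^2 +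
  (a - b)^2, which is coercive because of the factor 2 in front of p and the constant 1 in ||div z||
  \<le> ||Dz||.\<close>

text \<open>Otherwise the simplifier rewrites \<open>Hk 1\<close> to \<open>Hk (Suc 0)\<close>.\<close>

declare One_nat_def [simp del]

section \<open>The space \<open>L\<^sup>2\<close>\<close>

lemma L2_measurable: "f \<in> L2 S \<Longrightarrow> f \<in> borel_measurable (lebesgue_on S)"
  by (simp add: L2_def)

lemma L2_integrable_inner:
  assumes "f \<in> L2 S" "g \<in> L2 S"
  shows "integrable (lebesgue_on S) (\<lambda>x. f x \<bullet> g x)"
proof (rule Bochner_Integration.integrable_bound)
  show "integrable (lebesgue_on S) (\<lambda>x. (norm (f x))\<^sup>2 + (norm (g x))\<^sup>2)"
    using assms by (simp add: L2_def)
  show "(\<lambda>x. f x \<bullet> g x) \<in> borel_measurable (lebesgue_on S)"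
    using assms by (intro borel_measurable_inner) (auto simp: L2_def)
  show "AE x in lebesgue_on S. norm (f x \<bullet> g x) \<le> norm ((norm (f x))\<^sup>2 + (norm (g x))\<^sup>2)"
  proof (rule AE_I2)
    fix x
    have "\<bar>f x \<bullet> g x\<bar> \<le> norm (f x) * norm (g x)" by (rule Cauchy_Schwarz_ineq2)
    moreover have "0 \<le> (norm (f x) - norm (g x))\<^sup>2" "0 \<le> norm (f x) * norm (g x)" by simp_all
    ultimately show "norm (f x \<bullet> g x) \<le> norm ((norm (f x))\<^sup>2 + (norm (g x))\<^sup>2)"
      unfolding power2_diff real_norm_def by linarith
  qed
qed

lemma L2_bounded_cong_AE:
  assumes "f \<in> borel_measurable (lebesgue_on S)" "g \<in> L2 S"
    "AE x in lebesgue_on S. norm (f x) \<le> norm (g x)"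
  shows "f \<in> L2 S"
  unfolding L2_def
proof (intro CollectI conjI)
  show "integrable (lebesgue_on S) (\<lambda>x. (norm (f x))\<^sup>2)"
    by (rule Bochner_Integration.integrable_bound[where f="\<lambda>x. (norm (g x))\<^sup>2"])
      (use assms in \<open>auto simp: L2_def\<close>)
qed fact

lemma L2_norm_fun:
  assumes "f \<in> L2 S"
  shows "(\<lambda>x. norm (f x)) \<in> L2 S"
  using assms by (auto simp: L2_def)

lemma L2_add:
  assumes "f \<in> L2 S" "g \<in> L2 S"
  shows "(\<lambda>x. f x + g x) \<in> L2 S"
proof -
  have "(\<lambda>x. (norm (f x))\<^sup>2 + 2 * (f x \<bullet> g x) + (norm (g x))\<^sup>2) = (\<lambda>x. (norm (f x + g x))\<^sup>2)"
    by (simp add: power2_norm_eq_inner inner_add inner_commute algebra_simps)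
  moreover have "integrable (lebesgue_on S) (\<lambda>x. (norm (f x))\<^sup>2 + 2 * (f x \<bullet> g x) + (norm (g x))\<^sup>2)"
    using assms L2_integrable_inner[OF assms] by (auto simp: L2_def)
  ultimately show ?thesis
    using assms borel_measurable_add[of f "lebesgue_on S" g] by (simp add: L2_def)
qed

lemma L2_scaleR:
  assumes "f \<in> L2 S"
  shows "(\<lambda>x. a *\<^sub>R f x) \<in> L2 S"
  using assms by (auto simp: L2_def power_mult_distrib)

lemma L2_mult:
  fixes f :: "'a::euclidean_space \<Rightarrow> real"
  shows "f \<in> L2 S \<Longrightarrow> (\<lambda>x. a * f x) \<in> L2 S"
  using L2_scaleR[of f S a] by simp

lemma L2_uminus: "f \<in> L2 S \<Longrightarrow> (\<lambda>x. - f x) \<in> L2 S"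
  using L2_scaleR[of f S "-1"] by simp

lemma L2_diff:
  assumes "f \<in> L2 S" "g \<in> L2 S"
  shows "(\<lambda>x. f x - g x) \<in> L2 S"
  using L2_add[OF assms(1) L2_uminus[OF assms(2)]] by simp

lemma L2_zero: "(\<lambda>x. 0) \<in> L2 S"
  by (simp add: L2_def)

lemma L2_sum:
  assumes "finite A" "\<And>i. i \<in> A \<Longrightarrow> f i \<in> L2 S"
  shows "(\<lambda>x. \<Sum>i\<in>A. f i x) \<in> L2 S"
  using assms by (induction A rule: finite_induct) (auto intro: L2_add L2_zero)

lemma L2_inner_commute: "L2_inner S f g = L2_inner S g f"
  by (simp add: L2_inner_def inner_commute)

lemma L2_inner_add_left:
  assumes "f \<in> L2 S" "g \<in> L2 S" "k \<in> L2 S"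
  shows "L2_inner S (\<lambda>x. f x + g x) k = L2_inner S f k + L2_inner S g k"
  unfolding L2_inner_def inner_add_left
  by (intro Bochner_Integration.integral_add L2_integrable_inner assms)

lemma L2_inner_scaleR_left: "L2_inner S (\<lambda>x. a *\<^sub>R f x) k = a * L2_inner S f k"
  by (simp add: L2_inner_def)

lemma L2_inner_mult_left:
  "L2_inner S (\<lambda>x. a * f x) k = a * L2_inner S f (k :: _ \<Rightarrow> real)"
  using L2_inner_scaleR_left[of S a f k] by simp

lemma L2_inner_diff_left:
  assumes "f \<in> L2 S" "g \<in> L2 S" "k \<in> L2 S"
  shows "L2_inner S (\<lambda>x. f x - g x) k = L2_inner S f k - L2_inner S g k"
  unfolding L2_inner_def inner_diff_left
  by (intro Bochner_Integration.integral_diff L2_integrable_inner assms)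

lemma L2_inner_add_right:
  assumes "f \<in> L2 S" "g \<in> L2 S" "k \<in> L2 S"
  shows "L2_inner S k (\<lambda>x. f x + g x) = L2_inner S k f + L2_inner S k g"
  using L2_inner_add_left[OF assms] by (simp add: L2_inner_commute)

lemma L2_inner_diff_right:
  assumes "f \<in> L2 S" "g \<in> L2 S" "k \<in> L2 S"
  shows "L2_inner S k (\<lambda>x. f x - g x) = L2_inner S k f - L2_inner S k g"
  using L2_inner_diff_left[OF assms] by (simp add: L2_inner_commute)

lemma L2_inner_mult_right:
  "L2_inner S k (\<lambda>x. a * f x) = a * L2_inner S k (f :: _ \<Rightarrow> real)"
  using L2_inner_mult_left[of S a f k] by (simp add: L2_inner_commute)

lemma L2_inner_scaleR_right: "L2_inner S k (\<lambda>x. a *\<^sub>R f x) = a * L2_inner S k f"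
  by (simp add: L2_inner_def)

lemma L2_inner_sum_right:
  assumes "finite A" "k \<in> L2 S" "\<And>i. i \<in> A \<Longrightarrow> f i \<in> L2 S"
  shows "L2_inner S k (\<lambda>x. \<Sum>i\<in>A. f i x) = (\<Sum>i\<in>A. L2_inner S k (f i))"
  using assms
proof (induction A rule: finite_induct)
  case empty
  then show ?case by (simp add: L2_inner_def)
next
  case (insert i A)
  then show ?case by (simp add: L2_inner_add_right L2_sum)
qed

lemma L2_inner_cong_AE:
  assumes "f \<in> L2 S" "f' \<in> L2 S" "k \<in> L2 S" "AE x in lebesgue_on S. f x = f' x"
  shows "L2_inner S f k = L2_inner S f' k"
  unfolding L2_inner_def
  by (intro integral_cong_AE) (use assms in \<open>auto simp: L2_def\<close>)

lemma L2_inner_nonneg: "0 \<le> L2_inner S f f"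
  by (simp add: L2_inner_def)

lemma L2_norm_nonneg [simp]: "0 \<le> L2_norm S f"
  by (simp add: L2_norm_def L2_inner_nonneg)

lemma L2_norm_power2: "(L2_norm S f)\<^sup>2 = L2_inner S f f"
  by (simp add: L2_norm_def L2_inner_nonneg)

lemma L2_inner_zero_norm:
  assumes "f \<in> L2 S" "g \<in> L2 S" "L2_inner S g g = 0"
  shows "L2_inner S f g = 0" "AE x in lebesgue_on S. g x = 0"
proof -
  show *: "AE x in lebesgue_on S. g x = 0"
    using integral_nonneg_eq_0_iff_AE[OF L2_integrable_inner[OF assms(2,2)]] assms(3)
    by (simp add: L2_inner_def)
  have "L2_inner S g f = L2_inner S (\<lambda>x. 0) f"
    by (rule L2_inner_cong_AE[OF assms(2) L2_zero assms(1) *])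
  then show "L2_inner S f g = 0"
    by (simp add: L2_inner_commute L2_inner_def)
qed

text \<open>Expanding ||C f - B g||^2 \<ge> 0 gives C (C A - B^2) \<ge> 0, where C > 0 cancels. For
  C = 0 the function g is null and B vanishes.\<close>

lemma L2_inner_le_norm:
  assumes "f \<in> L2 S" "g \<in> L2 S"
  shows "\<bar>L2_inner S f g\<bar> \<le> L2_norm S f * L2_norm S g"
proof -
  define A B C where "A = L2_inner S f f" and "B = L2_inner S f g" and "C = L2_inner S g g"
  have "B\<^sup>2 \<le> A * C"
  proof (cases "C = 0")
    case True
    then show ?thesis
      using L2_inner_zero_norm[OF assms] by (simp add: B_def C_def)
  next
    case False
    then have "C > 0" using L2_inner_nonneg[of S g] by (simp add: C_def)
    have "0 \<le> L2_inner S (\<lambda>x. C *\<^sub>R f x - B *\<^sub>R g x) (\<lambda>x. C *\<^sub>R f x - B *\<^sub>R g x)"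
      by (rule L2_inner_nonneg)
    also have "\<dots> = C * (C * A - B\<^sup>2)"
      using assms by (simp add: L2_inner_diff_left L2_inner_diff_right L2_diff L2_scaleR
          L2_inner_scaleR_left L2_inner_scaleR_right A_def B_def C_def L2_inner_commute[of S g f]
          algebra_simps power2_eq_square)
    finally show ?thesis using \<open>C > 0\<close> by (simp add: zero_le_mult_iff mult.commute)
  qed
  then have "sqrt (B\<^sup>2) \<le> sqrt (A * C)" by (rule real_sqrt_le_mono)
  then show ?thesis by (simp add: A_def B_def C_def L2_norm_def real_sqrt_mult)
qed

lemma L2_norm_triangle:
  assumes "f \<in> L2 S" "g \<in> L2 S"
  shows "L2_norm S (\<lambda>x. f x + g x) \<le> L2_norm S f + L2_norm S g"
proof (rule power2_le_imp_le)
  have "(L2_norm S (\<lambda>x. f x + g x))\<^sup>2 = (L2_norm S f)\<^sup>2 + 2 * L2_inner S f g + (L2_norm S g)\<^sup>2"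
    using assms by (simp add: L2_norm_power2 L2_inner_add_left L2_inner_add_right L2_add
        L2_inner_commute[of S g f])
  also have "\<dots> \<le> (L2_norm S f + L2_norm S g)\<^sup>2"
    using L2_inner_le_norm[OF assms] by (simp add: power2_sum)
  finally show "(L2_norm S (\<lambda>x. f x + g x))\<^sup>2 \<le> (L2_norm S f + L2_norm S g)\<^sup>2" .
qed simp

lemma L2_norm_scaleR: "L2_norm S (\<lambda>x. a *\<^sub>R f x) = \<bar>a\<bar> * L2_norm S f"
  by (simp add: L2_norm_def L2_inner_scaleR_left L2_inner_scaleR_right real_sqrt_mult
      flip: mult.assoc)

lemma L2_norm_mult: "L2_norm S (\<lambda>x. a * f x) = \<bar>a\<bar> * L2_norm S (f :: _ \<Rightarrow> real)"
  using L2_norm_scaleR[of S a f] by simp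

lemma L2_norm_triangle_diff:
  assumes "f \<in> L2 S" "g \<in> L2 S"
  shows "L2_norm S (\<lambda>x. f x - g x) \<le> L2_norm S f + L2_norm S g"
  using L2_norm_triangle[OF assms(1) L2_uminus[OF assms(2)]] L2_norm_scaleR[of S "-1" g] by simp

lemma L2_norm_cong_AE:
  assumes "f \<in> L2 S" "g \<in> L2 S" "AE x in lebesgue_on S. f x = g x"
  shows "L2_norm S f = L2_norm S g"
  using L2_inner_cong_AE[OF assms(1,2,1,3)] L2_inner_cong_AE[OF assms(1,2,2,3)]
  by (simp add: L2_norm_def L2_inner_commute)

lemma L2_norm_mono_AE:
  assumes "f \<in> L2 S" "g \<in> L2 S" "AE x in lebesgue_on S. norm (f x) \<le> norm (g x)"
  shows "L2_norm S f \<le> L2_norm S g"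
  unfolding L2_norm_def L2_inner_def
proof (intro real_sqrt_le_mono integral_mono_AE L2_integrable_inner assms)
  show "AE x in lebesgue_on S. f x \<bullet> f x \<le> g x \<bullet> g x"
    using assms(3) by eventually_elim (simp add: norm_le)
qed

section \<open>Vector-valued square-integrable functions\<close>

lemma norm_axis [simp]: "norm (axis i x :: 'b::real_inner ^ 'n) = norm x"
  by (simp add: norm_eq_sqrt_inner inner_axis_axis)

text \<open>Coordinates are continuous, and f is the finite sum of its coordinates placed on the
  axes. The component type is an arbitrary Euclidean space, so that matrix fields in
  \<open>real^2^2\<close> are covered by two applications.\<close>

lemma L2_vec_iff:
  "f \<in> L2 S \<longleftrightarrow> (\<forall>i. (\<lambda>x. f x $ i) \<in> L2 S)" for f :: "'a::euclidean_space \<Rightarrow> 'b::euclidean_space ^ 'n"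
proof
  assume f: "f \<in> L2 S"
  show "\<forall>i. (\<lambda>x. f x $ i) \<in> L2 S"
  proof
    fix i
    have "(\<lambda>x. f x $ i) \<in> borel_measurable (lebesgue_on S)"
      by (rule borel_measurable_continuous_on[OF _ L2_measurable[OF f], of "\<lambda>y. y $ i"])
         (intro continuous_intros)
    then show "(\<lambda>x. f x $ i) \<in> L2 S"
      by (rule L2_bounded_cong_AE[OF _ f]) (auto intro: Finite_Cartesian_Product.norm_nth_le)
  qed
next
  assume *: "\<forall>i. (\<lambda>x. f x $ i) \<in> L2 S"
  have "(\<lambda>x. \<Sum>i\<in>UNIV. axis i (f x $ i)) \<in> L2 S"
  proof (rule L2_sum)
    fix i :: 'n
    have "(\<lambda>x. axis i (f x $ i) :: 'b^'n) \<in> borel_measurable (lebesgue_on S)"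
    proof (rule borel_measurable_continuous_on[of "\<lambda>y. axis i y :: 'b^'n"])
      show "continuous_on UNIV (\<lambda>y. axis i y :: 'b^'n)"
        by (intro linear_continuous_on bounded_linear_intro[where K=1])
           (simp_all, simp_all add: vec_eq_iff axis_def)
      show "(\<lambda>x. f x $ i) \<in> borel_measurable (lebesgue_on S)" using * by (simp add: L2_def)
    qed
    then show "(\<lambda>x. axis i (f x $ i)) \<in> L2 S"
      by (rule L2_bounded_cong_AE[OF _ *[rule_format, of i]]) simp
  qed simp
  moreover have "(\<lambda>x. \<Sum>i\<in>UNIV. axis i (f x $ i)) = f"
    by (auto simp: fun_eq_iff vec_eq_iff axis_def)
  ultimately show "f \<in> L2 S" by simp
qed

lemma L2_inner_vec:
  fixes f g :: "'a::euclidean_space \<Rightarrow> 'b::euclidean_space ^ 'n"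
  assumes "f \<in> L2 S" "g \<in> L2 S"
  shows "L2_inner S f g = (\<Sum>i\<in>UNIV. L2_inner S (\<lambda>x. f x $ i) (\<lambda>x. g x $ i))"
  unfolding L2_inner_def inner_vec_def
  using assms by (intro Bochner_Integration.integral_sum L2_integrable_inner) (auto simp: L2_vec_iff)

lemma finite_measure_lebesgue_on_bounded:
  assumes "bounded S" "S \<in> sets lebesgue"
  shows "finite_measure (lebesgue_on S)"
  using assms by (intro finite_measure_lebesgue_on) (simp add: bounded_set_imp_lmeasurable)

lemma L2_bounded:
  assumes "finite_measure (lebesgue_on S)" "f \<in> borel_measurable (lebesgue_on S)"
    "AE x in lebesgue_on S. norm (f x) \<le> B"
  shows "f \<in> L2 S"
proof -
  interpret finite_measure "lebesgue_on S" by fact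
  have "(\<lambda>x. B) \<in> L2 S" by (simp add: L2_def)
  then show ?thesis
    by (rule L2_bounded_cong_AE[OF assms(2)]) (use assms(3) in \<open>auto elim: eventually_mono\<close>)
qed

lemma L2_const:
  assumes "finite_measure (lebesgue_on S)"
  shows "(\<lambda>x. a) \<in> L2 S"
  by (rule L2_bounded[OF assms, of _ "norm a"]) auto

lemma L2_integrable:
  fixes f :: "'a::euclidean_space \<Rightarrow> real"
  assumes "finite_measure (lebesgue_on S)" "f \<in> L2 S"
  shows "integrable (lebesgue_on S) f"
  using L2_integrable_inner[OF assms(2) L2_const[OF assms(1), of 1]] by simp

lemma integral_eq_L2_inner_1:
  "(LINT x|lebesgue_on S. f x) = L2_inner S f (\<lambda>_. 1 :: real)"
  by (simp add: L2_inner_def)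

section \<open>Test functions and the fundamental lemma of the calculus of variations\<close>

text \<open>For p = 1 this is the classical function exp(-1/t) extended by 0. A polynomial in 1/t is
  carried along because differentiation produces such factors.\<close>

definition flat_exp :: "real poly \<Rightarrow> real \<Rightarrow> real" where
  "flat_exp p t = (if t \<le> 0 then 0 else poly p (1 / t) * exp (- (1 / t)))"

lemma poly_times_exp_minus_tendsto_0:
  "((\<lambda>s. poly p s * exp (- s)) \<longlongrightarrow> (0::real)) at_top"
proof -
  have "((\<lambda>s. \<Sum>i\<le>degree p. coeff p i * (s ^ i / exp s)) \<longlongrightarrow> (\<Sum>i\<le>degree p. coeff p i * 0)) at_top"
    by (intro tendsto_intros tendsto_power_div_exp_0)
  moreover have "(\<Sum>i\<le>degree p. coeff p i * (s ^ i / exp s)) = poly p s * exp (- s)" for s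
    by (simp add: poly_altdef sum_distrib_right exp_minus divide_inverse mult.assoc)
  ultimately show ?thesis by simp
qed

lemma flat_exp_tendsto_0: "(flat_exp p \<longlongrightarrow> 0) (at 0)"
proof (rule filterlim_split_at)
  have "(\<lambda>t. 0) \<midarrow>0\<rightarrow> (0::real)" by simp
  show "(flat_exp p \<longlongrightarrow> 0) (at_left 0)"
    by (rule Lim_transform_eventually[of "\<lambda>t. 0"])
       (auto simp: flat_exp_def eventually_at_left_field intro!: exI[of _ "-1"])
  have "((\<lambda>t. poly p (inverse t) * exp (- inverse t)) \<longlongrightarrow> 0) (at_right 0)"
    by (rule filterlim_compose[OF poly_times_exp_minus_tendsto_0 filterlim_inverse_at_top_right])
  then show "(flat_exp p \<longlongrightarrow> 0) (at_right 0)"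
    by (rule Lim_transform_eventually)
       (auto simp: flat_exp_def eventually_at_right_field inverse_eq_divide intro!: exI[of _ 1])
qed

text \<open>With s = 1/t, the derivative of p(s) exp(-s) with respect to t is s^2 (p(s) - p'(s))
  exp(-s). This is the origin of the new polynomial and shows that the family is closed under
  differentiation.\<close>

lemma flat_exp_has_real_derivative:
  "(flat_exp p has_real_derivative flat_exp (monom 1 2 * (p - pderiv p)) t) (at t)"
proof (cases t "0::real" rule: linorder_cases)
  case less
  have "((\<lambda>_. 0) has_real_derivative 0) (at t)" by simp
  then have "(flat_exp p has_real_derivative 0) (at t)"
    by (rule has_field_derivative_transform_within_open[where S="{..<0}"])
       (use less in \<open>auto simp: flat_exp_def\<close>)
  then show ?thesis using less by (simp add: flat_exp_def)
next
  case greater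
  have "((\<lambda>t. poly p (1 / t) * exp (- (1 / t))) has_real_derivative
      flat_exp (monom 1 2 * (p - pderiv p)) t) (at t)"
    using greater
    by (auto intro!: derivative_eq_intros DERIV_chain2[OF poly_DERIV]
        simp: flat_exp_def poly_monom field_simps power2_eq_square)
  then show ?thesis
    by (rule has_field_derivative_transform_within_open[where S="{0<..}"])
       (use greater in \<open>auto simp: flat_exp_def\<close>)
next
  case equal
  \<comment> \<open>Division by h multiplies a polynomial in 1/h by its variable, so for h \<noteq>
    0 the difference quotient at 0 is \<open>flat_exp (pCons 0 p) h\<close>, which tends to
    0.\<close>
  have "((\<lambda>h. (flat_exp p (0 + h) - flat_exp p 0) / h) \<longlongrightarrow> 0) (at 0)"
  proof (rule Lim_transform_eventually[OF flat_exp_tendsto_0[of "pCons 0 p"]])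
    show "\<forall>\<^sub>F h in at 0. flat_exp (pCons 0 p) h = (flat_exp p (0 + h) - flat_exp p 0) / h"
      by (auto simp: flat_exp_def eventually_at_filter)
  qed
  then show ?thesis
    using equal by (simp add: DERIV_def flat_exp_def)
qed

lemma smult_flat_exp: "c * flat_exp p t = flat_exp (smult c p) t"
  by (simp add: flat_exp_def)

lemma partial_deriv_eq:
  "(f has_derivative f') (at x) \<Longrightarrow> partial_deriv i f x = f' (axis i 1)"
  unfolding partial_deriv_def by (metis frechet_derivative_at)

text \<open>\<open>smooth\<close> is defined by recursion on partial derivatives, so a class of
  differentiable functions that contains the partial derivatives of its members consists of smooth
  functions. The free polynomial p absorbs the inner derivative of an affine argument, and sums and
  products are included for the product rule.\<close>

inductive_set flat_exp_algebra :: "(real^2 \<Rightarrow> real) set" where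
  base: "(\<lambda>x. flat_exp p (l \<bullet> x + d)) \<in> flat_exp_algebra"
| add: "f \<in> flat_exp_algebra \<Longrightarrow> g \<in> flat_exp_algebra \<Longrightarrow> (\<lambda>x. f x + g x) \<in> flat_exp_algebra"
| mult: "f \<in> flat_exp_algebra \<Longrightarrow> g \<in> flat_exp_algebra \<Longrightarrow> (\<lambda>x. f x * g x) \<in> flat_exp_algebra"

lemma partial_deriv_add:
  assumes "f differentiable (at x)" "g differentiable (at x)"
  shows "partial_deriv i (\<lambda>x. f x + g x) x = partial_deriv i f x + partial_deriv i g x"
  using partial_deriv_eq[OF has_derivative_add[OF assms[unfolded frechet_derivative_works]], of i]
  by (simp add: partial_deriv_def)

lemma partial_deriv_mult:
  assumes "f differentiable (at x)" "g differentiable (at x)"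
  shows "partial_deriv i (\<lambda>x. f x * g x) x = f x * partial_deriv i g x + partial_deriv i f x * g x"
  using partial_deriv_eq[OF has_derivative_mult[OF assms[unfolded frechet_derivative_works]], of i]
  by (simp add: partial_deriv_def)

lemma flat_exp_algebra_closed:
  "f \<in> flat_exp_algebra \<Longrightarrow>
    (\<forall>x. f differentiable (at x)) \<and> (\<forall>i. partial_deriv i f \<in> flat_exp_algebra)"
proof (induction rule: flat_exp_algebra.induct)
  case (base p l d)
  let ?p' = "monom 1 2 * (p - pderiv p)"
  have *: "((\<lambda>x. flat_exp p (l \<bullet> x + d)) has_derivative (\<lambda>h. (l \<bullet> h) * flat_exp ?p' (l \<bullet> x + d))) (at x)" for x
    by (rule has_derivative_in_compose2[where t=UNIV and g="flat_exp p" and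
          g'="\<lambda>y h. h * flat_exp ?p' y" and f="\<lambda>x. l \<bullet> x + d" and f'="\<lambda>h. l \<bullet> h", simplified])
       (auto intro!: derivative_eq_intros flat_exp_has_real_derivative[unfolded has_field_derivative_def,
          THEN has_derivative_eq_rhs] simp: mult.commute)
  have "partial_deriv i (\<lambda>x. flat_exp p (l \<bullet> x + d)) = (\<lambda>x. flat_exp (smult (l $ i) ?p') (l \<bullet> x + d))" for i
    using partial_deriv_eq[OF *] by (auto simp: fun_eq_iff inner_axis simp flip: smult_flat_exp)
  then show ?case
    using * by (auto simp: differentiable_def intro: flat_exp_algebra.base)
next
  case (add f g)
  then have "partial_deriv i (\<lambda>x. f x + g x) = (\<lambda>x. partial_deriv i f x + partial_deriv i g x)" for i
    by (auto intro!: partial_deriv_add)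
  with add show ?case by (auto intro: flat_exp_algebra.add)
next
  case (mult f g)
  then have "partial_deriv i (\<lambda>x. f x * g x) = (\<lambda>x. f x * partial_deriv i g x + partial_deriv i f x * g x)" for i
    by (auto intro!: partial_deriv_mult)
  with mult show ?case by (auto intro!: flat_exp_algebra.intros)
qed

lemma smooth_flat_exp_algebra:
  assumes "f \<in> flat_exp_algebra" shows "smooth f"
proof -
  have "C_k k f" if "f \<in> flat_exp_algebra" for k f
    using that
  proof (induction k arbitrary: f)
    case 0
    then show ?case
      using flat_exp_algebra_closed[OF 0] by (auto intro!: differentiable_imp_continuous_on
          simp: differentiable_on_def intro: differentiable_at_withinI)
  next
    case (Suc k)
    then show ?case using flat_exp_algebra_closed by auto
  qed
  with assms show ?thesis by (simp add: smooth_def)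
qed

text \<open>A factor with positive argument t tends to 1, since exp(-1/((n + 1) t)) does, and off
  the box some factor vanishes. The bumps are bounded by 1 and converge pointwise to the indicator
  of the open box, which suits dominated convergence.\<close>

definition box_bump :: "real^2 \<Rightarrow> real^2 \<Rightarrow> nat \<Rightarrow> real^2 \<Rightarrow> real" where
  "box_bump a b n x =
    flat_exp 1 (Suc n * (x $ 1 - a $ 1)) * flat_exp 1 (Suc n * (b $ 1 - x $ 1)) *
    (flat_exp 1 (Suc n * (x $ 2 - a $ 2)) * flat_exp 1 (Suc n * (b $ 2 - x $ 2)))"

lemma flat_exp_1_bounds: "0 \<le> flat_exp 1 t" "flat_exp 1 t \<le> 1"
  by (auto simp: flat_exp_def)

lemma smooth_box_bump: "smooth (box_bump a b n)"
proof -
  have 1: "(\<lambda>x. flat_exp 1 (Suc n * (x $ i - a $ i))) \<in> flat_exp_algebra" for i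
    using flat_exp_algebra.base[of 1 "axis i (real (Suc n))" "- Suc n * a $ i"]
    by (simp add: inner_axis' algebra_simps)
  have 2: "(\<lambda>x. flat_exp 1 (Suc n * (b $ i - x $ i))) \<in> flat_exp_algebra" for i
    using flat_exp_algebra.base[of 1 "- axis i (real (Suc n))" "Suc n * b $ i"]
    by (simp add: inner_axis' algebra_simps)
  show ?thesis
    unfolding box_bump_def[abs_def]
    by (intro smooth_flat_exp_algebra flat_exp_algebra.mult 1 2)
qed

lemma mem_box_2: "x \<in> box a b \<longleftrightarrow> a $ 1 < x $ 1 \<and> x $ 1 < b $ 1 \<and> a $ 2 < x $ 2 \<and> x $ 2 < b $ 2"
  for x :: "real^2"
  by (auto simp: mem_box_cart forall_2)

lemma box_bump_nonzero_imp: "box_bump a b n x \<noteq> 0 \<Longrightarrow> x \<in> box a b"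
  by (auto simp: box_bump_def mem_box_2 flat_exp_def mult_le_0_iff split: if_splits)

lemma box_bump_bounds: "\<bar>box_bump a b n x\<bar> \<le> 1"
  using flat_exp_1_bounds by (auto simp: box_bump_def abs_mult intro!: mult_le_one mult_nonneg_nonneg)

lemma flat_exp_1_scaled_tendsto:
  assumes "t > 0"
  shows "(\<lambda>n. flat_exp 1 (real (Suc n) * t)) \<longlonglongrightarrow> 1"
proof -
  have "(\<lambda>n. exp (- (inverse (real (Suc n)) * (1 / t)))) \<longlonglongrightarrow> exp (- (0 * (1 / t)))"
    by (intro tendsto_intros LIMSEQ_inverse_real_of_nat)
  moreover have "exp (- (inverse (real (Suc n)) * (1 / t))) = flat_exp 1 (real (Suc n) * t)" for n
    using assms by (auto simp: flat_exp_def mult_le_0_iff inverse_eq_divide)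
  ultimately show ?thesis by simp
qed

lemma box_bump_tendsto: "(\<lambda>n. box_bump a b n x) \<longlonglongrightarrow> indicator (box a b) x"
proof (cases "x \<in> box a b")
  case True
  then have "(\<lambda>n. box_bump a b n x) \<longlonglongrightarrow> 1 * 1 * (1 * 1)"
    unfolding box_bump_def
    by (intro tendsto_mult flat_exp_1_scaled_tendsto) (auto simp: mem_box_2)
  with True show ?thesis by simp
next
  case False
  then have "box_bump a b n x = 0" for n using box_bump_nonzero_imp by blast
  with False show ?thesis by simp
qed

lemma box_bump_test_function:
  assumes "cbox a b \<subseteq> \<Omega>"
  shows "box_bump a b n \<in> test_functions \<Omega>"
proof -
  have "{x. box_bump a b n x \<noteq> 0} \<subseteq> cbox a b"
    using box_bump_nonzero_imp box_subset_cbox by blast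
  then have "closure {x. box_bump a b n x \<noteq> 0} \<subseteq> cbox a b"
    by (rule closure_minimal[OF _ closed_cbox])
  moreover have "compact (closure {x. box_bump a b n x \<noteq> 0})"
    using bounded_subset[OF bounded_cbox \<open>{x. box_bump a b n x \<noteq> 0} \<subseteq> cbox a b\<close>] by simp
  ultimately show ?thesis
    using assms smooth_box_bump by (auto simp: test_functions_def)
qed

section \<open>The fundamental lemma\<close>

text \<open>Open boxes are stable under intersection and generate the Borel sets, so the
  \<pi>-\<lambda> theorem carries the vanishing of the integrals over to all Borel sets. The support
  in a single box supplies the integral over the whole space, on which the complement case
  relies.\<close>

lemma AE_zero_if_box_integrals_zero:
  fixes f :: "'a::euclidean_space \<Rightarrow> real"
  assumes f: "integrable lborel f" and supp: "\<And>x. x \<notin> box a b \<Longrightarrow> f x = 0"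
    and zero: "\<And>c d. (LINT x:box c d|lborel. f x) = 0"
  shows "AE x in lborel. f x = 0"
proof (rule sigma_finite_measure.density_zero[OF lborel.sigma_finite_measure_axioms f])
  fix A :: "'a set" assume "A \<in> sets lborel"
  then have A: "A \<in> sigma_sets UNIV (range (\<lambda>(a, b). box a b))"
    by (simp add: borel_eq_box)
  have UNIV: "(LINT x|lborel. f x) = 0"
  proof -
    have "(LINT x:box a b|lborel. f x) = (LINT x|lborel. f x)"
      unfolding set_lebesgue_integral_def
      by (rule Bochner_Integration.integral_cong) (auto simp: indicator_def supp)
    with zero show ?thesis by simp
  qed
  have stable: "Int_stable (range (\<lambda>(a, b). box a b :: 'a set))"
    by (auto simp: Int_stable_def box_Int_box)
  have borel: "B \<in> sets lborel" if "B \<in> sigma_sets UNIV (range (\<lambda>(a, b). box a b :: 'a set))" for B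
    using that by (simp add: borel_eq_box)
  have "range (\<lambda>(a, b). box a b :: 'a set) \<subseteq> Pow UNIV" by simp
  from stable this A show "(LINT x:A|lborel. f x) = 0"
  proof (induction rule: sigma_sets_induct_disjoint)
    case (basic A)
    then show ?case using zero by auto
  next
    case empty
    show ?case by (simp add: set_lebesgue_integral_def)
  next
    case (compl A)
    have "(LINT x:(UNIV - A)|lborel. f x) = (LINT x|lborel. f x - indicator A x *\<^sub>R f x)"
      unfolding set_lebesgue_integral_def
      by (rule Bochner_Integration.integral_cong) (auto simp: indicator_def)
    also have "\<dots> = (LINT x|lborel. f x) - (LINT x:A|lborel. f x)"
      unfolding set_lebesgue_integral_def
      by (rule Bochner_Integration.integral_diff)
         (use f borel[OF compl(1)] in \<open>auto intro!: integrable_mult_indicator simp del: real_scaleR_def\<close>)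
    finally show ?case using compl UNIV by simp
  next
    case (union A)
    have "(LINT x:(\<Union>i. A i)|lborel. f x) = (\<Sum>i. (LINT x:(A i)|lborel. f x))"
    proof (rule lebesgue_integral_countable_add)
      have b: "A i \<in> sets lborel" for i using union(2) borel by blast
      show "A i \<in> sets lborel" for i by (rule b)
      show "A i \<inter> A j = {}" if "i \<noteq> j" for i j
        using union(1) that by (auto simp: disjoint_family_on_def)
      have "(\<Union>i. A i) \<in> sets lborel" using b by blast
      then show "set_integrable lborel (\<Union>i. A i) f"
        using f unfolding set_integrable_def by (rule integrable_mult_indicator)
    qed
    then show ?case using union(3) by simp
  qed
qed

text \<open>Bumps converge boundedly to the indicator of a box, so g integrates to 0 over every box
  whose closure lies in \<Omega>. Hence g is null on each such box, and by Lindelof's theorem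
  countably many of them cover \<Omega>. The Borel representative \<open>g'\<close> is introduced
  because the argument on boxes is carried out for \<open>lborel\<close>.\<close>

lemma fundamental_lemma_calculus_of_variations:
  fixes \<Omega> :: "(real^2) set"
  assumes "open \<Omega>" "bounded \<Omega>" and g: "g \<in> L2 \<Omega>"
    and orth: "\<And>\<phi>. \<phi> \<in> test_functions \<Omega> \<Longrightarrow> L2_inner \<Omega> g \<phi> = 0"
  shows "AE x in lebesgue_on \<Omega>. g x = 0"
proof -
  have \<Omega>: "\<Omega> \<in> sets lebesgue" using assms(1) by (simp add: borel_open)
  have finite_measure_domain: "finite_measure (lebesgue_on \<Omega>)"
    by (rule finite_measure_lebesgue_on_bounded[OF assms(2) \<Omega>])
  have int: "integrable (lebesgue_on \<Omega>) g" by (rule L2_integrable[OF finite_measure_domain g])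
  have box0: "(LINT x|lebesgue_on \<Omega>. indicator (box a b) x * g x) = 0" if "cbox a b \<subseteq> \<Omega>" for a b
  proof -
    have bm: "box_bump a b n \<in> borel_measurable (lebesgue_on \<Omega>)" for n
      using smooth_box_bump[of a b n, unfolded smooth_def, rule_format, of 0]
      by (auto intro!: measurable_restrict_space1 measurable_completion borel_measurable_continuous_onI)
    have "(\<lambda>n. LINT x|lebesgue_on \<Omega>. box_bump a b n x * g x) \<longlonglongrightarrow>
          (LINT x|lebesgue_on \<Omega>. indicator (box a b) x * g x)"
    proof (rule integral_dominated_convergence[where w="\<lambda>x. \<bar>g x\<bar>"])
      show "(\<lambda>x. indicator (box a b) x * g x) \<in> borel_measurable (lebesgue_on \<Omega>)"
        using int by (intro borel_measurable_times borel_measurable_indicator)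
          (use that box_subset_cbox[of a b] \<Omega> in \<open>auto simp: sets_restrict_space_iff\<close>)
      show "(\<lambda>x. box_bump a b n x * g x) \<in> borel_measurable (lebesgue_on \<Omega>)" for n
        using int bm by auto
      show "integrable (lebesgue_on \<Omega>) (\<lambda>x. \<bar>g x\<bar>)" using int by auto
      show "AE x in lebesgue_on \<Omega>. (\<lambda>n. box_bump a b n x * g x) \<longlonglongrightarrow> indicator (box a b) x * g x"
        by (intro AE_I2 tendsto_mult box_bump_tendsto tendsto_const)
      show "AE x in lebesgue_on \<Omega>. norm (box_bump a b n x * g x) \<le> \<bar>g x\<bar>" for n
        by (auto simp: abs_mult mult_left_le_one_le box_bump_bounds)
    qed
    moreover have "(LINT x|lebesgue_on \<Omega>. box_bump a b n x * g x) = 0" for n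
      using orth[OF box_bump_test_function[OF that]] by (simp add: L2_inner_def mult.commute)
    ultimately show ?thesis by (simp add: LIMSEQ_const_iff)
  qed
  have int': "integrable lebesgue (\<lambda>x. indicator \<Omega> x *\<^sub>R g x)"
    using int \<Omega> by (simp add: integrable_restrict_space)
  then obtain g' where g'[measurable]: "g' \<in> borel_measurable lborel"
    and ae: "AE x in lborel. indicator \<Omega> x *\<^sub>R g x = g' x"
    using completion_ex_borel_measurable_real[of "\<lambda>x. indicator \<Omega> x *\<^sub>R g x" lborel] by blast
  have aeL: "AE x in lebesgue. indicator \<Omega> x *\<^sub>R g x = g' x"
    using ae by (rule AE_completion)
  have "integrable lebesgue g'"
    by (rule integrable_cong_AE_imp[OF int' _ aeL]) (simp add: measurable_completion)
  then have int_g': "integrable lborel g'" by (simp add: integrable_completion)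
  have local: "AE x in lborel. x \<in> box a b \<longrightarrow> g' x = 0" if ab: "cbox a b \<subseteq> \<Omega>" for a b
  proof -
    have "AE x in lborel. indicator (box a b) x * g' x = 0"
    proof (rule AE_zero_if_box_integrals_zero[where a=a and b=b])
      show "integrable lborel (\<lambda>x. indicator (box a b) x * g' x)"
        using integrable_mult_indicator[OF _ int_g', of "box a b"] by simp
      fix c d :: "real^2"
      obtain p q where pq: "box c d \<inter> box a b = box p q" by (auto simp: box_Int_box)
      show "(LINT x:box c d|lborel. indicator (box a b) x * g' x) = 0"
      \<comment> \<open>Only for a nonempty open box is the closed box its closure, and it is
        through the closure that \<open>cbox p q\<close> is seen to lie in
        \<open>cbox a b\<close>.\<close>
      proof (cases "box p q = {}")
        case True
        have "(\<lambda>x. indicator (box c d) x *\<^sub>R (indicator (box a b) x * g' x)) = (\<lambda>x. 0)"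
          using pq True by (auto simp: indicator_def fun_eq_iff)
        then show ?thesis by (simp add: set_lebesgue_integral_def del: real_scaleR_def)
      next
        case False
        then have "cbox p q = closure (box p q)" by (simp add: closure_box)
        also have "\<dots> \<subseteq> cbox a b"
          using pq box_subset_cbox[of a b] by (intro closure_minimal) auto
        finally have "cbox p q \<subseteq> \<Omega>" using ab by simp
        note box0[OF this]
        moreover have "(LINT x|lebesgue_on \<Omega>. indicator (box p q) x * g x) =
            (LINT x|lebesgue. indicator (box p q) x * (indicator \<Omega> x *\<^sub>R g x))"
          using \<Omega> by (subst integral_restrict_space) (auto intro!: Bochner_Integration.integral_cong)
        moreover have "\<dots> = (LINT x|lebesgue. indicator (box p q) x * g' x)"
        proof (rule integral_cong_AE)
          show "AE x in lebesgue. indicator (box p q) x * (indicator \<Omega> x *\<^sub>R g x) = indicator (box p q) x * g' x"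
            using aeL by eventually_elim simp
        next
          show "(\<lambda>x. indicator (box p q) x * (indicator \<Omega> x *\<^sub>R g x)) \<in> borel_measurable lebesgue"
            using int' by (intro borel_measurable_times borel_measurable_indicator) auto
        qed (auto intro!: measurable_completion)
        moreover have "\<dots> = (LINT x|lborel. indicator (box p q) x * g' x)"
          by (rule integral_completion) auto
        ultimately show ?thesis
          unfolding set_lebesgue_integral_def pq[symmetric]
          by (simp add: indicator_inter_arith mult.assoc)
      qed
    qed auto
    then show ?thesis by eventually_elim (auto simp: indicator_def)
  qed
  obtain D :: "(real^2) set set" where "countable D" and D: "\<And>X. X \<in> D \<Longrightarrow> \<exists>a b. X = box a b \<and> cbox a b \<subseteq> \<Omega>" "\<Union>D = \<Omega>"
  proof -
    define F where "F = {box a b |a b. cbox a b \<subseteq> \<Omega>}"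
    have "\<exists>D. D \<subseteq> F \<and> countable D \<and> \<Union>D = \<Union>F"
      by (rule Lindelof[of F]) (auto simp: F_def)
    then obtain D where "D \<subseteq> F" "countable D" "\<Union>D = \<Union>F" by blast
    moreover have "\<Union>F = \<Omega>"
    proof
      show "\<Union>F \<subseteq> \<Omega>" using box_subset_cbox by (auto simp: F_def)
      show "\<Omega> \<subseteq> \<Union>F"
      proof
        fix x assume "x \<in> \<Omega>"
        with assms(1) obtain a b where "cbox a b \<subseteq> \<Omega>" "x \<in> box a b"
          by (meson open_contains_cbox)
        then show "x \<in> \<Union>F" by (auto simp: F_def)
      qed
    qed
    ultimately show thesis using that[of D] by (auto simp: F_def)
  qed
  have "AE x in lborel. \<forall>X\<in>D. x \<in> X \<longrightarrow> g' x = 0"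
    unfolding AE_ball_countable[OF \<open>countable D\<close>] using D(1) local by blast
  then have "AE x in lebesgue. \<forall>X\<in>D. x \<in> X \<longrightarrow> g' x = 0" by (rule AE_completion)
  with aeL have "AE x in lebesgue. x \<in> \<Omega> \<longrightarrow> g x = 0"
    by eventually_elim (use D(2) in \<open>auto simp: indicator_def split: if_splits\<close>)
  then show ?thesis using \<Omega> by (simp add: AE_restrict_space_iff)
qed

section \<open>Weak derivatives\<close>

lemma smooth_differentiable: "smooth f \<Longrightarrow> f differentiable (at x)"
  by (auto simp: smooth_def dest: spec[of _ "Suc 0"])

lemma smooth_partial_deriv: "smooth f \<Longrightarrow> smooth (partial_deriv i f)"
  unfolding smooth_def
proof
  fix k assume "\<forall>k. C_k k f"
  then have "C_k (Suc k) f" by blast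
  then show "C_k k (partial_deriv i f)" by simp
qed

lemma smooth_continuous_on: "smooth f \<Longrightarrow> continuous_on S f"
  by (meson C_k.simps(1) continuous_on_subset smooth_def subset_UNIV)

lemma smooth_add:
  assumes "smooth f" "smooth g" shows "smooth (\<lambda>x. f x + g x)"
proof -
  have "C_k k (\<lambda>x. f x + g x)" if "smooth f" "smooth g" for k
    using that
  proof (induction k arbitrary: f g)
    case 0
    then show ?case by (simp add: smooth_continuous_on continuous_on_add continuous_on_mult)
  next
    case (Suc k)
    then have "partial_deriv i (\<lambda>x. f x + g x) = (\<lambda>x. partial_deriv i f x + partial_deriv i g x)" for i
      by (auto intro!: partial_deriv_add smooth_differentiable)
    with Suc show ?case
      by (simp add: differentiable_add differentiable_mult smooth_differentiable smooth_partial_deriv)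
  qed
  with assms show ?thesis unfolding smooth_def[of "\<lambda>x. f x + g x"] by blast
qed

lemma partial_deriv_cmult:
  assumes "f differentiable (at x)"
  shows "partial_deriv i (\<lambda>x. c * f x) x = c * partial_deriv i f x"
  using partial_deriv_mult[of "\<lambda>x. c" x f i] assms partial_deriv_eq[of "\<lambda>x. c" "\<lambda>x. 0" x i] by simp

lemma smooth_cmult:
  assumes "smooth f" shows "smooth (\<lambda>x. c * f x)"
proof -
  have "C_k k (\<lambda>x. c * f x)" if "smooth f" for k
    using that
  proof (induction k arbitrary: f)
    case 0
    then show ?case by (simp add: smooth_continuous_on continuous_on_add continuous_on_mult)
  next
    case (Suc k)
    then have "partial_deriv i (\<lambda>x. c * f x) = (\<lambda>x. c * partial_deriv i f x)" for i
      by (auto intro!: partial_deriv_cmult smooth_differentiable)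
    with Suc show ?case
      by (simp add: differentiable_add differentiable_mult smooth_differentiable smooth_partial_deriv)
  qed
  with assms show ?thesis unfolding smooth_def[of "\<lambda>x. c * f x"] by blast
qed

lemma zero_off_closure_support: "x \<notin> closure {x. f x \<noteq> 0} \<Longrightarrow> f x = 0"
  using closure_subset[of "{x. f x \<noteq> 0}"] by auto

lemma test_functions_smooth: "\<phi> \<in> test_functions \<Omega> \<Longrightarrow> smooth \<phi>"
  by (simp add: test_functions_def)

lemma test_functions_support:
  assumes "\<phi> \<in> test_functions \<Omega>"
  shows "compact (closure {x. \<phi> x \<noteq> 0})" "closure {x. \<phi> x \<noteq> 0} \<subseteq> \<Omega>"
  using assms by (simp_all only: test_functions_def mem_Collect_eq)

lemma test_functions_zero_outside: "\<phi> \<in> test_functions \<Omega> \<Longrightarrow> x \<notin> \<Omega> \<Longrightarrow> \<phi> x = 0"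
  using zero_off_closure_support[of x \<phi>] by (auto simp: test_functions_def)

lemma test_functionsI:
  assumes "smooth \<psi>" "\<phi> \<in> test_functions \<Omega>" "\<And>x. x \<notin> closure {x. \<phi> x \<noteq> 0} \<Longrightarrow> \<psi> x = 0"
  shows "\<psi> \<in> test_functions \<Omega>"
proof -
  have "closure {x. \<psi> x \<noteq> 0} \<subseteq> closure {x. \<phi> x \<noteq> 0}"
    by (rule closure_minimal) (use assms(3) in auto)
  moreover have "compact (closure {x. \<psi> x \<noteq> 0})"
    using compact_Int_closed[OF test_functions_support(1)[OF assms(2)] closed_closure, of "{x. \<psi> x \<noteq> 0}"] calculation
    by (simp only: inf.absorb2)
  ultimately show ?thesis
    using assms(1) test_functions_support(2)[OF assms(2)] unfolding test_functions_def by blast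
qed

text \<open>A test function vanishes on the open complement of its support, hence so does its
  derivative.\<close>

lemma test_functions_partial_deriv:
  assumes "\<phi> \<in> test_functions \<Omega>"
  shows "partial_deriv i \<phi> \<in> test_functions \<Omega>"
proof (rule test_functionsI[OF _ assms])
  show "smooth (partial_deriv i \<phi>)"
    using assms by (intro smooth_partial_deriv test_functions_smooth)
  define K where "K = closure {x. \<phi> x \<noteq> 0}"
  have K: "open (- K)" "\<And>y. y \<notin> K \<Longrightarrow> \<phi> y = 0"
    unfolding K_def by (auto dest: zero_off_closure_support)
  fix x assume "x \<notin> closure {x. \<phi> x \<noteq> 0}"
  then have x: "x \<in> - K" by (simp add: K_def)
  have "((\<lambda>x. 0) has_derivative (\<lambda>h. 0)) (at x)" by simp
  then have "(\<phi> has_derivative (\<lambda>h. 0)) (at x)"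
    using K(1) x by (rule has_derivative_transform_within_open) (simp add: K(2))
  then show "partial_deriv i \<phi> x = 0"
    by (simp add: partial_deriv_eq)
qed

lemma test_functions_cmult:
  assumes "\<phi> \<in> test_functions \<Omega>" shows "(\<lambda>x. c * \<phi> x) \<in> test_functions \<Omega>"
  by (rule test_functionsI[OF smooth_cmult[OF test_functions_smooth[OF assms]] assms])
     (use zero_off_closure_support[of _ \<phi>] mult_zero_right in metis)

lemma test_functions_add:
  assumes "\<phi> \<in> test_functions \<Omega>" "\<psi> \<in> test_functions \<Omega>"
  shows "(\<lambda>x. \<phi> x + \<psi> x) \<in> test_functions \<Omega>"
proof -
  have sub: "closure {x. \<phi> x + \<psi> x \<noteq> 0} \<subseteq> closure {x. \<phi> x \<noteq> 0} \<union> closure {x. \<psi> x \<noteq> 0}"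
  proof (rule closure_minimal)
    have "{x. \<phi> x + \<psi> x \<noteq> 0} \<subseteq> {x. \<phi> x \<noteq> 0} \<union> {x. \<psi> x \<noteq> 0}" by auto
    also have "\<dots> \<subseteq> closure {x. \<phi> x \<noteq> 0} \<union> closure {x. \<psi> x \<noteq> 0}"
      by (intro Un_mono closure_subset)
    finally show "{x. \<phi> x + \<psi> x \<noteq> 0} \<subseteq> closure {x. \<phi> x \<noteq> 0} \<union> closure {x. \<psi> x \<noteq> 0}" .
  qed (intro closed_Un closed_closure)
  have comp: "compact (closure {x. \<phi> x \<noteq> 0} \<union> closure {x. \<psi> x \<noteq> 0})"
    by (intro compact_Un test_functions_support(1)[OF assms(1)] test_functions_support(1)[OF assms(2)])
  have "compact (closure {x. \<phi> x + \<psi> x \<noteq> 0})"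
    using compact_Int_closed[OF comp closed_closure, of "{x. \<phi> x + \<psi> x \<noteq> 0}"] sub
    by (simp only: inf.absorb2)
  moreover have "closure {x. \<phi> x + \<psi> x \<noteq> 0} \<subseteq> \<Omega>"
    using sub test_functions_support(2)[OF assms(1)] test_functions_support(2)[OF assms(2)] by blast
  ultimately show ?thesis
    unfolding test_functions_def
    by (intro CollectI conjI smooth_add test_functions_smooth[OF assms(1)] test_functions_smooth[OF assms(2)])
qed

lemma test_functions_bounded:
  assumes "\<phi> \<in> test_functions \<Omega>"
  obtains B where "B > 0" "\<And>x. \<bar>\<phi> x\<bar> \<le> B"
proof -
  let ?K = "closure {x. \<phi> x \<noteq> 0}"
  have "compact (\<phi> ` ?K)"
    by (intro compact_continuous_image smooth_continuous_on test_functions_smooth[OF assms]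
        test_functions_support(1)[OF assms])
  then obtain B where B: "B > 0" "\<And>y. y \<in> \<phi> ` ?K \<Longrightarrow> norm y \<le> B"
    using compact_imp_bounded bounded_pos by metis
  have "\<bar>\<phi> x\<bar> \<le> B" for x
  proof (cases "\<phi> x = 0")
    case False
    then have "x \<in> ?K" using zero_off_closure_support[of x \<phi>] by blast
    then show ?thesis using B by auto
  qed (use B in simp)
  with B(1) show thesis by (rule that)
qed

lemma test_functions_mi_deriv:
  assumes "\<phi> \<in> test_functions \<Omega>"
  shows "mi_deriv \<alpha> \<phi> \<in> test_functions \<Omega>"
proof -
  have "(partial_deriv i ^^ n) \<psi> \<in> test_functions \<Omega>" if "\<psi> \<in> test_functions \<Omega>" for i n \<psi>
    by (induction n) (use that in \<open>auto intro: test_functions_partial_deriv\<close>)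
  with assms show ?thesis by (simp add: mi_deriv_def)
qed

lemma mi_deriv_single: "mi_deriv (mi_single 1 i) \<phi> = partial_deriv i \<phi>"
  using exhaust_2[of i] by (auto simp: mi_deriv_def mi_single_def One_nat_def)

lemma mi_deriv_0: "mi_deriv (mi_single 0 i) \<phi> = \<phi>"
  by (simp add: mi_deriv_def mi_single_def)

lemma mi_order_single: "mi_order (mi_single k i) = k"
  by (simp add: mi_order_def mi_single_def)

lemma mi_order_le_1: "{\<alpha>. mi_order \<alpha> \<le> 1} = {mi_single 0 1, mi_single 1 1, mi_single 1 2}"
proof -
  have "\<alpha> \<in> {mi_single 0 1, mi_single 1 1, mi_single 1 2}" if "mi_order \<alpha> \<le> 1" for \<alpha>
  proof -
    have "\<alpha> 1 + \<alpha> 2 \<le> 1" using that by (simp add: mi_order_def sum_2)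
    then consider "\<alpha> 1 = 0" "\<alpha> 2 = 0" | "\<alpha> 1 = 1" "\<alpha> 2 = 0" | "\<alpha> 1 = 0" "\<alpha> 2 = 1" by linarith
    then show ?thesis
      by cases (auto simp: mi_single_def fun_eq_iff forall_2)
  qed
  then show ?thesis by (auto simp: mi_order_single)
qed

lemma mi_single_distinct: "mi_single 0 1 \<noteq> mi_single 1 i" "mi_single 1 1 \<noteq> mi_single 1 2"
proof -
  have "mi_single 0 1 i \<noteq> mi_single 1 i i" "mi_single 1 1 1 \<noteq> mi_single 1 2 1"
    by (simp_all add: mi_single_def)
  then show "mi_single 0 1 \<noteq> mi_single 1 i" "mi_single 1 1 \<noteq> mi_single 1 2"
    by auto
qed

section \<open>Weak derivatives on a bounded open set\<close>

locale bounded_domain =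
  fixes \<Omega> :: "(real^2) set"
  assumes open_domain: "open \<Omega>" and bounded_domain: "bounded \<Omega>"
begin

lemma domain_lebesgue: "\<Omega> \<in> sets lebesgue"
  using open_domain by (simp add: borel_open)

lemma finite_measure_domain: "finite_measure (lebesgue_on \<Omega>)"
  by (rule finite_measure_lebesgue_on_bounded[OF bounded_domain domain_lebesgue])

lemma continuous_borel_measurable:
  assumes "continuous_on \<Omega> f"
  shows "f \<in> borel_measurable (lebesgue_on \<Omega>)"
  by (rule continuous_imp_measurable_on_sets_lebesgue[OF assms domain_lebesgue])

lemma test_functions_L2:
  assumes "\<phi> \<in> test_functions \<Omega>" shows "\<phi> \<in> L2 \<Omega>"
proof -
  obtain B where "\<And>x. \<bar>\<phi> x\<bar> \<le> B" using test_functions_bounded[OF assms] by blast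
  then show ?thesis
    using assms
    by (intro L2_bounded[OF finite_measure_domain, of _ B] continuous_borel_measurable smooth_continuous_on
        test_functions_smooth) auto
qed

lemma has_weak_deriv_add:
  assumes "has_weak_deriv \<Omega> \<alpha> u g" "has_weak_deriv \<Omega> \<alpha> v k" "u \<in> L2 \<Omega>" "v \<in> L2 \<Omega>" "g \<in> L2 \<Omega>" "k \<in> L2 \<Omega>"
  shows "has_weak_deriv \<Omega> \<alpha> (\<lambda>x. u x + v x) (\<lambda>x. g x + k x)"
  using assms
  by (auto simp: has_weak_deriv_def L2_inner_add_left test_functions_mi_deriv test_functions_L2 distrib_left)

lemma has_weak_deriv_cmult:
  assumes "has_weak_deriv \<Omega> \<alpha> u g"
  shows "has_weak_deriv \<Omega> \<alpha> (\<lambda>x. c * u x) (\<lambda>x. c * g x)"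
  using assms by (auto simp: has_weak_deriv_def L2_inner_mult_left)

text \<open>The sign factor cancels, so the difference of two weak derivatives is orthogonal to all
  test functions.\<close>

lemma has_weak_deriv_unique:
  assumes "has_weak_deriv \<Omega> \<alpha> u g" "has_weak_deriv \<Omega> \<alpha> u k" "g \<in> L2 \<Omega>" "k \<in> L2 \<Omega>"
  shows "AE x in lebesgue_on \<Omega>. g x = k x"
proof -
  have "AE x in lebesgue_on \<Omega>. g x - k x = 0"
  proof (rule fundamental_lemma_calculus_of_variations[OF open_domain bounded_domain L2_diff[OF assms(3,4)]])
    fix \<phi> assume \<phi>: "\<phi> \<in> test_functions \<Omega>"
    then have "(- 1) ^ mi_order \<alpha> * L2_inner \<Omega> g \<phi> = (- 1) ^ mi_order \<alpha> * L2_inner \<Omega> k \<phi>"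
      using assms(1,2) by (metis has_weak_deriv_def)
    then show "L2_inner \<Omega> (\<lambda>x. g x - k x) \<phi> = 0"
      using assms \<phi> by (simp add: L2_inner_diff_left test_functions_L2)
  qed
  then show ?thesis by simp
qed

lemma
  assumes "u \<in> Hk k \<Omega>" "mi_order \<alpha> \<le> k"
  shows weak_deriv_L2: "weak_deriv \<Omega> \<alpha> u \<in> L2 \<Omega>"
    and has_weak_deriv_weak_deriv: "has_weak_deriv \<Omega> \<alpha> u (weak_deriv \<Omega> \<alpha> u)"
proof -
  have "\<exists>g. g \<in> L2 \<Omega> \<and> has_weak_deriv \<Omega> \<alpha> u g"
    using assms by (auto simp: Hk_def)
  from someI_ex[OF this] show "weak_deriv \<Omega> \<alpha> u \<in> L2 \<Omega>" "has_weak_deriv \<Omega> \<alpha> u (weak_deriv \<Omega> \<alpha> u)"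
    by (simp_all add: weak_deriv_def)
qed

text \<open>Access to the chosen representative: any explicit square-integrable weak derivative
  agrees with it almost everywhere. Linearity of \<open>grad\<close> and the gradients of concrete
  functions are derived from this.\<close>

lemma weak_deriv_eq_AE:
  assumes "has_weak_deriv \<Omega> \<alpha> u g" "g \<in> L2 \<Omega>"
  shows "AE x in lebesgue_on \<Omega>. weak_deriv \<Omega> \<alpha> u x = g x"
proof -
  have "\<exists>g. g \<in> L2 \<Omega> \<and> has_weak_deriv \<Omega> \<alpha> u g"
    using assms by auto
  from someI_ex[OF this] show ?thesis
    unfolding weak_deriv_def[symmetric] using has_weak_deriv_unique assms by blast
qed

lemma Hk_imp_L2: "u \<in> Hk k \<Omega> \<Longrightarrow> u \<in> L2 \<Omega>"
  by (simp add: Hk_def)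

lemma Hk_add:
  assumes "u \<in> Hk k \<Omega>" "v \<in> Hk k \<Omega>" shows "(\<lambda>x. u x + v x) \<in> Hk k \<Omega>"
  unfolding Hk_def
proof (intro CollectI conjI allI impI)
  show "(\<lambda>x. u x + v x) \<in> L2 \<Omega>" using assms by (simp add: Hk_def L2_add)
  fix \<alpha> assume "mi_order \<alpha> \<le> k"
  then obtain g h where "g \<in> L2 \<Omega>" "has_weak_deriv \<Omega> \<alpha> u g" "h \<in> L2 \<Omega>" "has_weak_deriv \<Omega> \<alpha> v h"
    using assms unfolding Hk_def by blast
  then show "\<exists>g\<in>L2 \<Omega>. has_weak_deriv \<Omega> \<alpha> (\<lambda>x. u x + v x) g"
    using assms by (intro bexI[of _ "\<lambda>x. g x + h x"] has_weak_deriv_add L2_add)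
      (auto intro: Hk_imp_L2)
qed

lemma Hk_cmult:
  assumes "u \<in> Hk k \<Omega>" shows "(\<lambda>x. c * u x) \<in> Hk k \<Omega>"
  unfolding Hk_def
proof (intro CollectI conjI allI impI)
  show "(\<lambda>x. c * u x) \<in> L2 \<Omega>" using assms by (simp add: Hk_def L2_mult)
  fix \<alpha> assume "mi_order \<alpha> \<le> k"
  then obtain g where "g \<in> L2 \<Omega>" "has_weak_deriv \<Omega> \<alpha> u g"
    using assms unfolding Hk_def by blast
  then show "\<exists>g\<in>L2 \<Omega>. has_weak_deriv \<Omega> \<alpha> (\<lambda>x. c * u x) g"
    by (intro bexI[of _ "\<lambda>x. c * g x"] has_weak_deriv_cmult L2_mult)
qed

lemma Hk_diff:
  assumes "u \<in> Hk k \<Omega>" "v \<in> Hk k \<Omega>" shows "(\<lambda>x. u x - v x) \<in> Hk k \<Omega>"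
  using Hk_add[OF assms(1) Hk_cmult[OF assms(2), of "-1"]] by simp

text \<open>The derivative of order 0 is u itself, so only the first-order derivatives have to be
  exhibited.\<close>

lemma H1I:
  assumes "u \<in> L2 \<Omega>" "\<And>i. g i \<in> L2 \<Omega>" "\<And>i. has_weak_deriv \<Omega> (mi_single 1 i) u (g i)"
  shows "u \<in> Hk 1 \<Omega>"
  unfolding Hk_def
proof (intro CollectI conjI allI impI)
  fix \<alpha> assume "mi_order \<alpha> \<le> 1"
  then have "\<alpha> \<in> {mi_single 0 1, mi_single 1 1, mi_single 1 2}" using mi_order_le_1 by blast
  moreover have "has_weak_deriv \<Omega> (mi_single 0 1) u u"
    by (simp add: has_weak_deriv_def mi_deriv_0 mi_order_single)
  ultimately show "\<exists>g\<in>L2 \<Omega>. has_weak_deriv \<Omega> \<alpha> u g"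
    using assms by auto
qed fact

lemma grad_L2:
  assumes "u \<in> Hk 1 \<Omega>" shows "grad \<Omega> u \<in> L2 \<Omega>"
  unfolding L2_vec_iff grad_def using weak_deriv_L2[OF assms] by (simp add: mi_order_single)

lemma grad_nth_L2:
  assumes "u \<in> Hk 1 \<Omega>" shows "(\<lambda>x. grad \<Omega> u x $ i) \<in> L2 \<Omega>"
  using grad_L2[OF assms] by (simp add: L2_vec_iff)

lemma has_weak_deriv_grad:
  assumes "u \<in> Hk 1 \<Omega>"
  shows "has_weak_deriv \<Omega> (mi_single 1 i) u (\<lambda>x. grad \<Omega> u x $ i)"
  using has_weak_deriv_weak_deriv[OF assms, of "mi_single 1 i"] by (simp add: mi_order_single grad_def)

lemma grad_eq_AE:
  assumes "\<And>i. g i \<in> L2 \<Omega>" "\<And>i. has_weak_deriv \<Omega> (mi_single 1 i) u (g i)"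
  shows "AE x in lebesgue_on \<Omega>. grad \<Omega> u x = (\<chi> i. g i x)"
proof -
  have "AE x in lebesgue_on \<Omega>. \<forall>i\<in>UNIV. weak_deriv \<Omega> (mi_single 1 i) u x = g i x"
    by (rule AE_finite_allI) (use assms weak_deriv_eq_AE in auto)
  then show ?thesis by eventually_elim (simp add: grad_def vec_eq_iff)
qed

lemma grad_add_AE:
  assumes "u \<in> Hk 1 \<Omega>" "v \<in> Hk 1 \<Omega>"
  shows "AE x in lebesgue_on \<Omega>. grad \<Omega> (\<lambda>x. u x + v x) x = grad \<Omega> u x + grad \<Omega> v x"
proof -
  have "AE x in lebesgue_on \<Omega>. grad \<Omega> (\<lambda>x. u x + v x) x = (\<chi> i. grad \<Omega> u x $ i + grad \<Omega> v x $ i)"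
    using assms by (intro grad_eq_AE has_weak_deriv_add has_weak_deriv_grad L2_add grad_nth_L2 Hk_imp_L2)
  then show ?thesis by eventually_elim (simp add: vec_eq_iff)
qed

lemma grad_cmult_AE:
  assumes "u \<in> Hk 1 \<Omega>"
  shows "AE x in lebesgue_on \<Omega>. grad \<Omega> (\<lambda>x. c * u x) x = c *\<^sub>R grad \<Omega> u x"
proof -
  have "AE x in lebesgue_on \<Omega>. grad \<Omega> (\<lambda>x. c * u x) x = (\<chi> i. c * grad \<Omega> u x $ i)"
    using assms by (intro grad_eq_AE has_weak_deriv_cmult has_weak_deriv_grad L2_mult grad_nth_L2)
  then show ?thesis by eventually_elim (simp add: vec_eq_iff)
qed

lemma grad_diff_AE:
  assumes "u \<in> Hk 1 \<Omega>" "v \<in> Hk 1 \<Omega>"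
  shows "AE x in lebesgue_on \<Omega>. grad \<Omega> (\<lambda>x. u x - v x) x = grad \<Omega> u x - grad \<Omega> v x"
  using grad_add_AE[OF assms(1) Hk_cmult[OF assms(2), of "-1"]] grad_cmult_AE[OF assms(2), of "-1"]
  by eventually_elim simp

lemma L2_inner_grad_add:
  assumes "u \<in> Hk 1 \<Omega>" "v \<in> Hk 1 \<Omega>" "g \<in> L2 \<Omega>"
  shows "L2_inner \<Omega> (grad \<Omega> (\<lambda>x. u x + v x)) g = L2_inner \<Omega> (grad \<Omega> u) g + L2_inner \<Omega> (grad \<Omega> v) g"
  using L2_inner_cong_AE[OF grad_L2[OF Hk_add[OF assms(1,2)]]
      L2_add[OF grad_L2[OF assms(1)] grad_L2[OF assms(2)]] assms(3) grad_add_AE[OF assms(1,2)]]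
  by (simp add: L2_inner_add_left grad_L2 assms)

lemma L2_inner_grad_diff:
  assumes "u \<in> Hk 1 \<Omega>" "v \<in> Hk 1 \<Omega>" "g \<in> L2 \<Omega>"
  shows "L2_inner \<Omega> (grad \<Omega> (\<lambda>x. u x - v x)) g = L2_inner \<Omega> (grad \<Omega> u) g - L2_inner \<Omega> (grad \<Omega> v) g"
  using L2_inner_cong_AE[OF grad_L2[OF Hk_diff[OF assms(1,2)]]
      L2_diff[OF grad_L2[OF assms(1)] grad_L2[OF assms(2)]] assms(3) grad_diff_AE[OF assms(1,2)]]
  by (simp add: L2_inner_diff_left grad_L2 assms)

lemma L2_inner_grad_cmult:
  assumes "u \<in> Hk 1 \<Omega>" "g \<in> L2 \<Omega>"
  shows "L2_inner \<Omega> (grad \<Omega> (\<lambda>x. c * u x)) g = c * L2_inner \<Omega> (grad \<Omega> u) g"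
  using L2_inner_cong_AE[OF grad_L2[OF Hk_cmult[OF assms(1)]]
      L2_scaleR[OF grad_L2[OF assms(1)]] assms(2) grad_cmult_AE[OF assms(1)]]
  by (simp add: L2_inner_scaleR_left grad_L2 assms)

text \<open>Three multi-indices have order at most 1. The one of order 0 contributes the norm of a
  chosen representative of u, which equals u almost everywhere.\<close>

lemma Hk_norm_1:
  assumes "u \<in> Hk 1 \<Omega>"
  shows "Hk_norm 1 \<Omega> u = sqrt ((L2_norm \<Omega> u)\<^sup>2 + (L2_norm \<Omega> (grad \<Omega> u))\<^sup>2)"
proof -
  have u: "u \<in> L2 \<Omega>" by (rule Hk_imp_L2[OF assms])
  have "L2_norm \<Omega> (weak_deriv \<Omega> (mi_single 0 1) u) = L2_norm \<Omega> u"
    by (rule L2_norm_cong_AE[OF weak_deriv_L2[OF assms] u weak_deriv_eq_AE[OF _ u]])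
       (simp_all add: has_weak_deriv_def mi_deriv_0 mi_order_single)
  moreover have "(L2_norm \<Omega> (grad \<Omega> u))\<^sup>2 =
     (L2_norm \<Omega> (weak_deriv \<Omega> (mi_single 1 1) u))\<^sup>2 + (L2_norm \<Omega> (weak_deriv \<Omega> (mi_single 1 2) u))\<^sup>2"
    using L2_inner_vec[OF grad_L2[OF assms] grad_L2[OF assms]]
    by (simp add: L2_norm_power2 sum_2 grad_def)
  moreover have "(\<Sum>\<alpha>\<in>{\<alpha>. mi_order \<alpha> \<le> 1}. (L2_norm \<Omega> (weak_deriv \<Omega> \<alpha> u))\<^sup>2) =
     (L2_norm \<Omega> (weak_deriv \<Omega> (mi_single 0 1) u))\<^sup>2 + ((L2_norm \<Omega> (weak_deriv \<Omega> (mi_single 1 1) u))\<^sup>2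
      + (L2_norm \<Omega> (weak_deriv \<Omega> (mi_single 1 2) u))\<^sup>2)"
    unfolding mi_order_le_1 using mi_single_distinct by simp
  ultimately show ?thesis by (simp add: Hk_norm_def)
qed

lemma L2_norm_le_Hk_norm: "u \<in> Hk 1 \<Omega> \<Longrightarrow> L2_norm \<Omega> u \<le> Hk_norm 1 \<Omega> u"
  by (simp add: Hk_norm_1 real_le_rsqrt)

lemma L2_norm_grad_le_Hk_norm: "u \<in> Hk 1 \<Omega> \<Longrightarrow> L2_norm \<Omega> (grad \<Omega> u) \<le> Hk_norm 1 \<Omega> u"
  by (simp add: Hk_norm_1 real_le_rsqrt)

lemma Hk_norm_le: "u \<in> Hk 1 \<Omega> \<Longrightarrow> Hk_norm 1 \<Omega> u \<le> L2_norm \<Omega> u + L2_norm \<Omega> (grad \<Omega> u)"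
  using sqrt_add_le_add_sqrt[of "(L2_norm \<Omega> u)\<^sup>2" "(L2_norm \<Omega> (grad \<Omega> u))\<^sup>2"] by (simp add: Hk_norm_1)

end

section \<open>Lipschitz functions\<close>

lemma diff_quotient_tendsto:
  fixes f :: "'a::real_normed_vector \<Rightarrow> real"
  assumes "f differentiable (at x)" "h \<longlonglongrightarrow> 0" "\<And>n. h n \<noteq> (0::real)"
  shows "(\<lambda>n. (f (x + h n *\<^sub>R a) - f x) / h n) \<longlonglongrightarrow> frechet_derivative f (at x) a"
proof -
  define D where "D = frechet_derivative f (at x)"
  have D: "(f has_derivative D) (at x)"
    using assms(1) by (simp add: D_def frechet_derivative_works)
  have g: "((\<lambda>t. x + t *\<^sub>R a) has_derivative (\<lambda>t. t *\<^sub>R a)) (at 0)"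
    by (auto intro!: derivative_eq_intros)
  have "((\<lambda>t. f (x + t *\<^sub>R a)) has_derivative (\<lambda>t. D (t *\<^sub>R a))) (at 0)"
    using has_derivative_compose[OF g, of f D] D by simp
  moreover have "D (t *\<^sub>R a) = D a * t" for t
    using linear_cmul[OF has_derivative_linear[OF D]] by simp
  ultimately have "((\<lambda>t. f (x + t *\<^sub>R a)) has_real_derivative D a) (at 0)"
    by (simp add: has_field_derivative_def)
  then have "((\<lambda>t. (f (x + t *\<^sub>R a) - f x) / t) \<longlongrightarrow> D a) (at 0)"
    by (simp add: DERIV_def)
  moreover have "filterlim h (at 0) sequentially"
    using assms by (auto simp: filterlim_at)
  ultimately show ?thesis
    unfolding D_def[symmetric] by (rule filterlim_compose)
qed

lemma lborel_integral_translate: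
  fixes f :: "'a::euclidean_space \<Rightarrow> real"
  assumes [measurable]: "f \<in> borel_measurable borel"
  shows "(LINT x|lborel. f (x + a)) = (LINT x|lborel. f x)"
proof -
  have "(LINT x|lborel. f x) = (LINT x|distr lborel borel ((+) a). f x)"
    by (simp add: lborel_distr_plus)
  also have "\<dots> = (LINT x|lborel. f (a + x))" by (rule integral_distr) auto
  finally show ?thesis by (simp add: add.commute)
qed

lemma lborel_nn_integral_translate:
  fixes f :: "'a::euclidean_space \<Rightarrow> ennreal"
  assumes [measurable]: "f \<in> borel_measurable borel"
  shows "(\<integral>\<^sup>+x. f (x + a) \<partial>lborel) = (\<integral>\<^sup>+x. f x \<partial>lborel)"
proof -
  have "(\<integral>\<^sup>+x. f x \<partial>lborel) = (\<integral>\<^sup>+x. f x \<partial>distr lborel borel ((+) a))"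
    by (simp add: lborel_distr_plus)
  also have "\<dots> = (\<integral>\<^sup>+x. f (a + x) \<partial>lborel)" by (rule nn_integral_distr) auto
  finally show ?thesis by (simp add: add.commute)
qed

lemma integrable_lborel_bounded_support:
  fixes f :: "'a::euclidean_space \<Rightarrow> real"
  assumes "f \<in> borel_measurable borel" "bounded A" "\<And>x. \<bar>f x\<bar> \<le> B" "\<And>x. x \<notin> A \<Longrightarrow> f x = 0"
  shows "integrable lborel f"
proof -
  obtain c R where R: "A \<subseteq> cball c R"
    using assms(2) unfolding bounded_subset_cball by blast
  show ?thesis
  proof (rule integrableI_bounded_set[of "cball c R"])
    show "emeasure lborel (cball c R) < \<infinity>"
      using emeasure_compact_finite[OF compact_cball] by (simp add: less_top)
    show "AE x in lborel. x \<notin> cball c R \<longrightarrow> f x = 0" using assms(4) R by (intro AE_I2) blast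
  qed (use assms in auto)
qed

context bounded_domain
begin

text \<open>Translation invariance and Tonelli's theorem are used for \<open>lborel\<close>, whereas
  the norms live on \<open>lebesgue_on \<Omega>\<close>. An integrand that is Borel after the
  cut-off has the same integral in both settings.\<close>

lemma lebesgue_on_integral_eq:
  fixes f :: "real^2 \<Rightarrow> real"
  assumes "(\<lambda>x. indicator \<Omega> x * f x) \<in> borel_measurable borel"
  shows "(LINT x|lebesgue_on \<Omega>. f x) = (LINT x|lborel. indicator \<Omega> x * f x)"
  using integral_restrict_space[of \<Omega> lebesgue f] integral_completion[of "\<lambda>x. indicator \<Omega> x * f x" lborel]
    domain_lebesgue assms by simp

lemma integrable_indicator_domain: "integrable lborel (\<lambda>x. indicator \<Omega> x * (c::real))"
proof (rule integrable_lborel_bounded_support[OF _ bounded_domain])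
  show "(\<lambda>x. indicator \<Omega> x * c) \<in> borel_measurable borel"
    using open_domain by (intro borel_measurable_times borel_measurable_indicator) auto
  show "\<bar>indicator \<Omega> x * c\<bar> \<le> \<bar>c\<bar>" for x by (simp add: indicator_def)
qed simp

lemma L2_inner_lborel:
  fixes f g :: "real^2 \<Rightarrow> real"
  assumes "(\<lambda>x. indicator \<Omega> x * (f x * g x)) \<in> borel_measurable borel"
  shows "L2_inner \<Omega> f g = (LINT x|lborel. indicator \<Omega> x * (f x * g x))"
  using lebesgue_on_integral_eq[OF assms] by (simp add: L2_inner_def)

end

section \<open>Lipschitz bounds for test functions\<close>

text \<open>Partial derivatives of a test function are test functions and therefore bounded; the
  mean value inequality along coordinate lines does the rest.\<close>

lemma test_functions_diff_quotient_bound: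
  assumes "\<phi> \<in> test_functions \<Omega>"
  obtains B where "B > 0" "\<And>i x h. \<bar>\<phi> (x + h *\<^sub>R axis i 1) - \<phi> x\<bar> \<le> B * \<bar>h\<bar>"
proof -
  have "\<exists>B>0. \<forall>x. \<bar>partial_deriv i \<phi> x\<bar> \<le> B" for i
    using test_functions_bounded[OF test_functions_partial_deriv[OF assms]] by metis
  then obtain b where b: "\<And>i. b i > 0" "\<And>i x. \<bar>partial_deriv i \<phi> x\<bar> \<le> b i" by metis
  define B where "B = b 1 + b 2"
  have B: "B > 0" "\<bar>partial_deriv i \<phi> x\<bar> \<le> B" for i x
    using b(1)[of 1] b(2)[of 1 x] b(1)[of 2] b(2)[of 2 x] exhaust_2[of i] by (auto simp: B_def)
  have "\<bar>\<phi> (x + h *\<^sub>R axis i 1) - \<phi> x\<bar> \<le> B * \<bar>h\<bar>" for i x h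
  proof -
    have d: "((\<lambda>t. \<phi> (x + t *\<^sub>R axis i 1)) has_real_derivative partial_deriv i \<phi> (x + t *\<^sub>R axis i 1)) (at t)" for t
    proof -
      let ?y = "x + t *\<^sub>R axis i (1::real)"
      let ?D = "frechet_derivative \<phi> (at ?y)"
      have D: "(\<phi> has_derivative ?D) (at ?y)"
        using smooth_differentiable[OF test_functions_smooth[OF assms]] by (simp add: frechet_derivative_works)
      have "((\<lambda>t. x + t *\<^sub>R axis i 1) has_derivative (\<lambda>s. s *\<^sub>R axis i 1)) (at t)"
        by (auto intro!: derivative_eq_intros)
      from has_derivative_compose[OF this, of \<phi> ?D] D
      have "((\<lambda>t. \<phi> (x + t *\<^sub>R axis i 1)) has_derivative (\<lambda>s. ?D (s *\<^sub>R axis i 1))) (at t)" by simp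
      moreover have "(\<lambda>s. ?D (s *\<^sub>R axis i 1)) = (\<lambda>s. ?D (axis i 1) * s)"
        using linear_cmul[OF has_derivative_linear[OF D]] by auto
      ultimately show ?thesis
        by (simp add: has_field_derivative_def partial_deriv_def)
    qed
    have "norm (\<phi> (x + h *\<^sub>R axis i 1) - \<phi> (x + 0 *\<^sub>R axis i 1)) \<le> B * norm (h - 0)"
      by (rule field_differentiable_bound[where S=UNIV and f="\<lambda>t. \<phi> (x + t *\<^sub>R axis i 1)"])
         (use d B in auto)
    then show ?thesis by simp
  qed
  with B(1) show thesis by (rule that)
qed

text \<open>Two points are joined through a corner \<open>?z\<close>, one coordinate at a time,
  which accounts for the factor 2.\<close>

lemma test_functions_lipschitz:
  assumes "\<phi> \<in> test_functions \<Omega>"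
  obtains M where "M-lipschitz_on UNIV \<phi>"
proof -
  obtain B where B: "B > 0" "\<And>i x h. \<bar>\<phi> (x + h *\<^sub>R axis i 1) - \<phi> x\<bar> \<le> B * \<bar>h\<bar>"
    using test_functions_diff_quotient_bound[OF assms] by metis
  have "dist (\<phi> x) (\<phi> y) \<le> 2 * B * dist x y" for x y
  proof -
    let ?z = "x + (y $ 1 - x $ 1) *\<^sub>R axis 1 1"
    have y: "y = ?z + (y $ 2 - x $ 2) *\<^sub>R axis 2 1"
      by (auto simp: vec_eq_iff forall_2 axis_def)
    have "\<bar>\<phi> ?z - \<phi> x\<bar> \<le> B * \<bar>y $ 1 - x $ 1\<bar>" by (rule B(2))
    moreover have "\<bar>\<phi> y - \<phi> ?z\<bar> \<le> B * \<bar>y $ 2 - x $ 2\<bar>"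
      using B(2)[of ?z "y $ 2 - x $ 2" 2] by (simp only: y[symmetric])
    moreover have "\<bar>y $ i - x $ i\<bar> \<le> dist x y" for i
      using Finite_Cartesian_Product.norm_nth_le[of "y - x" i] by (simp add: dist_norm norm_minus_commute)
    then have "B * \<bar>y $ 1 - x $ 1\<bar> \<le> B * dist x y" "B * \<bar>y $ 2 - x $ 2\<bar> \<le> B * dist x y"
      using B(1) by auto
    ultimately show ?thesis by (simp add: dist_real_def)
  qed
  then have "(2 * B)-lipschitz_on UNIV \<phi>" using B(1) by (auto intro: lipschitz_onI)
  then show thesis by (rule that)
qed

text \<open>By Rademacher's theorem the set \<open>S\<close> exists for every Lipschitz function; for the functions
  considered here it is explicit.\<close>

locale lipschitz_function = bounded_domain +
  fixes v :: "real^2 \<Rightarrow> real" and M :: real and S :: "(real^2) set"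
  assumes lip: "M-lipschitz_on \<Omega> v" and S: "open S" "S \<subseteq> \<Omega>" "negligible (\<Omega> - S)"
    and diff: "\<And>x. x \<in> S \<Longrightarrow> v differentiable (at x)"
begin

text \<open>The value 0 off S makes the function Borel and bounded on the whole plane and zero
  outside \<Omega>, so that it can be integrated over \<open>lborel\<close> as it stands.\<close>

definition pd :: "2 \<Rightarrow> real^2 \<Rightarrow> real" where
  "pd i x = (if x \<in> S then partial_deriv i v x else 0)"

text \<open>The extension by zero may jump at the boundary of \<Omega>: the Lipschitz bound is
  inherited only for increments between two points of \<Omega>.\<close>

definition V :: "real^2 \<Rightarrow> real" where
  "V x = indicator \<Omega> x * v x"

lemma M_nonneg: "0 \<le> M"
  using lip by (rule lipschitz_on_nonneg)

lemma V_borel [measurable]: "V \<in> borel_measurable borel"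
  using borel_measurable_continuous_on_indicator[OF _ lipschitz_on_continuous_on[OF lip]] open_domain
  by (simp add: V_def[abs_def])

lemma V_shift_borel [measurable]: "(\<lambda>x. V (x + a)) \<in> borel_measurable borel"
  by (rule measurable_compose[OF _ V_borel]) simp

lemma V_bounded: obtains B where "B > 0" "\<And>x. \<bar>V x\<bar> \<le> B"
proof -
  have "bounded (v ` \<Omega>)"
    by (rule bounded_uniformly_continuous_image[OF lipschitz_on_uniformly_continuous[OF lip] bounded_domain])
  then obtain B where "B > 0" "\<And>x. x \<in> \<Omega> \<Longrightarrow> \<bar>v x\<bar> \<le> B"
    by (auto simp: bounded_pos)
  then show thesis by (intro that[of B]) (auto simp: V_def indicator_def)
qed

lemma V_diff_quotient_bound:
  assumes "x \<in> \<Omega>" "x + h *\<^sub>R a \<in> \<Omega>" "h \<noteq> 0"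
  shows "\<bar>(V (x + h *\<^sub>R a) - V x) / h\<bar> \<le> M * norm a"
  using lipschitz_onD[OF lip assms(2,1)] assms
  by (simp add: V_def dist_norm abs_divide divide_le_eq abs_mult algebra_simps)

lemma V_diff_quotient_tendsto:
  assumes "x \<in> S" "h \<longlonglongrightarrow> 0" "\<And>n. h n \<noteq> 0"
  shows "(\<lambda>n. (V (x + h n *\<^sub>R a) - V x) / h n) \<longlonglongrightarrow> frechet_derivative v (at x) a"
proof (rule Lim_transform_eventually[OF diff_quotient_tendsto[OF diff[OF assms(1)] assms(2,3)]])
  have "(\<lambda>n. x + h n *\<^sub>R a) \<longlonglongrightarrow> x + 0 *\<^sub>R a"
    by (intro tendsto_intros assms)
  then have "\<forall>\<^sub>F n in sequentially. x + h n *\<^sub>R a \<in> S"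
    using S(1) assms(1) by (simp add: topological_tendstoD)
  then show "\<forall>\<^sub>F n in sequentially. (v (x + h n *\<^sub>R a) - v x) / h n = (V (x + h n *\<^sub>R a) - V x) / h n"
    by eventually_elim (use S(2) assms(1) in \<open>auto simp: V_def indicator_def\<close>)
qed

lemma V_diff_quotient_eventually_bound:
  assumes "x \<in> \<Omega>" "h \<longlonglongrightarrow> 0" "\<And>n. h n \<noteq> 0"
  shows "\<forall>\<^sub>F n in sequentially. \<bar>(V (x + h n *\<^sub>R a) - V x) / h n\<bar> \<le> M * norm a"
proof -
  have "(\<lambda>n. x + h n *\<^sub>R a) \<longlonglongrightarrow> x + 0 *\<^sub>R a"
    by (intro tendsto_intros assms)
  then have "\<forall>\<^sub>F n in sequentially. x + h n *\<^sub>R a \<in> \<Omega>"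
    using open_domain assms(1) by (simp add: topological_tendstoD)
  then show ?thesis
    by eventually_elim (use V_diff_quotient_bound assms in blast)
qed

lemma pd_eq: "x \<in> S \<Longrightarrow> pd i x = frechet_derivative v (at x) (axis i 1)"
  by (simp add: pd_def partial_deriv_def)

text \<open>A pointwise limit of Borel difference quotients along h = 1/(n + 1), cut off by the
  indicator of the open set S.\<close>

lemma pd_borel [measurable]: "pd i \<in> borel_measurable borel"
proof (rule borel_measurable_LIMSEQ_real)
  define h :: "nat \<Rightarrow> real" where "h = (\<lambda>n. inverse (real (Suc n)))"
  have h: "h \<longlonglongrightarrow> 0" "\<And>n. h n \<noteq> 0"
    using LIMSEQ_inverse_real_of_nat by (auto simp: h_def)
  show "(\<lambda>n. indicator S x * ((V (x + h n *\<^sub>R axis i 1) - V x) / h n)) \<longlonglongrightarrow> pd i x" for x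
    using V_diff_quotient_tendsto[OF _ h] by (cases "x \<in> S") (simp_all add: pd_eq, simp add: pd_def)
  show "(\<lambda>x. indicator S x * ((V (x + h n *\<^sub>R axis i 1) - V x) / h n)) \<in> borel_measurable borel" for n
    using S(1) by (intro borel_measurable_times borel_measurable_indicator borel_measurable_divide
        borel_measurable_diff V_borel V_shift_borel) auto
qed

lemma pd_bound: "\<bar>pd i x\<bar> \<le> M"
proof (cases "x \<in> S")
  case True
  define h :: "nat \<Rightarrow> real" where "h = (\<lambda>n. inverse (real (Suc n)))"
  have h: "h \<longlonglongrightarrow> 0" "\<And>n. h n \<noteq> 0"
    using LIMSEQ_inverse_real_of_nat by (auto simp: h_def)
  have "(\<lambda>n. \<bar>(V (x + h n *\<^sub>R axis i 1) - V x) / h n\<bar>) \<longlonglongrightarrow> \<bar>pd i x\<bar>"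
    unfolding pd_eq[OF True] by (intro tendsto_rabs V_diff_quotient_tendsto True h)
  then show ?thesis
    by (rule tendsto_upperbound)
      (use V_diff_quotient_eventually_bound[OF _ h, of x "axis i 1"] True S in auto)
qed (use M_nonneg in \<open>simp add: pd_def\<close>)

lemma pd_L2: "pd i \<in> L2 \<Omega>"
  by (rule L2_bounded[OF finite_measure_domain, of _ M]) (use pd_bound in \<open>auto intro!: measurable_restrict_space1 measurable_completion\<close>)

lemma v_L2: "v \<in> L2 \<Omega>"
proof -
  obtain B where B: "\<And>x. \<bar>V x\<bar> \<le> B" using V_bounded by blast
  have "norm (v x) \<le> B" if "x \<in> \<Omega>" for x using B[of x] that by (simp add: V_def)
  then have "AE x in lebesgue_on \<Omega>. norm (v x) \<le> B"
    by (intro AE_I2) (simp add: space_restrict_space)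
  then show ?thesis
    by (intro L2_bounded[OF finite_measure_domain] continuous_borel_measurable lipschitz_on_continuous_on[OF lip])
qed

lemma AE_S: "AE x in lborel. x \<in> \<Omega> \<longrightarrow> x \<in> S"
proof -
  have "AE x in lebesgue. x \<notin> \<Omega> - S"
    using S(3) by (intro AE_not_in) (simp add: negligible_iff_null_sets)
  then show ?thesis by (auto simp: AE_completion_iff elim: eventually_mono)
qed

text \<open>A translation moves the difference quotient from \<phi> to v and reverses its step, and
  the reversal produces the minus sign. Since \<open>V\<close> may jump at the boundary, its
  quotients are bounded by M only at points that stay in \<Omega> after the shift; the steps are
  therefore kept below the distance \<delta> between the support of \<phi> and the complement of
  \<Omega>.\<close>

lemma has_weak_deriv_pd: "has_weak_deriv \<Omega> (mi_single 1 i) v (pd i)"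
  unfolding has_weak_deriv_def mi_order_single mi_deriv_single
proof
  fix \<phi> assume \<phi>: "\<phi> \<in> test_functions \<Omega>"
  let ?e = "axis i 1 :: real^2"
  obtain Bv where Bv: "Bv > 0" "\<And>x. \<bar>V x\<bar> \<le> Bv" using V_bounded by blast
  obtain B1 where B1: "B1 > 0" "\<And>x. \<bar>\<phi> x\<bar> \<le> B1" using test_functions_bounded[OF \<phi>] by blast
  obtain B2 where B2: "B2 > 0" "\<And>i x h. \<bar>\<phi> (x + h *\<^sub>R axis i 1) - \<phi> x\<bar> \<le> B2 * \<bar>h\<bar>"
    using test_functions_diff_quotient_bound[OF \<phi>] by metis
  have cont: "continuous_on UNIV \<phi>" "continuous_on UNIV (partial_deriv i \<phi>)"
    using \<phi> test_functions_partial_deriv[OF \<phi>] by (auto intro!: smooth_continuous_on test_functions_smooth)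
  then have [measurable]: "\<phi> \<in> borel_measurable borel" "partial_deriv i \<phi> \<in> borel_measurable borel"
    by (auto intro: borel_measurable_continuous_onI)
  obtain K where K: "compact K" "K \<subseteq> \<Omega>" "\<And>x. x \<notin> K \<Longrightarrow> \<phi> x = 0"
    using test_functions_support[OF \<phi>] zero_off_closure_support by metis
  obtain \<delta> where \<delta>: "\<delta> > 0" "\<And>x y. x \<in> K \<Longrightarrow> y \<in> - \<Omega> \<Longrightarrow> \<delta> \<le> dist x y"
    using separate_compact_closed[OF K(1), of "- \<Omega>"] open_domain K(2) by blast
  have stay: "x - h *\<^sub>R ?e \<in> \<Omega>" if "x \<in> K" "\<bar>h\<bar> < \<delta>" for x h
    using \<delta>(2)[OF that(1), of "x - h *\<^sub>R ?e"] that(2) by (force simp: dist_norm)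
  define h :: "nat \<Rightarrow> real" where "h n = \<delta> / 2 * inverse (real (Suc n))" for n
  have h_lim: "h \<longlonglongrightarrow> 0"
    using tendsto_mult[OF tendsto_const LIMSEQ_inverse_real_of_nat, of "\<delta>/2"] by (simp add: h_def[abs_def])
  have h0: "h n \<noteq> 0" "h n > 0" for n using \<delta>(1) by (auto simp: h_def)
  have h_small: "\<bar>h n\<bar> < \<delta>" for n
  proof -
    have "h n \<le> \<delta> / 2 * 1"
      unfolding h_def using \<delta>(1) by (intro mult_left_mono) (auto simp: inverse_eq_divide)
    then show ?thesis using \<delta>(1) h0(2)[of n] by simp
  qed
  have int1: "integrable lborel (\<lambda>x. V x * \<phi> (x + a))" for a
  proof (rule integrable_lborel_bounded_support[OF _ bounded_domain])
    show "\<bar>V x * \<phi> (x + a)\<bar> \<le> Bv * B1" for x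
      unfolding abs_mult by (intro mult_mono Bv B1) (use Bv in auto)
    show "V x * \<phi> (x + a) = 0" if "x \<notin> \<Omega>" for x using that by (simp add: V_def)
  qed measurable
  have int2: "integrable lborel (\<lambda>x. V (x - a) * \<phi> x)" for a
  proof (rule integrable_lborel_bounded_support)
    show "bounded K" by (rule compact_imp_bounded[OF K(1)])
    show "(\<lambda>x. V (x - a) * \<phi> x) \<in> borel_measurable borel"
      using V_shift_borel[of "- a"] by simp
    show "\<bar>V (x - a) * \<phi> x\<bar> \<le> Bv * B1" for x
      unfolding abs_mult by (intro mult_mono Bv B1) (use Bv in auto)
  qed (use K(3) in auto)
  have swap: "(LINT x|lborel. V x * ((\<phi> (x + h n *\<^sub>R ?e) - \<phi> x) / h n)) =
      (LINT x|lborel. (V (x + (- h n) *\<^sub>R ?e) - V x) / h n * \<phi> x)" for n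
  proof -
    let ?a = "h n *\<^sub>R ?e"
    have "(LINT x|lborel. V x * \<phi> (x + ?a)) = (LINT x|lborel. V (x - ?a) * \<phi> x)"
      using lborel_integral_translate[of "\<lambda>x. V (x - ?a) * \<phi> x" ?a] by simp
    then have "(LINT x|lborel. V x * \<phi> (x + ?a)) - (LINT x|lborel. V x * \<phi> x) =
        (LINT x|lborel. V (x - ?a) * \<phi> x) - (LINT x|lborel. V x * \<phi> x)" by simp
    then have "(LINT x|lborel. V x * \<phi> (x + ?a) - V x * \<phi> x) = (LINT x|lborel. V (x - ?a) * \<phi> x - V x * \<phi> x)"
      using int1[of ?a] int2[of ?a] int1[of 0] by simp
    then have "(LINT x|lborel. (V x * \<phi> (x + ?a) - V x * \<phi> x) / h n) =
        (LINT x|lborel. (V (x - ?a) * \<phi> x - V x * \<phi> x) / h n)" by simp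
    then show ?thesis by (simp add: algebra_simps diff_divide_distrib)
  qed
  have lim1: "(\<lambda>n. LINT x|lborel. V x * ((\<phi> (x + h n *\<^sub>R ?e) - \<phi> x) / h n)) \<longlonglongrightarrow>
      (LINT x|lborel. V x * partial_deriv i \<phi> x)"
  proof (rule integral_dominated_convergence[where w="\<lambda>x. indicator \<Omega> x * (Bv * B2)"])
    show "integrable lborel (\<lambda>x. indicator \<Omega> x * (Bv * B2))"
      by (rule integrable_indicator_domain)
    show "AE x in lborel. (\<lambda>n. V x * ((\<phi> (x + h n *\<^sub>R ?e) - \<phi> x) / h n)) \<longlonglongrightarrow> V x * partial_deriv i \<phi> x"
      unfolding partial_deriv_def
      by (intro AE_I2 tendsto_mult tendsto_const diff_quotient_tendsto h_lim h0
          smooth_differentiable[OF test_functions_smooth[OF \<phi>]])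
    show "AE x in lborel. norm (V x * ((\<phi> (x + h n *\<^sub>R ?e) - \<phi> x) / h n)) \<le> indicator \<Omega> x * (Bv * B2)" for n
    proof (rule AE_I2)
      fix x
      have "\<bar>(\<phi> (x + h n *\<^sub>R ?e) - \<phi> x) / h n\<bar> \<le> B2"
        using B2(2)[of x "h n" i] h0(2)[of n] by (simp add: abs_divide divide_le_eq)
      then have "\<bar>V x\<bar> * \<bar>(\<phi> (x + h n *\<^sub>R ?e) - \<phi> x) / h n\<bar> \<le> Bv * B2"
        by (intro mult_mono Bv) (use Bv in auto)
      then show "norm (V x * ((\<phi> (x + h n *\<^sub>R ?e) - \<phi> x) / h n)) \<le> indicator \<Omega> x * (Bv * B2)"
        by (auto simp: abs_mult V_def indicator_def)
    qed
  qed measurable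
  have lim2: "(\<lambda>n. LINT x|lborel. (V (x + (- h n) *\<^sub>R ?e) - V x) / h n * \<phi> x) \<longlonglongrightarrow>
      (LINT x|lborel. - (pd i x * \<phi> x))"
  proof (rule integral_dominated_convergence[where w="\<lambda>x. indicator \<Omega> x * (M * B1)"])
    show "integrable lborel (\<lambda>x. indicator \<Omega> x * (M * B1))"
      by (rule integrable_indicator_domain)
    show "AE x in lborel. (\<lambda>n. (V (x + (- h n) *\<^sub>R ?e) - V x) / h n * \<phi> x) \<longlonglongrightarrow> - (pd i x * \<phi> x)"
      using AE_S
    proof eventually_elim
      fix x assume x: "x \<in> \<Omega> \<longrightarrow> x \<in> S"
      show "(\<lambda>n. (V (x + (- h n) *\<^sub>R ?e) - V x) / h n * \<phi> x) \<longlonglongrightarrow> - (pd i x * \<phi> x)"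
      proof (cases "x \<in> S")
        case True
        have "(\<lambda>n. - h n) \<longlonglongrightarrow> 0" using tendsto_minus[OF h_lim] by simp
        then have "(\<lambda>n. (V (x + (- h n) *\<^sub>R ?e) - V x) / (- h n)) \<longlonglongrightarrow> pd i x"
          unfolding pd_eq[OF True] by (rule V_diff_quotient_tendsto[OF True]) (use h0 in simp)
        then have "(\<lambda>n. - ((V (x + (- h n) *\<^sub>R ?e) - V x) / (- h n)) * \<phi> x) \<longlonglongrightarrow> - (pd i x) * \<phi> x"
          by (intro tendsto_mult tendsto_minus tendsto_const)
        then show ?thesis by simp
      next
        case False
        with x K have "\<phi> x = 0" by blast
        then show ?thesis by simp
      qed
    qed
    show "AE x in lborel. norm ((V (x + (- h n) *\<^sub>R ?e) - V x) / h n * \<phi> x) \<le> indicator \<Omega> x * (M * B1)" for n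
    proof (rule AE_I2)
      fix x
      show "norm ((V (x + (- h n) *\<^sub>R ?e) - V x) / h n * \<phi> x) \<le> indicator \<Omega> x * (M * B1)"
      proof (cases "x \<in> K")
        case True
        then have "x \<in> \<Omega>" "x + (- h n) *\<^sub>R ?e \<in> \<Omega>" using K(2) stay[OF True h_small] by auto
        then have "\<bar>(V (x + (- h n) *\<^sub>R ?e) - V x) / (- h n)\<bar> \<le> M * norm ?e"
          by (intro V_diff_quotient_bound) (use h0 in auto)
        then have "\<bar>(V (x + (- h n) *\<^sub>R ?e) - V x) / h n\<bar> * \<bar>\<phi> x\<bar> \<le> M * B1"
          by (intro mult_mono B1) (use M_nonneg in auto)
        then show ?thesis using \<open>x \<in> \<Omega>\<close> by (simp add: abs_mult)
      next
        case False
        then show ?thesis using K(3) M_nonneg B1(1) by simp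
      qed
    qed
  qed measurable
  have "(LINT x|lborel. V x * partial_deriv i \<phi> x) = (LINT x|lborel. - (pd i x * \<phi> x))"
    using lim1 lim2 unfolding swap by (rule LIMSEQ_unique)
  moreover have "L2_inner \<Omega> v (partial_deriv i \<phi>) = (LINT x|lborel. V x * partial_deriv i \<phi> x)"
    by (subst L2_inner_lborel) (auto simp: V_def[symmetric] mult.assoc[symmetric])
  moreover have "L2_inner \<Omega> (pd i) \<phi> = (LINT x|lborel. pd i x * \<phi> x)"
  proof -
    have *: "(\<lambda>x. indicator \<Omega> x * (pd i x * \<phi> x)) = (\<lambda>x. pd i x * \<phi> x)"
      using S(2) by (auto simp: indicator_def pd_def fun_eq_iff)
    show ?thesis by (subst L2_inner_lborel) (simp_all only: *, measurable)
  qed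
  ultimately show "L2_inner \<Omega> v (partial_deriv i \<phi>) = (- 1) ^ 1 * L2_inner \<Omega> (pd i) \<phi>"
    by simp
qed

lemma v_H1: "v \<in> Hk 1 \<Omega>"
  using v_L2 pd_L2 has_weak_deriv_pd by (rule H1I)

lemma grad_v_AE: "AE x in lebesgue_on \<Omega>. grad \<Omega> v x = (\<chi> i. pd i x)"
  using pd_L2 has_weak_deriv_pd by (rule grad_eq_AE)

end

section \<open>The inequality of Poincare\<close>

context lipschitz_function
begin

text \<open>The squared norm of v(x + a) - v(x) over those x for which x and x + a both lie in
  \<Omega>, so that jumps of \<open>V\<close> at the boundary do not enter.\<close>

definition translation_diff :: "real^2 \<Rightarrow> real" where
  "translation_diff a = (LINT x|lborel. indicator \<Omega> x * (indicator \<Omega> (x + a) * (V (x + a) - V x)\<^sup>2))"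

lemma indicator_domain_borel [measurable]:
  "(indicator \<Omega> :: _ \<Rightarrow> real) \<in> borel_measurable borel"
  "(\<lambda>x. indicator \<Omega> (x + a) :: real) \<in> borel_measurable borel"
proof -
  show 1: "(indicator \<Omega> :: _ \<Rightarrow> real) \<in> borel_measurable borel"
    using open_domain by (intro borel_measurable_indicator) simp
  show "(\<lambda>x. indicator \<Omega> (x + a) :: real) \<in> borel_measurable borel"
    by (rule measurable_compose[OF _ 1]) simp
qed

text \<open>The four shifts are independent so that every piece of a subdivided increment is an
  instance.\<close>

lemma translation_integrable:
  "integrable lborel (\<lambda>x. indicator \<Omega> (x + c) * (indicator \<Omega> (x + d) * (V (x + a) - V (x + b))\<^sup>2))"
proof -
  obtain B where B: "B > 0" "\<And>x. \<bar>V x\<bar> \<le> B" using V_bounded by blast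
  show ?thesis
  proof (rule integrable_lborel_bounded_support)
    show "bounded ((\<lambda>x. x - c) ` \<Omega>)"
      using bounded_translation[OF bounded_domain, of "- c"] by (simp add: add.commute)
    fix x
    have "(V (x + a) - V (x + b))\<^sup>2 \<le> (2 * B)\<^sup>2"
      using B(2)[of "x + a"] B(2)[of "x + b"] B(1) by (intro power2_le_iff_abs_le[THEN iffD2]) auto
    then show "\<bar>indicator \<Omega> (x + c) * (indicator \<Omega> (x + d) * (V (x + a) - V (x + b))\<^sup>2)\<bar> \<le> (2 * B)\<^sup>2"
      by (simp add: indicator_def)
    show "indicator \<Omega> (x + c) * (indicator \<Omega> (x + d) * (V (x + a) - V (x + b))\<^sup>2) = 0"
      if "x \<notin> (\<lambda>x. x - c) ` \<Omega>"
    proof -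
      have "x + c \<notin> \<Omega>" using that by (auto simp: image_iff)
      then show ?thesis by simp
    qed
  qed measurable
qed

lemma sum_telescope_power2_le:
  fixes f :: "nat \<Rightarrow> real"
  shows "(f n - f 0)\<^sup>2 \<le> real n * (\<Sum>k<n. (f (Suc k) - f k)\<^sup>2)"
proof -
  have "(\<Sum>k<n. f (Suc k) - f k)\<^sup>2 \<le> (\<Sum>k<n. (f (Suc k) - f k)\<^sup>2) * real (card {..<n})"
    using sum_squared_le_sum_of_squares[of "\<lambda>k. f (Suc k) - f k" "{..<n}"] by simp
  then show ?thesis by (simp add: sum_lessThan_telescope mult.commute)
qed

text \<open>The segment from \<open>x\<close> to \<open>x + n b\<close> stays in \<open>\<Omega>\<close> by convexity, so that the
  squared increment over it is controlled by its \<open>n\<close> pieces, and each piece is a translate of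
  the first.\<close>

lemma translation_diff_scale:
  assumes "convex \<Omega>"
  shows "translation_diff (real n *\<^sub>R b) \<le> (real n)\<^sup>2 * translation_diff b"
proof (cases "n = 0")
  case True
  then show ?thesis by (simp add: translation_diff_def)
next
  case False
  let ?p = "\<lambda>k x. x + real k *\<^sub>R b"
  let ?g = "\<lambda>k x. indicator \<Omega> (?p k x) * (indicator \<Omega> (?p (Suc k) x) * (V (?p (Suc k) x) - V (?p k x))\<^sup>2)"
  have int: "integrable lborel (?g k)" for k
    by (rule translation_integrable)
  have eq: "(LINT x|lborel. ?g k x) = translation_diff b" for k
  proof -
    have "(LINT x|lborel. ?g k x) = (LINT x|lborel. (\<lambda>x. indicator \<Omega> x * (indicator \<Omega> (x + b) * (V (x + b) - V x)\<^sup>2)) (x + real k *\<^sub>R b))"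
      by (simp add: algebra_simps)
    also have "\<dots> = translation_diff b"
      unfolding translation_diff_def by (rule lborel_integral_translate) measurable
    finally show ?thesis .
  qed
  have mem: "?p k x \<in> \<Omega>" if "x \<in> \<Omega>" "?p n x \<in> \<Omega>" "k \<le> n" for k x
  proof -
    have "(1 - real k / real n) *\<^sub>R x + (real k / real n) *\<^sub>R ?p n x \<in> \<Omega>"
      using assms that False by (intro convexD_alt) auto
    also have "(1 - real k / real n) *\<^sub>R x + (real k / real n) *\<^sub>R ?p n x = ?p k x"
      using False by (simp add: algebra_simps)
    finally show ?thesis .
  qed
  have "translation_diff (real n *\<^sub>R b) \<le> (LINT x|lborel. real n * (\<Sum>k<n. ?g k x))"
    unfolding translation_diff_def
  proof (rule integral_mono)
    show "integrable lborel (\<lambda>x. indicator \<Omega> x * (indicator \<Omega> (?p n x) * (V (?p n x) - V x)\<^sup>2))"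
      using translation_integrable[of 0 "real n *\<^sub>R b" "real n *\<^sub>R b" 0] by simp
    show "integrable lborel (\<lambda>x. real n * (\<Sum>k<n. ?g k x))"
      by (intro integrable_mult_right Bochner_Integration.integrable_sum int)
    fix x
    show "indicator \<Omega> x * (indicator \<Omega> (?p n x) * (V (?p n x) - V x)\<^sup>2) \<le> real n * (\<Sum>k<n. ?g k x)"
    proof (cases "x \<in> \<Omega> \<and> ?p n x \<in> \<Omega>")
      case True
      then have "?g k x = (V (?p (Suc k) x) - V (?p k x))\<^sup>2" if "k < n" for k
        using mem[of x k] mem[of x "Suc k"] that by (simp del: of_nat_Suc)
      then have "(\<Sum>k<n. ?g k x) = (\<Sum>k<n. (V (?p (Suc k) x) - V (?p k x))\<^sup>2)"
        by (intro sum.cong refl) auto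
      moreover have "indicator \<Omega> x * (indicator \<Omega> (?p n x) * (V (?p n x) - V x)\<^sup>2) = (V (?p n x) - V (?p 0 x))\<^sup>2"
        using True by simp
      ultimately show ?thesis
        using sum_telescope_power2_le[of "\<lambda>k. V (?p k x)" n] by (simp only:)
    next
      case False
      then show ?thesis by (auto intro!: mult_nonneg_nonneg sum_nonneg)
    qed
  qed
  also have "\<dots> = real n * (\<Sum>k<n. LINT x|lborel. ?g k x)"
    by (simp only: integral_mult_right_zero Bochner_Integration.integral_sum[OF int])
  also have "\<dots> = (real n)\<^sup>2 * translation_diff b"
    unfolding eq by (simp add: power2_eq_square)
  finally show ?thesis .
qed

definition gradient_energy :: real where
  "gradient_energy = (LINT x|lborel. (norm (\<chi> i. pd i x))\<^sup>2)"

lemma gradient_energy_integrable: "integrable lborel (\<lambda>x. (norm (\<chi> i. pd i x))\<^sup>2)"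
  and gradient_energy_eq: "gradient_energy = (L2_norm \<Omega> (grad \<Omega> v))\<^sup>2"
proof -
  have 1: "(norm (\<chi> i. pd i x))\<^sup>2 = (pd 1 x)\<^sup>2 + (pd 2 x)\<^sup>2" for x
    unfolding power2_norm_eq_inner by (simp add: inner_vec_def sum_2 power2_eq_square)
  show "integrable lborel (\<lambda>x. (norm (\<chi> i. pd i x))\<^sup>2)"
  proof (rule integrable_lborel_bounded_support[OF _ bounded_domain])
    fix x
    have "(pd i x)\<^sup>2 \<le> M\<^sup>2" for i
      using pd_bound M_nonneg by (simp add: power2_le_iff_abs_le)
    from this[of 1] this[of 2] show "\<bar>(norm (\<chi> i. pd i x))\<^sup>2\<bar> \<le> 2 * M\<^sup>2" unfolding 1 by simp
    show "(norm (\<chi> i. pd i x))\<^sup>2 = 0" if "x \<notin> \<Omega>"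
      using that S(2) unfolding 1 by (auto simp: pd_def)
  qed (unfold 1, measurable)
  have *: "(\<lambda>x. indicator \<Omega> x * (norm (\<chi> i. pd i x))\<^sup>2) = (\<lambda>x. (norm (\<chi> i. pd i x))\<^sup>2)"
    using S(2) unfolding 1 by (auto simp: indicator_def pd_def fun_eq_iff)
  have L2: "(\<lambda>x. \<chi> i. pd i x) \<in> L2 \<Omega>"
    using pd_L2 by (simp add: L2_vec_iff)
  have "(L2_norm \<Omega> (grad \<Omega> v))\<^sup>2 = (L2_norm \<Omega> (\<lambda>x. \<chi> i. pd i x))\<^sup>2"
    using L2_norm_cong_AE[OF grad_L2[OF v_H1] L2 grad_v_AE] by simp
  also have "\<dots> = (LINT x|lebesgue_on \<Omega>. (norm (\<chi> i. pd i x))\<^sup>2)"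
    by (simp add: L2_norm_power2 L2_inner_def power2_norm_eq_inner)
  also have "\<dots> = gradient_energy"
    unfolding gradient_energy_def
    by (subst lebesgue_on_integral_eq) (simp_all only: *, unfold 1, measurable)
  finally show "gradient_energy = (L2_norm \<Omega> (grad \<Omega> v))\<^sup>2" by simp
qed

text \<open>The derivative is linear, so its value at a is the inner product of a with the vector of
  partial derivatives, and Cauchy-Schwarz applies.\<close>

lemma frechet_derivative_le:
  assumes "x \<in> S"
  shows "(frechet_derivative v (at x) a)\<^sup>2 \<le> (norm a)\<^sup>2 * (norm (\<chi> i. pd i x))\<^sup>2"
proof -
  let ?D = "frechet_derivative v (at x)"
  have lin: "linear ?D"
    using diff[OF assms] by (simp add: frechet_derivative_works has_derivative_linear)
  have a: "a = a $ 1 *\<^sub>R axis 1 1 + a $ 2 *\<^sub>R axis 2 1"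
    by (auto simp: vec_eq_iff forall_2 axis_def)
  have "?D a = a $ 1 * ?D (axis 1 1) + a $ 2 * ?D (axis 2 1)"
    by (subst a) (simp only: linear_add[OF lin] linear_cmul[OF lin] real_scaleR_def)
  also have "\<dots> = a \<bullet> (\<chi> i. pd i x)"
    by (simp add: inner_vec_def sum_2 pd_eq[OF assms])
  finally have "\<bar>?D a\<bar> \<le> norm a * norm (\<chi> i. pd i x)"
    by (simp add: Cauchy_Schwarz_ineq2)
  then have "\<bar>?D a\<bar>\<^sup>2 \<le> (norm a * norm (\<chi> i. pd i x))\<^sup>2"
    by (intro power_mono) auto
  then show ?thesis by (simp add: power_mult_distrib)
qed

text \<open>Dividing a into n + 1 equal steps costs a factor (n + 1)^2, which turns the squared
  increment over one step into a squared difference quotient. As n grows, the quotients converge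
  almost everywhere to the directional derivative and are dominated through the Lipschitz
  constant.\<close>

lemma translation_diff_le:
  assumes "convex \<Omega>"
  shows "translation_diff a \<le> (norm a)\<^sup>2 * gradient_energy"
proof -
  define h :: "nat \<Rightarrow> real" where "h = (\<lambda>n. inverse (real (Suc n)))"
  have h: "h \<longlonglongrightarrow> 0" "\<And>n. h n \<noteq> 0" "\<And>n. h n > 0"
    using LIMSEQ_inverse_real_of_nat by (auto simp: h_def)
  let ?q = "\<lambda>n x. indicator \<Omega> x * (indicator \<Omega> (x + h n *\<^sub>R a) * ((V (x + h n *\<^sub>R a) - V x) / h n)\<^sup>2)"
  let ?l = "\<lambda>x. indicator S x * (frechet_derivative v (at x) a)\<^sup>2"
  have lim_pt: "(\<lambda>n. ?q n x) \<longlonglongrightarrow> ?l x" if x: "x \<in> \<Omega> \<longrightarrow> x \<in> S" for x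
  proof (cases "x \<in> S")
    case True
    have "(\<lambda>n. x + h n *\<^sub>R a) \<longlonglongrightarrow> x + 0 *\<^sub>R a"
      by (intro tendsto_intros h)
    then have "\<forall>\<^sub>F n in sequentially. x + h n *\<^sub>R a \<in> \<Omega>"
      using open_domain True S(2) by (intro topological_tendstoD) auto
    then have "\<forall>\<^sub>F n in sequentially. ((V (x + h n *\<^sub>R a) - V x) / h n)\<^sup>2 = ?q n x"
      by eventually_elim (use True S(2) in auto)
    moreover have "(\<lambda>n. ((V (x + h n *\<^sub>R a) - V x) / h n)\<^sup>2) \<longlonglongrightarrow> (frechet_derivative v (at x) a)\<^sup>2"
      by (intro tendsto_power V_diff_quotient_tendsto True h)
    ultimately have "(\<lambda>n. ?q n x) \<longlonglongrightarrow> (frechet_derivative v (at x) a)\<^sup>2"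
      by (rule Lim_transform_eventually[rotated])
    with True show ?thesis by simp
  next
    case False
    then show ?thesis using x by auto
  qed
  have meas_q: "?q n \<in> borel_measurable borel" for n
    by measurable
  have bound_q: "\<bar>?q n x\<bar> \<le> indicator \<Omega> x * (M * norm a)\<^sup>2" for n x
  proof (cases "x \<in> \<Omega> \<and> x + h n *\<^sub>R a \<in> \<Omega>")
    case True
    then have "\<bar>(V (x + h n *\<^sub>R a) - V x) / h n\<bar> \<le> M * norm a"
      by (intro V_diff_quotient_bound h) auto
    then have "((V (x + h n *\<^sub>R a) - V x) / h n)\<^sup>2 \<le> (M * norm a)\<^sup>2"
      using M_nonneg by (intro power2_le_iff_abs_le[THEN iffD2]) auto
    with True show ?thesis by simp
  next
    case False
    then show ?thesis by auto
  qed
  have meas_l: "(\<lambda>x. indicator S x * (frechet_derivative v (at x) a)\<^sup>2) \<in> borel_measurable borel"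
  proof (rule borel_measurable_LIMSEQ_real)
    have [measurable]: "(indicator S :: _ \<Rightarrow> real) \<in> borel_measurable borel"
      using S(1) by (intro borel_measurable_indicator) simp
    show "(\<lambda>n. indicator S x * ?q n x) \<longlonglongrightarrow> ?l x" for x
      using lim_pt[of x] by (cases "x \<in> S") auto
    show "(\<lambda>x. indicator S x * ?q n x) \<in> borel_measurable borel" for n
      using meas_q by measurable
  qed
  have "(\<lambda>n. LINT x|lborel. ?q n x) \<longlonglongrightarrow> (LINT x|lborel. ?l x)"
  proof (rule integral_dominated_convergence)
    show "?l \<in> borel_measurable lborel" "\<And>n. ?q n \<in> borel_measurable lborel"
      using meas_l meas_q by simp_all
    show "integrable lborel (\<lambda>x. indicator \<Omega> x * (M * norm a)\<^sup>2)"
      by (rule integrable_indicator_domain)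
    show "AE x in lborel. (\<lambda>n. ?q n x) \<longlonglongrightarrow> ?l x"
      using AE_S by eventually_elim (rule lim_pt)
    show "AE x in lborel. norm (?q n x) \<le> indicator \<Omega> x * (M * norm a)\<^sup>2" for n
      using bound_q by simp
  qed
  moreover have "translation_diff a \<le> (LINT x|lborel. ?q n x)" for n
  proof -
    have "translation_diff a = translation_diff (real (Suc n) *\<^sub>R (h n *\<^sub>R a))"
      by (simp add: h_def del: of_nat_Suc)
    also have "\<dots> \<le> (real (Suc n))\<^sup>2 * translation_diff (h n *\<^sub>R a)"
      by (rule translation_diff_scale[OF assms])
    also have "\<dots> = (LINT x|lborel. (real (Suc n))\<^sup>2 * (indicator \<Omega> x * (indicator \<Omega> (x + h n *\<^sub>R a) * (V (x + h n *\<^sub>R a) - V x)\<^sup>2)))"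
      by (simp add: translation_diff_def)
    also have "\<dots> = (LINT x|lborel. ?q n x)"
      by (intro Bochner_Integration.integral_cong) (auto simp: h_def power_mult_distrib divide_inverse)
    finally show ?thesis .
  qed
  ultimately have "translation_diff a \<le> (LINT x|lborel. ?l x)"
    by (intro LIMSEQ_le_const) auto
  also have "\<dots> \<le> (LINT x|lborel. (norm a)\<^sup>2 * (norm (\<chi> i. pd i x))\<^sup>2)"
  proof (rule integral_mono_AE')
    show "integrable lborel (\<lambda>x. (norm a)\<^sup>2 * (norm (\<chi> i. pd i x))\<^sup>2)"
      using gradient_energy_integrable by simp
    show "AE x in lborel. ?l x \<le> (norm a)\<^sup>2 * (norm (\<chi> i. pd i x))\<^sup>2"
      using frechet_derivative_le by (intro AE_I2) (simp add: indicator_def)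
    show "AE x in lborel. 0 \<le> (norm a)\<^sup>2 * (norm (\<chi> i. pd i x))\<^sup>2"
      by simp
  qed
  also have "\<dots> = (norm a)\<^sup>2 * gradient_energy"
    by (simp add: gradient_energy_def)
  finally show ?thesis .
qed

end

text \<open>For mean-free v, integrating (v(y) - v(x))^2 over y in \<Omega> gives m v(x)^2 +
  ||v||^2, where m is the measure of \<Omega>. The substitution y = a + x and Tonelli's theorem turn
  the double integral into the integral of \<open>translation_diff\<close> over a, which vanishes
  once |a| exceeds the diameter d. The outcome is ||v||^2 \<le> (d^2 D / m) ||\<nabla>v||^2, where D
  is the measure of a ball of radius d.\<close>

lemma (in bounded_domain) poincare_constant:
  assumes "\<Omega> \<noteq> {}" "convex \<Omega>"
  obtains C where "C > 0"
    "\<And>v M S. lipschitz_function \<Omega> v M S \<Longrightarrow> (LINT x|lebesgue_on \<Omega>. v x) = 0 \<Longrightarrow>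
      L2_norm \<Omega> v \<le> C * L2_norm \<Omega> (grad \<Omega> v)"
proof -
  define m where "m = measure lborel \<Omega>"
  have fin_m: "emeasure lborel \<Omega> < \<infinity>"
    using emeasure_bounded_finite[OF bounded_domain] by simp
  have m: "m > 0" "emeasure lborel \<Omega> = ennreal m"
  proof -
    have "emeasure lborel \<Omega> \<noteq> 0"
    proof
      assume "emeasure lborel \<Omega> = 0"
      then have "\<Omega> \<in> null_sets lebesgue"
        using open_domain by (intro null_sets_completionI) (simp add: null_sets_def)
      then show False
        using open_not_negligible[OF open_domain assms(1)] by (simp add: negligible_iff_null_sets)
    qed
    then show "m > 0" "emeasure lborel \<Omega> = ennreal m"
      using fin_m by (auto simp: m_def emeasure_eq_ennreal_measure zero_less_measure_iff)
  qed
  define d where "d = diameter \<Omega>"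
  have d: "norm (y - x) \<le> d" if "x \<in> \<Omega>" "y \<in> \<Omega>" for x y
    using diameter_bounded_bound[OF bounded_domain that] by (simp add: d_def dist_norm norm_minus_commute)
  have d0: "d \<ge> 0" using d assms(1) by fastforce
  define D where "D = measure lborel (cball (0::real^2) d)"
  have D: "emeasure lborel (cball (0::real^2) d) = ennreal D"
    using emeasure_compact_finite[OF compact_cball, of "0::real^2" d]
    by (simp add: D_def emeasure_eq_ennreal_measure less_top)
  \<comment> \<open>The summand 1 makes the constant positive without a lower bound for d and
    D.\<close>
  define C where "C = sqrt (d\<^sup>2 * D / m) + 1"
  have "C > 0" unfolding C_def using m(1) by (intro add_nonneg_pos) (auto simp: D_def)
  moreover have "L2_norm \<Omega> v \<le> C * L2_norm \<Omega> (grad \<Omega> v)"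
    if "lipschitz_function \<Omega> v M S" and mean: "(LINT x|lebesgue_on \<Omega>. v x) = 0" for v M S
  proof -
    interpret lipschitz_function \<Omega> v M S by fact
    obtain B where B: "B > 0" "\<And>x. \<bar>V x\<bar> \<le> B" using V_bounded by blast
    have V_ind: "indicator \<Omega> x * V x = V x" for x by (simp add: V_def indicator_def)
    have intV: "integrable lborel V"
      by (rule integrable_lborel_bounded_support[OF V_borel bounded_domain B(2)]) (simp add: V_def)
    have intV2: "integrable lborel (\<lambda>x. (V x)\<^sup>2)"
      by (rule integrable_lborel_bounded_support[OF _ bounded_domain, of _ "B\<^sup>2"])
         (use B in \<open>auto simp: V_def power2_le_iff_abs_le\<close>, simp add: V_def[symmetric])
    have meanV: "(LINT x|lborel. V x) = 0"
      using mean lebesgue_on_integral_eq[of v] by (simp add: V_def[symmetric])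
    define E where "E = (LINT x|lborel. (V x)\<^sup>2)"
    have E: "E = (L2_norm \<Omega> v)\<^sup>2"
    proof -
      have *: "(\<lambda>x. indicator \<Omega> x * (v x * v x)) = (\<lambda>x. (V x)\<^sup>2)"
        by (auto simp: V_def indicator_def power2_eq_square fun_eq_iff)
      then show ?thesis
        unfolding E_def L2_norm_power2 by (subst L2_inner_lborel) (simp_all only: *, measurable)
    qed
    have E0: "E \<ge> 0" by (simp add: E)
    let ?F = "\<lambda>x y. indicator \<Omega> x * (indicator \<Omega> y * (V y - V x)\<^sup>2)"
    have inner: "(\<integral>\<^sup>+y. ennreal (?F x y) \<partial>lborel) = ennreal (indicator \<Omega> x * (m * (V x)\<^sup>2 + E))" for x
    proof -
      have eq: "?F x y = indicator \<Omega> x * ((V y)\<^sup>2 - 2 * V x * V y + (V x)\<^sup>2 * indicator \<Omega> y)" for y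
        by (auto simp: indicator_def power2_diff V_def)
      have int: "integrable lborel (\<lambda>y. (V y)\<^sup>2 - 2 * V x * V y + (V x)\<^sup>2 * indicator \<Omega> y)"
        using intV intV2 integrable_indicator_domain[of "(V x)\<^sup>2"]
        by (auto simp: mult.commute)
      have "(LINT y|lborel. (V y)\<^sup>2 - 2 * V x * V y + (V x)\<^sup>2 * indicator \<Omega> y) = E - 2 * V x * 0 + (V x)\<^sup>2 * m"
        using intV intV2 integrable_indicator_domain[of 1] meanV
        by (simp add: E_def m_def)
      then have "(LINT y|lborel. ?F x y) = indicator \<Omega> x * (m * (V x)\<^sup>2 + E)"
        unfolding eq integral_mult_right_zero by (simp add: mult.commute)
      moreover have "integrable lborel (?F x)"
        unfolding eq using int by (rule integrable_mult_right)
      then have "(\<integral>\<^sup>+y. ennreal (?F x y) \<partial>lborel) = ennreal (LINT y|lborel. ?F x y)"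
        by (rule nn_integral_eq_integral) (intro AE_I2 mult_nonneg_nonneg indicator_pos_le zero_le_power2)
      ultimately show ?thesis by (simp only:)
    qed
    \<comment> \<open>The exact value of the right-hand side is 2 m E; giving away a factor 2
      enlarges only the constant.\<close>
    have "ennreal (m * E) \<le> (\<integral>\<^sup>+x. ennreal (indicator \<Omega> x * (m * (V x)\<^sup>2 + E)) \<partial>lborel)"
    proof -
      have "ennreal (m * E) = (\<integral>\<^sup>+x. ennreal (m * (V x)\<^sup>2) \<partial>lborel)"
        by (subst nn_integral_eq_integral) (use intV2 m(1) in \<open>auto simp: E_def\<close>)
      also have "\<dots> \<le> (\<integral>\<^sup>+x. ennreal (indicator \<Omega> x * (m * (V x)\<^sup>2 + E)) \<partial>lborel)"
        using E0 by (intro nn_integral_mono ennreal_leI) (auto simp: indicator_def V_def)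
      finally show ?thesis .
    qed
    also have "\<dots> = (\<integral>\<^sup>+x. \<integral>\<^sup>+y. ennreal (?F x y) \<partial>lborel \<partial>lborel)"
      by (simp add: inner)
    also have "\<dots> = (\<integral>\<^sup>+x. \<integral>\<^sup>+a. ennreal (?F x (a + x)) \<partial>lborel \<partial>lborel)"
    proof (rule nn_integral_cong)
      fix x
      show "(\<integral>\<^sup>+y. ennreal (?F x y) \<partial>lborel) = (\<integral>\<^sup>+a. ennreal (?F x (a + x)) \<partial>lborel)"
        by (rule lborel_nn_integral_translate[symmetric]) measurable
    qed
    also have "\<dots> = (\<integral>\<^sup>+a. \<integral>\<^sup>+x. ennreal (?F x (a + x)) \<partial>lborel \<partial>lborel)"
    proof (rule lborel_pair.Fubini')
      have [measurable]: "(\<lambda>p. V (fst p + snd p)) \<in> borel_measurable (lborel \<Otimes>\<^sub>M lborel)"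
        by (rule measurable_compose[OF _ V_borel]) measurable
      have [measurable]: "(\<lambda>p. indicator \<Omega> (fst p + snd p) :: real) \<in> borel_measurable (lborel \<Otimes>\<^sub>M lborel)"
        by (rule measurable_compose[OF _ indicator_domain_borel(1)]) measurable
      have [measurable]: "(\<lambda>p. V (snd p)) \<in> borel_measurable (lborel \<Otimes>\<^sub>M lborel)"
        by (rule measurable_compose[OF _ V_borel]) measurable
      have [measurable]: "(\<lambda>p. indicator \<Omega> (snd p) :: real) \<in> borel_measurable (lborel \<Otimes>\<^sub>M lborel)"
        by (rule measurable_compose[OF _ indicator_domain_borel(1)]) measurable
      show "(\<lambda>(a, x). ennreal (?F x (a + x))) \<in> borel_measurable (lborel \<Otimes>\<^sub>M lborel)"
        unfolding split_beta by measurable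
    qed
    also have "\<dots> = (\<integral>\<^sup>+a. ennreal (translation_diff a) \<partial>lborel)"
      unfolding translation_diff_def
      by (intro nn_integral_cong, subst nn_integral_eq_integral)
         (use translation_integrable[of 0 _ _ 0] in \<open>auto simp: add.commute\<close>)
    also have "\<dots> \<le> (\<integral>\<^sup>+a. ennreal (d\<^sup>2 * gradient_energy) * indicator (cball (0::real^2) d) a \<partial>lborel)"
    proof (rule nn_integral_mono)
      fix a
      show "ennreal (translation_diff a) \<le> ennreal (d\<^sup>2 * gradient_energy) * indicator (cball (0::real^2) d) a"
      proof (cases "a \<in> cball 0 d")
        case True
        have "translation_diff a \<le> (norm a)\<^sup>2 * gradient_energy"
          by (rule translation_diff_le[OF assms(2)])
        also have "\<dots> \<le> d\<^sup>2 * gradient_energy"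
          using True gradient_energy_eq by (intro mult_right_mono power_mono) auto
        finally show ?thesis using True by (simp add: ennreal_leI)
      next
        case False
        have "(\<lambda>x. indicator \<Omega> x * (indicator \<Omega> (x + a) * (V (x + a) - V x)\<^sup>2)) = (\<lambda>x. 0)"
        proof
          fix x
          show "indicator \<Omega> x * (indicator \<Omega> (x + a) * (V (x + a) - V x)\<^sup>2) = 0"
            using d[of x "x + a"] False by (auto simp: indicator_def)
        qed
        then have "translation_diff a = 0"
          unfolding translation_diff_def by simp
        then show ?thesis by simp
      qed
    qed
    also have "\<dots> = ennreal (d\<^sup>2 * gradient_energy) * ennreal D"
      by (simp add: nn_integral_cmult_indicator D)
    also have "\<dots> = ennreal (d\<^sup>2 * gradient_energy * D)"
      by (rule ennreal_mult'[symmetric]) (simp add: gradient_energy_eq)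
    finally have "m * E \<le> d\<^sup>2 * gradient_energy * D"
      using gradient_energy_eq by (subst (asm) ennreal_le_iff) (auto simp: D_def)
    then have "(L2_norm \<Omega> v)\<^sup>2 \<le> (d\<^sup>2 * D / m) * (L2_norm \<Omega> (grad \<Omega> v))\<^sup>2"
      using m(1) by (simp add: E gradient_energy_eq field_simps)
    then have "sqrt ((L2_norm \<Omega> v)\<^sup>2) \<le> sqrt ((d\<^sup>2 * D / m) * (L2_norm \<Omega> (grad \<Omega> v))\<^sup>2)"
      by (rule real_sqrt_le_mono)
    then have "L2_norm \<Omega> v \<le> sqrt (d\<^sup>2 * D / m) * L2_norm \<Omega> (grad \<Omega> v)"
      by (simp only: real_sqrt_mult[of "d\<^sup>2 * D / m"] real_sqrt_abs abs_of_nonneg[OF L2_norm_nonneg])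
    also have "\<dots> \<le> C * L2_norm \<Omega> (grad \<Omega> v)"
      unfolding C_def by (intro mult_right_mono) auto
    finally show ?thesis .
  qed
  ultimately show thesis by (rule that)
qed

section \<open>Lagrange finite elements\<close>

lemma finite_mi_order_le: "finite {\<alpha>. mi_order \<alpha> \<le> k}"
proof (rule finite_subset)
  show "{\<alpha>. mi_order \<alpha> \<le> k} \<subseteq> (\<Pi>\<^sub>E i\<in>UNIV. {..k})"
  proof
    fix \<alpha> assume "\<alpha> \<in> {\<alpha>. mi_order \<alpha> \<le> k}"
    then have "\<alpha> i \<le> k" for i
      using exhaust_2[of i] by (auto simp: mi_order_def sum_2)
    then show "\<alpha> \<in> (\<Pi>\<^sub>E i\<in>UNIV. {..k})" by auto
  qed
  show "finite (\<Pi>\<^sub>E i\<in>(UNIV :: 2 set). {..k})"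
    by (intro finite_PiE) auto
qed

lemma poly_deg_le_polynomial:
  assumes "p \<in> poly_deg_le k" shows "real_polynomial_function p"
proof -
  obtain a where p: "p = (\<lambda>x. \<Sum>\<alpha>\<in>{\<alpha>. mi_order \<alpha> \<le> k}. a \<alpha> * (\<Prod>i\<in>UNIV. (x $ i) ^ \<alpha> i))"
    using assms by (auto simp: poly_deg_le_def)
  have "real_polynomial_function (\<lambda>x. x $ i)" for i :: 2
    by (intro real_polynomial_function.intros(1) bounded_linear_vec_nth)
  then show ?thesis
    unfolding p using finite_mi_order_le
    by (intro real_polynomial_function_sum real_polynomial_function.intros(4) real_polynomial_function.intros(2)
        real_polynomial_function_prod real_polynomial_function_power) auto
qed

lemma poly_deg_le_add:
  assumes "p \<in> poly_deg_le k" "q \<in> poly_deg_le k" shows "(\<lambda>x. p x + q x) \<in> poly_deg_le k"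
proof -
  obtain a b where "p = (\<lambda>x. \<Sum>\<alpha>\<in>{\<alpha>. mi_order \<alpha> \<le> k}. a \<alpha> * (\<Prod>i\<in>UNIV. (x $ i) ^ \<alpha> i))"
    "q = (\<lambda>x. \<Sum>\<alpha>\<in>{\<alpha>. mi_order \<alpha> \<le> k}. b \<alpha> * (\<Prod>i\<in>UNIV. (x $ i) ^ \<alpha> i))"
    using assms by (auto simp: poly_deg_le_def)
  then have "(\<lambda>x. p x + q x) = (\<lambda>x. \<Sum>\<alpha>\<in>{\<alpha>. mi_order \<alpha> \<le> k}. (a \<alpha> + b \<alpha>) * (\<Prod>i\<in>UNIV. (x $ i) ^ \<alpha> i))"
    by (simp add: distrib_right sum.distrib)
  then show ?thesis unfolding poly_deg_le_def by (intro CollectI exI[of _ "\<lambda>\<alpha>. a \<alpha> + b \<alpha>"])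
qed

lemma poly_deg_le_cmult:
  assumes "p \<in> poly_deg_le k" shows "(\<lambda>x. c * p x) \<in> poly_deg_le k"
proof -
  obtain a where "p = (\<lambda>x. \<Sum>\<alpha>\<in>{\<alpha>. mi_order \<alpha> \<le> k}. a \<alpha> * (\<Prod>i\<in>UNIV. (x $ i) ^ \<alpha> i))"
    using assms by (auto simp: poly_deg_le_def)
  then have "(\<lambda>x. c * p x) = (\<lambda>x. \<Sum>\<alpha>\<in>{\<alpha>. mi_order \<alpha> \<le> k}. (c * a \<alpha>) * (\<Prod>i\<in>UNIV. (x $ i) ^ \<alpha> i))"
    by (simp add: sum_distrib_left mult.assoc)
  then show ?thesis unfolding poly_deg_le_def by (intro CollectI exI[of _ "\<lambda>\<alpha>. c * a \<alpha>"])
qed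

lemma poly_deg_le_const: "(\<lambda>x. c) \<in> poly_deg_le k"
proof -
  have "(\<Sum>\<alpha>\<in>{\<alpha>. mi_order \<alpha> \<le> k}. (if \<alpha> = (\<lambda>_. 0) then c else 0) * (\<Prod>i\<in>UNIV. (x $ i) ^ \<alpha> i)) = c" for x :: "real^2"
  proof -
    have "(\<Sum>\<alpha>\<in>{\<alpha>. mi_order \<alpha> \<le> k}. (if \<alpha> = (\<lambda>_. 0) then c else 0) * (\<Prod>i\<in>UNIV. (x $ i) ^ \<alpha> i)) =
      (\<Sum>\<alpha>\<in>{\<alpha>. mi_order \<alpha> \<le> k}. if \<alpha> = (\<lambda>_. 0) then c else 0)"
      by (intro sum.cong) auto
    also have "\<dots> = c"
      using finite_mi_order_le by (simp add: mi_order_def)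
    finally show ?thesis .
  qed
  then show ?thesis
    unfolding poly_deg_le_def
    by (intro CollectI exI[of _ "\<lambda>\<alpha>. if \<alpha> = (\<lambda>_. 0) then c else 0"]) (simp only:)
qed

lemma lagrange_space_add:
  assumes "u \<in> lagrange_space \<Omega> T k" "v \<in> lagrange_space \<Omega> T k"
  shows "(\<lambda>x. u x + v x) \<in> lagrange_space \<Omega> T k"
  unfolding lagrange_space_def
proof (intro CollectI conjI ballI)
  show "continuous_on (closure \<Omega>) (\<lambda>x. u x + v x)"
    using assms by (intro continuous_on_add) (auto simp: lagrange_space_def)
  fix K assume "K \<in> T"
  then obtain p q where "p \<in> poly_deg_le k" "\<forall>x\<in>K. u x = p x" "q \<in> poly_deg_le k" "\<forall>x\<in>K. v x = q x"
    using assms unfolding lagrange_space_def by blast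
  then show "\<exists>p\<in>poly_deg_le k. \<forall>x\<in>K. u x + v x = p x"
    by (intro bexI[of _ "\<lambda>x. p x + q x"] poly_deg_le_add) auto
qed

lemma lagrange_space_cmult:
  assumes "u \<in> lagrange_space \<Omega> T k"
  shows "(\<lambda>x. c * u x) \<in> lagrange_space \<Omega> T k"
  unfolding lagrange_space_def
proof (intro CollectI conjI ballI)
  show "continuous_on (closure \<Omega>) (\<lambda>x. c * u x)"
    using assms by (intro continuous_on_mult_left) (auto simp: lagrange_space_def)
  fix K assume "K \<in> T"
  then obtain p where "p \<in> poly_deg_le k" "\<forall>x\<in>K. u x = p x"
    using assms unfolding lagrange_space_def by blast
  then show "\<exists>p\<in>poly_deg_le k. \<forall>x\<in>K. c * u x = p x"
    by (intro bexI[of _ "\<lambda>x. c * p x"] poly_deg_le_cmult) auto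
qed

lemma lagrange_space_const: "(\<lambda>x. c) \<in> lagrange_space \<Omega> T k"
  using poly_deg_le_const by (auto simp: lagrange_space_def)

lemma lagrange_space_diff:
  assumes "u \<in> lagrange_space \<Omega> T k" "v \<in> lagrange_space \<Omega> T k"
  shows "(\<lambda>x. u x - v x) \<in> lagrange_space \<Omega> T k"
  using lagrange_space_add[OF assms(1) lagrange_space_cmult[OF assms(2), of "-1"]] by simp

lemma lipschitz_on_mult_bounded:
  fixes f g :: "'a::metric_space \<Rightarrow> real"
  assumes "M-lipschitz_on A f" "N-lipschitz_on A g" "\<And>x. x \<in> A \<Longrightarrow> \<bar>f x\<bar> \<le> B" "\<And>x. x \<in> A \<Longrightarrow> \<bar>g x\<bar> \<le> C"
    "0 \<le> B" "0 \<le> C"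
  shows "(B * N + C * M)-lipschitz_on A (\<lambda>x. f x * g x)"
proof (rule lipschitz_onI)
  fix x y assume xy: "x \<in> A" "y \<in> A"
  have "f x * g x - f y * g y = f x * (g x - g y) + g y * (f x - f y)" by (simp add: algebra_simps)
  then have "\<bar>f x * g x - f y * g y\<bar> \<le> \<bar>f x\<bar> * \<bar>g x - g y\<bar> + \<bar>g y\<bar> * \<bar>f x - f y\<bar>"
    using abs_triangle_ineq[of "f x * (g x - g y)" "g y * (f x - f y)"] by (simp add: abs_mult)
  also have "\<dots> \<le> B * (N * dist x y) + C * (M * dist x y)"
    using lipschitz_onD[OF assms(1) xy] lipschitz_onD[OF assms(2) xy] assms xy
    by (intro add_mono mult_mono) (auto simp: dist_real_def)
  finally show "dist (f x * g x) (f y * g y) \<le> (B * N + C * M) * dist x y"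
    by (simp add: dist_real_def algebra_simps)
next
  show "0 \<le> B * N + C * M"
    using assms lipschitz_on_nonneg by (metis add_nonneg_nonneg mult_nonneg_nonneg)
qed

text \<open>A bound of |p| is carried through the induction because the Lipschitz constant of a
  product involves bounds of both factors.\<close>

lemma real_polynomial_function_lipschitz:
  assumes "real_polynomial_function p" "bounded A"
  shows "\<exists>M B. M-lipschitz_on A p \<and> 0 \<le> B \<and> (\<forall>x\<in>A. \<bar>p x\<bar> \<le> B)"
  using assms(1)
proof (induction rule: real_polynomial_function.induct)
  case (linear f)
  obtain K where K: "\<And>x. norm (f x) \<le> norm x * K" "K > 0"
    using bounded_linear.pos_bounded[OF linear] by blast
  obtain R where R: "\<And>x. x \<in> A \<Longrightarrow> norm x \<le> R" "R > 0"
    using assms(2) bounded_pos by metis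
  have "K-lipschitz_on A f"
    using K bounded_linear.linear[OF linear]
    by (intro lipschitz_onI) (auto simp: dist_norm linear_diff[symmetric] mult.commute)
  moreover have "\<bar>f x\<bar> \<le> R * K" if "x \<in> A" for x
    using order_trans[OF K(1)[of x] mult_right_mono[OF R(1)[OF that], of K]] K(2) by simp
  ultimately show ?case using K(2) R(2) by (intro exI[of _ K] exI[of _ "R * K"]) auto
next
  case (const c)
  show ?case by (intro exI[of _ 0] exI[of _ "\<bar>c\<bar>"]) (auto intro: lipschitz_on_constant)
next
  case (add f g)
  then obtain M B N C where "M-lipschitz_on A f" "0 \<le> B" "\<forall>x\<in>A. \<bar>f x\<bar> \<le> B"
    "N-lipschitz_on A g" "0 \<le> C" "\<forall>x\<in>A. \<bar>g x\<bar> \<le> C" by blast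
  then show ?case
    by (intro exI[of _ "M + N"] exI[of _ "B + C"] conjI lipschitz_on_add)
       (auto intro!: order_trans[OF abs_triangle_ineq] add_mono)
next
  case (mult f g)
  then obtain M B N C where "M-lipschitz_on A f" "0 \<le> B" "\<forall>x\<in>A. \<bar>f x\<bar> \<le> B"
    "N-lipschitz_on A g" "0 \<le> C" "\<forall>x\<in>A. \<bar>g x\<bar> \<le> C" by blast
  then show ?case
    by (intro exI[of _ "B * N + C * M"] exI[of _ "B * C"] conjI lipschitz_on_mult_bounded)
       (auto simp: abs_mult intro!: mult_mono)
qed

section \<open>Finite element functions on a mesh of a convex domain\<close>

locale mesh = bounded_domain +
  fixes T :: "(real^2) set set"
  assumes convex_domain: "convex \<Omega>" and nonempty_domain: "\<Omega> \<noteq> {}"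
    and conforming: "conforming_triangulation \<Omega> T"
begin

lemma finite_mesh: "finite T"
  and Union_mesh: "\<Union>T = closure \<Omega>"
  and cell: "K \<in> T \<Longrightarrow> convex K \<and> compact K"
  using conforming
  by (auto simp: conforming_triangulation_def triangulation_def simplex compact_convex_hull
      finite_imp_compact)

text \<open>This is the set S of \<open>lipschitz_function\<close> for finite element functions: in
  an open cell they are polynomials, and the rest of \<Omega> lies in finitely many frontiers of
  convex cells, which are null sets.\<close>

definition skeleton_complement :: "(real^2) set" where
  "skeleton_complement = (\<Union>K\<in>T. interior K)"

lemma interior_closure_domain: "interior (closure \<Omega>) = \<Omega>"
  using convex_interior_closure[OF convex_domain] open_domain by (simp add: interior_open)

lemma interior_cell_subset: "K \<in> T \<Longrightarrow> interior K \<subseteq> \<Omega>"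
  using interior_mono[of K "closure \<Omega>"] Union_mesh interior_closure_domain by blast

text \<open>On each cell v is a polynomial and hence Lipschitz. By convexity the segment between two
  points stays in \<Omega>; its parameter interval is covered by the closed preimages of finitely
  many cells, and Lipschitz bounds glue along such a cover of an interval.\<close>

lemma lagrange_lipschitz:
  assumes "v \<in> lagrange_space \<Omega> T k"
  shows "\<exists>M. M-lipschitz_on \<Omega> v"
proof -
  have "\<exists>M. M-lipschitz_on K v" if K: "K \<in> T" for K
  proof -
    obtain p where p: "p \<in> poly_deg_le k" "\<forall>x\<in>K. v x = p x"
      using assms K by (auto simp: lagrange_space_def)
    then obtain M where "M-lipschitz_on K p"
      using real_polynomial_function_lipschitz[OF poly_deg_le_polynomial compact_imp_bounded] cell[OF K] by metis
    then have "M-lipschitz_on K v" using p(2) by (auto intro: lipschitz_on_transform)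
    then show ?thesis by blast
  qed
  then obtain m where m: "\<And>K. K \<in> T \<Longrightarrow> (m K)-lipschitz_on K v" by metis
  \<comment> \<open>The sum serves as a common upper bound of the nonnegative cell
    constants.\<close>
  define M where "M = (\<Sum>K\<in>T. m K)"
  have m0: "0 \<le> m K" if "K \<in> T" for K using lipschitz_on_nonneg[OF m[OF that]] .
  have mM: "m K \<le> M" if "K \<in> T" for K
    unfolding M_def using finite_mesh that m0 by (intro member_le_sum) auto
  have M0: "0 \<le> M" unfolding M_def using m0 by (intro sum_nonneg)
  have "dist (v x) (v y) \<le> M * dist x y" if xy: "x \<in> \<Omega>" "y \<in> \<Omega>" for x y
  proof -
    define \<gamma> where "\<gamma> t = x + t *\<^sub>R (y - x)" for t
    have "(M * dist x y)-lipschitz_on {0..1} (\<lambda>t. v (\<gamma> t))"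
    proof (rule lipschitz_on_closed_Union[where I=T and U="\<lambda>K. \<gamma> -` K"])
      fix K assume K: "K \<in> T"
      show "(M * dist x y)-lipschitz_on (\<gamma> -` K) (\<lambda>t. v (\<gamma> t))"
      proof (rule lipschitz_onI)
        fix s t assume "s \<in> \<gamma> -` K" "t \<in> \<gamma> -` K"
        then have "dist (v (\<gamma> s)) (v (\<gamma> t)) \<le> m K * dist (\<gamma> s) (\<gamma> t)"
          by (intro lipschitz_onD[OF m[OF K]]) auto
        also have "\<dots> \<le> M * dist (\<gamma> s) (\<gamma> t)" by (intro mult_right_mono mM K) auto
        also have "dist (\<gamma> s) (\<gamma> t) = dist x y * dist s t"
        proof -
          have "\<gamma> s - \<gamma> t = (s - t) *\<^sub>R (y - x)" by (simp add: \<gamma>_def algebra_simps)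
          then show ?thesis by (simp add: dist_norm norm_minus_commute mult.commute)
        qed
        finally show "dist (v (\<gamma> s)) (v (\<gamma> t)) \<le> M * dist x y * dist s t" by (simp add: mult.assoc)
      qed (use M0 in simp)
      show "closed (\<gamma> -` K)"
        unfolding \<gamma>_def using cell[OF K]
        by (intro continuous_closed_vimage compact_imp_closed continuous_intros) auto
    next
      show "{0..1} \<subseteq> (\<Union>K\<in>T. \<gamma> -` K)"
      proof
        fix t :: real assume "t \<in> {0..1}"
        then have "(1 - t) *\<^sub>R x + t *\<^sub>R y \<in> \<Omega>"
          using convex_domain xy by (intro convexD_alt) auto
        then have "\<gamma> t \<in> \<Omega>" by (simp add: \<gamma>_def algebra_simps)
        then show "t \<in> (\<Union>K\<in>T. \<gamma> -` K)" using Union_mesh closure_subset[of \<Omega>] by blast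
      qed
    qed (use finite_mesh M0 in auto)
    from lipschitz_onD[OF this, of 0 1] show ?thesis by (simp add: \<gamma>_def)
  qed
  then show ?thesis using M0 by (intro exI[of _ M] lipschitz_onI)
qed

lemma lagrange_lipschitz_function:
  assumes "v \<in> lagrange_space \<Omega> T k"
  obtains M where "lipschitz_function \<Omega> v M skeleton_complement"
proof -
  obtain M where M: "M-lipschitz_on \<Omega> v" using lagrange_lipschitz[OF assms] by blast
  have "lipschitz_function \<Omega> v M skeleton_complement"
  proof
    show "M-lipschitz_on \<Omega> v" by fact
    show "open skeleton_complement" "skeleton_complement \<subseteq> \<Omega>"
      unfolding skeleton_complement_def using interior_cell_subset by auto
    show "negligible (\<Omega> - skeleton_complement)"
    proof (rule negligible_subset)
      show "negligible (\<Union>K\<in>T. frontier K)"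
        using finite_mesh cell by (intro negligible_Union) (auto intro: negligible_convex_frontier)
      show "\<Omega> - skeleton_complement \<subseteq> (\<Union>K\<in>T. frontier K)"
      proof
        fix x assume x: "x \<in> \<Omega> - skeleton_complement"
        then obtain K where "K \<in> T" "x \<in> K" using Union_mesh closure_subset[of \<Omega>] by blast
        then show "x \<in> (\<Union>K\<in>T. frontier K)"
          using x closure_subset[of K] by (auto simp: frontier_def skeleton_complement_def)
      qed
    qed
    fix x assume "x \<in> skeleton_complement"
    then obtain K where K: "K \<in> T" "x \<in> interior K" by (auto simp: skeleton_complement_def)
    then obtain p where p: "p \<in> poly_deg_le k" "\<forall>x\<in>K. v x = p x"
      using assms by (auto simp: lagrange_space_def)
    have "p differentiable (at x)"
      by (rule differentiable_at_real_polynomial_function[OF poly_deg_le_polynomial[OF p(1)]])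
    then obtain p' where "(p has_derivative p') (at x)" by (auto simp: differentiable_def)
    then have "(v has_derivative p') (at x)"
      by (rule has_derivative_transform_within_open[OF _ open_interior K(2)])
         (use p(2) interior_subset[of K] in auto)
    then show "v differentiable (at x)" by (auto simp: differentiable_def)
  qed
  then show thesis by (rule that)
qed

lemma lagrange_H1: "lagrange_space \<Omega> T k \<subseteq> Hk 1 \<Omega>"
  using lagrange_lipschitz_function lipschitz_function.v_H1 by (metis subsetI)

lemma Vh0_H1: "Vh0 \<Omega> T k \<subseteq> Hk 1 \<Omega>"
  using lagrange_H1 by (auto simp: Vh0_def)

end

section \<open>Functions with zero boundary values\<close>

context bounded_domain
begin

lemma Hk_norm_add:
  assumes "u \<in> Hk 1 \<Omega>" "v \<in> Hk 1 \<Omega>"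
  shows "Hk_norm 1 \<Omega> (\<lambda>x. u x + v x) \<le> Hk_norm 1 \<Omega> u + Hk_norm 1 \<Omega> v"
proof -
  have "L2_norm \<Omega> (grad \<Omega> (\<lambda>x. u x + v x)) = L2_norm \<Omega> (\<lambda>x. grad \<Omega> u x + grad \<Omega> v x)"
    by (rule L2_norm_cong_AE[OF grad_L2[OF Hk_add[OF assms]] L2_add[OF grad_L2[OF assms(1)] grad_L2[OF assms(2)]]
          grad_add_AE[OF assms]])
  also have "\<dots> \<le> L2_norm \<Omega> (grad \<Omega> u) + L2_norm \<Omega> (grad \<Omega> v)"
    by (intro L2_norm_triangle grad_L2 assms)
  finally have "(L2_norm \<Omega> (grad \<Omega> (\<lambda>x. u x + v x)))\<^sup>2 \<le> (L2_norm \<Omega> (grad \<Omega> u) + L2_norm \<Omega> (grad \<Omega> v))\<^sup>2"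
    by (intro power_mono) auto
  moreover have "(L2_norm \<Omega> (\<lambda>x. u x + v x))\<^sup>2 \<le> (L2_norm \<Omega> u + L2_norm \<Omega> v)\<^sup>2"
    by (intro power_mono L2_norm_triangle Hk_imp_L2[OF assms(1)] Hk_imp_L2[OF assms(2)]) auto
  ultimately have "Hk_norm 1 \<Omega> (\<lambda>x. u x + v x) \<le>
    sqrt ((L2_norm \<Omega> u + L2_norm \<Omega> v)\<^sup>2 + (L2_norm \<Omega> (grad \<Omega> u) + L2_norm \<Omega> (grad \<Omega> v))\<^sup>2)"
    unfolding Hk_norm_1[OF Hk_add[OF assms]] by (intro real_sqrt_le_mono add_mono)
  also have "\<dots> \<le> Hk_norm 1 \<Omega> u + Hk_norm 1 \<Omega> v"
    unfolding Hk_norm_1[OF assms(1)] Hk_norm_1[OF assms(2)] by (rule real_sqrt_sum_squares_triangle_ineq)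
  finally show ?thesis .
qed

lemma L2_norm_grad_cmult:
  assumes "u \<in> Hk 1 \<Omega>"
  shows "L2_norm \<Omega> (grad \<Omega> (\<lambda>x. c * u x)) = \<bar>c\<bar> * L2_norm \<Omega> (grad \<Omega> u)"
  using L2_norm_cong_AE[OF grad_L2[OF Hk_cmult[OF assms]] L2_scaleR[OF grad_L2[OF assms]] grad_cmult_AE[OF assms]]
  by (simp add: L2_norm_scaleR)

lemma Hk_norm_cmult:
  assumes "u \<in> Hk 1 \<Omega>"
  shows "Hk_norm 1 \<Omega> (\<lambda>x. c * u x) = \<bar>c\<bar> * Hk_norm 1 \<Omega> u"
proof -
  have "Hk_norm 1 \<Omega> (\<lambda>x. c * u x) = sqrt (c\<^sup>2 * ((L2_norm \<Omega> u)\<^sup>2 + (L2_norm \<Omega> (grad \<Omega> u))\<^sup>2))"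
    by (simp add: Hk_norm_1[OF Hk_cmult[OF assms]] L2_norm_grad_cmult[OF assms] L2_norm_mult
        power_mult_distrib distrib_left)
  then show ?thesis by (simp add: real_sqrt_mult Hk_norm_1[OF assms])
qed

lemma test_function_lipschitz_function:
  assumes "\<phi> \<in> test_functions \<Omega>"
  obtains M where "lipschitz_function \<Omega> \<phi> M \<Omega>"
proof -
  obtain M where "M-lipschitz_on UNIV \<phi>" using test_functions_lipschitz[OF assms] by blast
  then have "lipschitz_function \<Omega> \<phi> M \<Omega>"
    using open_domain smooth_differentiable[OF test_functions_smooth[OF assms]]
    by unfold_locales (auto intro: lipschitz_on_subset)
  then show thesis by (rule that)
qed

lemma test_functions_H1: "test_functions \<Omega> \<subseteq> Hk 1 \<Omega>"
  using test_function_lipschitz_function lipschitz_function.v_H1 by (metis subsetI)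

lemma grad_test_function:
  assumes "\<phi> \<in> test_functions \<Omega>"
  shows "AE x in lebesgue_on \<Omega>. grad \<Omega> \<phi> x = (\<chi> i. partial_deriv i \<phi> x)"
proof -
  obtain M where "lipschitz_function \<Omega> \<phi> M \<Omega>" using test_function_lipschitz_function[OF assms] by blast
  then interpret \<phi>: lipschitz_function \<Omega> \<phi> M \<Omega> .
  have "AE x in lebesgue_on \<Omega>. x \<in> \<Omega>"
    by (rule AE_I2) (simp add: space_restrict_space)
  with \<phi>.grad_v_AE show ?thesis
    by eventually_elim (simp add: \<phi>.pd_def)
qed

lemma H10_H1: "H10 \<Omega> \<subseteq> Hk 1 \<Omega>"
  by (auto simp: H10_def)

lemma H10_approx:
  assumes "u \<in> H10 \<Omega>" "e > 0"
  obtains \<phi> where "\<phi> \<in> test_functions \<Omega>" "L2_norm \<Omega> (\<lambda>x. u x - \<phi> x) \<le> e"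
    "L2_norm \<Omega> (grad \<Omega> (\<lambda>x. u x - \<phi> x)) \<le> e"
proof -
  obtain \<phi> where \<phi>: "\<phi> \<in> test_functions \<Omega>" "Hk_norm 1 \<Omega> (\<lambda>x. u x - \<phi> x) < e"
    using assms by (auto simp: H10_def)
  moreover have "(\<lambda>x. u x - \<phi> x) \<in> Hk 1 \<Omega>"
    using assms(1) \<phi>(1) H10_H1 test_functions_H1 by (intro Hk_diff) auto
  ultimately show thesis
    using L2_norm_le_Hk_norm L2_norm_grad_le_Hk_norm by (intro that[of \<phi>]) force+
qed

lemma H10_add:
  assumes "u \<in> H10 \<Omega>" "v \<in> H10 \<Omega>" shows "(\<lambda>x. u x + v x) \<in> H10 \<Omega>"
  unfolding H10_def
proof (intro CollectI conjI allI impI)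
  have u: "u \<in> Hk 1 \<Omega>" and v: "v \<in> Hk 1 \<Omega>" using assms H10_H1 by auto
  then show "(\<lambda>x. u x + v x) \<in> Hk 1 \<Omega>" by (rule Hk_add)
  fix e :: real assume "e > 0"
  then obtain \<phi> \<psi> where \<phi>: "\<phi> \<in> test_functions \<Omega>" "Hk_norm 1 \<Omega> (\<lambda>x. u x - \<phi> x) < e / 2"
    and \<psi>: "\<psi> \<in> test_functions \<Omega>" "Hk_norm 1 \<Omega> (\<lambda>x. v x - \<psi> x) < e / 2"
    using assms by (auto simp: H10_def dest!: spec[of _ "e / 2"])
  have "Hk_norm 1 \<Omega> (\<lambda>x. (u x - \<phi> x) + (v x - \<psi> x)) \<le> Hk_norm 1 \<Omega> (\<lambda>x. u x - \<phi> x) + Hk_norm 1 \<Omega> (\<lambda>x. v x - \<psi> x)"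
    using u v \<phi>(1) \<psi>(1) test_functions_H1 by (intro Hk_norm_add Hk_diff) auto
  also have "\<dots> < e" using \<phi>(2) \<psi>(2) by simp
  finally have "Hk_norm 1 \<Omega> (\<lambda>x. u x + v x - (\<phi> x + \<psi> x)) < e" by (simp add: algebra_simps)
  then show "\<exists>\<phi>\<in>test_functions \<Omega>. Hk_norm 1 \<Omega> (\<lambda>x. u x + v x - \<phi> x) < e"
    by (rule bexI[of _ "\<lambda>x. \<phi> x + \<psi> x"]) (rule test_functions_add[OF \<phi>(1) \<psi>(1)])
qed

lemma H10_cmult:
  assumes "u \<in> H10 \<Omega>" shows "(\<lambda>x. c * u x) \<in> H10 \<Omega>"
  unfolding H10_def
proof (intro CollectI conjI allI impI)
  have u: "u \<in> Hk 1 \<Omega>" using assms H10_H1 by auto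
  then show "(\<lambda>x. c * u x) \<in> Hk 1 \<Omega>" by (rule Hk_cmult)
  fix e :: real assume e: "e > 0"
  then have "e / (\<bar>c\<bar> + 1) > 0" by simp
  then obtain \<phi> where \<phi>: "\<phi> \<in> test_functions \<Omega>" "Hk_norm 1 \<Omega> (\<lambda>x. u x - \<phi> x) < e / (\<bar>c\<bar> + 1)"
    using assms by (auto simp: H10_def)
  have H1: "(\<lambda>x. u x - \<phi> x) \<in> Hk 1 \<Omega>" using u \<phi>(1) test_functions_H1 by (intro Hk_diff) auto
  have "Hk_norm 1 \<Omega> (\<lambda>x. c * (u x - \<phi> x)) = \<bar>c\<bar> * Hk_norm 1 \<Omega> (\<lambda>x. u x - \<phi> x)"
    by (rule Hk_norm_cmult[OF H1])
  also have "\<dots> \<le> \<bar>c\<bar> * (e / (\<bar>c\<bar> + 1))" using \<phi>(2) by (intro mult_left_mono) auto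
  also have "\<dots> < e" using e by (simp add: field_simps)
  finally have "Hk_norm 1 \<Omega> (\<lambda>x. c * u x - c * \<phi> x) < e" by (simp add: algebra_simps)
  then show "\<exists>\<phi>\<in>test_functions \<Omega>. Hk_norm 1 \<Omega> (\<lambda>x. c * u x - \<phi> x) < e"
    by (rule bexI[of _ "\<lambda>x. c * \<phi> x"]) (rule test_functions_cmult[OF \<phi>(1)])
qed

lemma H10_diff:
  assumes "u \<in> H10 \<Omega>" "v \<in> H10 \<Omega>" shows "(\<lambda>x. u x - v x) \<in> H10 \<Omega>"
  using H10_add[OF assms(1) H10_cmult[OF assms(2), of "-1"]] by simp

lemma L2_norm_nth_le:
  fixes g :: "real^2 \<Rightarrow> real^2"
  assumes "g \<in> L2 \<Omega>" shows "L2_norm \<Omega> (\<lambda>x. g x $ i) \<le> L2_norm \<Omega> g"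
proof (rule L2_norm_mono_AE[OF _ assms])
  show "(\<lambda>x. g x $ i) \<in> L2 \<Omega>" using assms by (simp add: L2_vec_iff)
  show "AE x in lebesgue_on \<Omega>. norm (g x $ i) \<le> norm (g x)"
    by (intro AE_I2 Finite_Cartesian_Product.norm_nth_le)
qed

text \<open>The weak derivative of \<open>x\<^sub>1 \<phi>\<close> tested with \<open>\<phi>\<close> gives
  \<open>(\<phi>, \<phi>) = -2 (x\<^sub>1 \<phi>, \<partial>\<^sub>1 \<phi>)\<close>.\<close>

lemma poincare_friedrichs_test:
  assumes R: "\<And>x. x \<in> \<Omega> \<Longrightarrow> norm x \<le> R" "R > 0" and \<phi>: "\<phi> \<in> test_functions \<Omega>"
  shows "L2_norm \<Omega> \<phi> \<le> 2 * R * L2_norm \<Omega> (grad \<Omega> \<phi>)"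
proof -
  define w where "w x = x $ 1 * \<phi> x" for x :: "real^2"
  obtain B where B: "B > 0" "\<And>x. \<bar>\<phi> x\<bar> \<le> B" using test_functions_bounded[OF \<phi>] by blast
  obtain M where "M-lipschitz_on UNIV \<phi>" using test_functions_lipschitz[OF \<phi>] by blast
  then have M: "M-lipschitz_on \<Omega> \<phi>" by (rule lipschitz_on_subset) simp
  have x1: "1-lipschitz_on \<Omega> (\<lambda>x. x $ 1)"
    by (intro lipschitz_onI) (auto simp: dist_vec_nth_le)
  have x1R: "\<bar>x $ 1\<bar> \<le> R" if "x \<in> \<Omega>" for x
    using R(1)[OF that] Finite_Cartesian_Product.norm_nth_le[of x 1] by simp
  have L: "(R * M + B * 1)-lipschitz_on \<Omega> w"
    unfolding w_def using x1R B R(2) by (intro lipschitz_on_mult_bounded x1 M) auto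
  have d1: "(\<lambda>x. x $ 1) differentiable (at (x::real^2))" for x
    by (intro bounded_linear_imp_differentiable bounded_linear_vec_nth)
  have d\<phi>: "\<phi> differentiable (at x)" for x by (rule smooth_differentiable[OF test_functions_smooth[OF \<phi>]])
  interpret w: lipschitz_function \<Omega> w "R * M + B * 1" \<Omega>
    using L open_domain by unfold_locales (simp_all add: w_def[abs_def] differentiable_mult d1 d\<phi>)
  have pd1: "partial_deriv 1 (\<lambda>x. x $ 1) x = 1" for x :: "real^2"
    by (subst partial_deriv_eq[OF bounded_linear_imp_has_derivative[OF bounded_linear_vec_nth]]) (simp add: axis_def)
  have pd: "w.pd 1 x = x $ 1 * partial_deriv 1 \<phi> x + \<phi> x" if "x \<in> \<Omega>" for x
  proof -
    have w: "w = (\<lambda>x. x $ 1 * \<phi> x)" by (simp add: w_def fun_eq_iff)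
    have "w.pd 1 x = partial_deriv 1 w x" using that by (simp add: w.pd_def)
    also have "\<dots> = x $ 1 * partial_deriv 1 \<phi> x + \<phi> x"
      unfolding w using partial_deriv_mult[OF d1 d\<phi>, of 1 x] pd1[of x] by simp
    finally show ?thesis .
  qed
  have L2\<phi>: "\<phi> \<in> L2 \<Omega>" by (rule test_functions_L2[OF \<phi>])
  have L2p: "partial_deriv 1 \<phi> \<in> L2 \<Omega>" by (rule test_functions_L2[OF test_functions_partial_deriv[OF \<phi>]])
  have L2xp: "(\<lambda>x. x $ 1 * partial_deriv 1 \<phi> x) \<in> L2 \<Omega>"
  proof (rule L2_bounded_cong_AE[OF _ L2_mult[OF L2p, of R]])
    show "(\<lambda>x. x $ 1 * partial_deriv 1 \<phi> x) \<in> borel_measurable (lebesgue_on \<Omega>)"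
      using \<phi> by (intro continuous_borel_measurable continuous_intros smooth_continuous_on
          smooth_partial_deriv test_functions_smooth)
    show "AE x in lebesgue_on \<Omega>. norm (x $ 1 * partial_deriv 1 \<phi> x) \<le> norm (R * partial_deriv 1 \<phi> x)"
      using x1R R(2) by (intro AE_I2) (auto simp: space_restrict_space abs_mult intro!: mult_right_mono)
  qed
  have "L2_inner \<Omega> w (partial_deriv 1 \<phi>) = - L2_inner \<Omega> (w.pd 1) \<phi>"
    using w.has_weak_deriv_pd[of 1] \<phi> by (simp add: has_weak_deriv_def mi_deriv_single mi_order_single)
  also have "L2_inner \<Omega> (w.pd 1) \<phi> = L2_inner \<Omega> (\<lambda>x. x $ 1 * partial_deriv 1 \<phi> x + \<phi> x) \<phi>"
    by (rule L2_inner_cong_AE[OF w.pd_L2 L2_add[OF L2xp L2\<phi>] L2\<phi>])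
       (intro AE_I2, simp add: space_restrict_space pd)
  also have "\<dots> = L2_inner \<Omega> (\<lambda>x. x $ 1 * partial_deriv 1 \<phi> x) \<phi> + L2_inner \<Omega> \<phi> \<phi>"
    by (rule L2_inner_add_left[OF L2xp L2\<phi> L2\<phi>])
  also have "L2_inner \<Omega> w (partial_deriv 1 \<phi>) = L2_inner \<Omega> (\<lambda>x. x $ 1 * partial_deriv 1 \<phi> x) \<phi>"
    by (simp add: L2_inner_def w_def mult_ac)
  finally have "(L2_norm \<Omega> \<phi>)\<^sup>2 = - 2 * L2_inner \<Omega> (\<lambda>x. x $ 1 * partial_deriv 1 \<phi> x) \<phi>"
    by (simp add: L2_norm_power2)
  also have "\<dots> \<le> 2 * (L2_norm \<Omega> (\<lambda>x. x $ 1 * partial_deriv 1 \<phi> x) * L2_norm \<Omega> \<phi>)"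
    using L2_inner_le_norm[OF L2xp L2\<phi>] by linarith
  also have "L2_norm \<Omega> (\<lambda>x. x $ 1 * partial_deriv 1 \<phi> x) \<le> L2_norm \<Omega> (\<lambda>x. R * partial_deriv 1 \<phi> x)"
    by (rule L2_norm_mono_AE[OF L2xp L2_mult[OF L2p]])
       (use x1R R(2) in \<open>intro AE_I2, auto simp: space_restrict_space abs_mult intro!: mult_right_mono\<close>)
  also have "\<dots> = R * L2_norm \<Omega> (partial_deriv 1 \<phi>)" using R(2) by (simp add: L2_norm_mult)
  also have "L2_norm \<Omega> (partial_deriv 1 \<phi>) = L2_norm \<Omega> (\<lambda>x. grad \<Omega> \<phi> x $ 1)"
    by (rule L2_norm_cong_AE[OF L2p]) (use \<phi> test_functions_H1 grad_test_function[OF \<phi>] in \<open>auto intro!: grad_nth_L2\<close>)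
  also have "\<dots> \<le> L2_norm \<Omega> (grad \<Omega> \<phi>)"
    using \<phi> test_functions_H1 by (intro L2_norm_nth_le grad_L2) auto
  finally have "L2_norm \<Omega> \<phi> * L2_norm \<Omega> \<phi> \<le> (2 * R * L2_norm \<Omega> (grad \<Omega> \<phi>)) * L2_norm \<Omega> \<phi>"
    using R(2) by (simp add: power2_eq_square mult_ac mult_left_mono mult_right_mono)
  then show ?thesis
    using R(2) by (cases "L2_norm \<Omega> \<phi> = 0") (auto simp: less_le)
qed

text \<open>The inequality for test functions extends by density, both sides being continuous in the
  norm of H^1.\<close>

lemma poincare_friedrichs_constant:
  obtains C where "C > 0" "\<And>u. u \<in> H10 \<Omega> \<Longrightarrow> L2_norm \<Omega> u \<le> C * L2_norm \<Omega> (grad \<Omega> u)"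
proof -
  obtain R where R: "R > 0" "\<And>x. x \<in> \<Omega> \<Longrightarrow> norm x \<le> R"
    using bounded_domain by (auto simp: bounded_pos)
  have "L2_norm \<Omega> u \<le> 2 * R * L2_norm \<Omega> (grad \<Omega> u)" if u: "u \<in> H10 \<Omega>" for u
  proof (rule field_le_epsilon)
    fix e :: real assume "e > 0"
    \<comment> \<open>The approximation error enters once through the norm of u and 2 R times
      through the gradient, hence the divisor 2 R + 1.\<close>
    define e' where "e' = e / (2 * R + 1)"
    have e': "e' > 0" "e' * (2 * R + 1) = e" using \<open>e > 0\<close> R(1) by (auto simp: e'_def)
    obtain \<phi> where \<phi>: "\<phi> \<in> test_functions \<Omega>" "L2_norm \<Omega> (\<lambda>x. u x - \<phi> x) \<le> e'"
      "L2_norm \<Omega> (grad \<Omega> (\<lambda>x. u x - \<phi> x)) \<le> e'"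
      using H10_approx[OF u e'(1)] by blast
    have H1: "u \<in> Hk 1 \<Omega>" "\<phi> \<in> Hk 1 \<Omega>" using u \<phi>(1) H10_H1 test_functions_H1 by auto
    have "L2_norm \<Omega> u = L2_norm \<Omega> (\<lambda>x. (u x - \<phi> x) + \<phi> x)" by simp
    also have "\<dots> \<le> L2_norm \<Omega> (\<lambda>x. u x - \<phi> x) + L2_norm \<Omega> \<phi>"
      by (intro L2_norm_triangle L2_diff Hk_imp_L2[OF H1(1)] Hk_imp_L2[OF H1(2)])
    also have "L2_norm \<Omega> \<phi> \<le> 2 * R * L2_norm \<Omega> (grad \<Omega> \<phi>)"
      by (rule poincare_friedrichs_test[OF R(2,1) \<phi>(1)])
    also have "L2_norm \<Omega> (grad \<Omega> \<phi>) = L2_norm \<Omega> (\<lambda>x. grad \<Omega> u x - grad \<Omega> (\<lambda>x. u x - \<phi> x) x)"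
      using grad_diff_AE[OF H1] H1
      by (intro L2_norm_cong_AE grad_L2 L2_diff Hk_diff) (auto elim: eventually_mono)
    also have "\<dots> \<le> L2_norm \<Omega> (grad \<Omega> u) + L2_norm \<Omega> (grad \<Omega> (\<lambda>x. u x - \<phi> x))"
      by (intro L2_norm_triangle_diff grad_L2 Hk_diff H1)
    finally have "L2_norm \<Omega> u \<le> L2_norm \<Omega> (\<lambda>x. u x - \<phi> x) +
        2 * R * (L2_norm \<Omega> (grad \<Omega> u) + L2_norm \<Omega> (grad \<Omega> (\<lambda>x. u x - \<phi> x)))"
      using R(1) by (simp add: mult_left_mono)
    also have "\<dots> \<le> e' + 2 * R * (L2_norm \<Omega> (grad \<Omega> u) + e')"
      using \<phi> R(1) by (intro add_mono mult_left_mono) auto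
    also have "\<dots> = 2 * R * L2_norm \<Omega> (grad \<Omega> u) + e" using e'(2) by (simp add: algebra_simps)
    finally show "L2_norm \<Omega> u \<le> 2 * R * L2_norm \<Omega> (grad \<Omega> u) + e" .
  qed
  then show thesis using R(1) by (intro that[of "2 * R"]) auto
qed

end

section \<open>The curl identity\<close>

text \<open>A quarter turn: the inner product of u with \<open>rot v\<close> is the determinant with
  rows u and v. In this form the curl identity concerns an L^2 inner product with an isometric image
  of a gradient, which Cauchy-Schwarz bounds by the gradient norms.\<close>

definition rot :: "real^2 \<Rightarrow> real^2" where
  "rot w = (\<chi> i. if i = 1 then w $ 2 else - w $ 1)"

lemma inner_rot: "u \<bullet> rot v = u $ 1 * v $ 2 - u $ 2 * v $ 1"
  by (simp add: rot_def inner_vec_def sum_2)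

lemma norm_rot [simp]: "norm (rot v) = norm v"
  unfolding norm_eq_sqrt_inner by (simp add: rot_def inner_vec_def sum_2)

context bounded_domain
begin

lemma rot_L2:
  assumes "g \<in> L2 \<Omega>" shows "(\<lambda>x. rot (g x)) \<in> L2 \<Omega>"
  unfolding L2_vec_iff
proof
  have "(\<lambda>x. g x $ j) \<in> L2 \<Omega>" for j using assms by (simp add: L2_vec_iff)
  then show "(\<lambda>x. rot (g x) $ i) \<in> L2 \<Omega>" for i
    using exhaust_2[of i] L2_uminus[of "\<lambda>x. g x $ 1" \<Omega>] by (auto simp: rot_def)
qed

lemma L2_norm_rot: "L2_norm \<Omega> (\<lambda>x. rot (g x)) = L2_norm \<Omega> g"
  by (simp add: L2_norm_def L2_inner_def flip: power2_norm_eq_inner)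

text \<open>The discrete version of the identity holds for difference quotients with step \<open>h\<close>, where
  it is invariance of the integral under translations.\<close>

lemma test_functions_curl_identity:
  assumes \<phi>: "\<phi> \<in> test_functions \<Omega>" and \<psi>: "\<psi> \<in> test_functions \<Omega>"
  shows "L2_inner \<Omega> (partial_deriv 1 \<phi>) (partial_deriv 2 \<psi>) = L2_inner \<Omega> (partial_deriv 2 \<phi>) (partial_deriv 1 \<psi>)"
proof -
  let ?e1 = "axis 1 1 :: real^2" and ?e2 = "axis 2 1 :: real^2"
  have cont: "continuous_on UNIV \<xi>" if "\<xi> \<in> test_functions \<Omega>" for \<xi>
    using that by (intro smooth_continuous_on test_functions_smooth)
  have meas: "\<xi> \<in> borel_measurable borel" if "\<xi> \<in> test_functions \<Omega>" for \<xi>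
    by (rule borel_measurable_continuous_onI[OF cont[OF that]])
  have shift: "(\<lambda>x. \<xi> (x + a)) \<in> borel_measurable borel" if "\<xi> \<in> test_functions \<Omega>" for \<xi> a
    by (rule measurable_compose[OF _ meas[OF that]]) simp
  note [measurable] = shift[OF \<phi>] shift[OF \<psi>] meas[OF \<phi>] meas[OF \<psi>]
    meas[OF test_functions_partial_deriv[OF \<phi>]] meas[OF test_functions_partial_deriv[OF \<psi>]]
  obtain B1 where B1: "B1 > 0" "\<And>x. \<bar>\<phi> x\<bar> \<le> B1" using test_functions_bounded[OF \<phi>] by blast
  obtain B2 where B2: "B2 > 0" "\<And>x. \<bar>\<psi> x\<bar> \<le> B2" using test_functions_bounded[OF \<psi>] by blast
  obtain C1 where C1: "C1 > 0" "\<And>i x h. \<bar>\<phi> (x + h *\<^sub>R axis i 1) - \<phi> x\<bar> \<le> C1 * \<bar>h\<bar>"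
    using test_functions_diff_quotient_bound[OF \<phi>] by metis
  obtain C2 where C2: "C2 > 0" "\<And>i x h. \<bar>\<psi> (x + h *\<^sub>R axis i 1) - \<psi> x\<bar> \<le> C2 * \<bar>h\<bar>"
    using test_functions_diff_quotient_bound[OF \<psi>] by metis
  obtain R where R: "R > 0" "\<And>x. x \<in> \<Omega> \<Longrightarrow> norm x \<le> R"
    using bounded_domain by (auto simp: bounded_pos)
  define J where "J a b = (LINT x|lborel. \<phi> (x + a) * \<psi> (x + b))" for a b
  have intJ: "integrable lborel (\<lambda>x. \<phi> (x + a) * \<psi> (x + b))" for a b
  proof (rule integrable_lborel_bounded_support)
    show "bounded ((\<lambda>x. x - a) ` \<Omega>)"
      using bounded_translation[OF bounded_domain, of "- a"] by (simp add: add.commute)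
    show "\<bar>\<phi> (x + a) * \<psi> (x + b)\<bar> \<le> B1 * B2" for x
      unfolding abs_mult by (intro mult_mono B1 B2) (use B1 in auto)
    show "\<phi> (x + a) * \<psi> (x + b) = 0" if "x \<notin> (\<lambda>x. x - a) ` \<Omega>" for x
    proof -
      have "x + a \<notin> \<Omega>" using that by (auto simp: image_iff)
      then show ?thesis using test_functions_zero_outside[OF \<phi>] by simp
    qed
  qed measurable
  have J_shift: "J (a + c) (b + c) = J a b" for a b c
    using lborel_integral_translate[of "\<lambda>x. \<phi> (x + a) * \<psi> (x + b)" c]
    by (simp add: J_def add_ac)
  define D where "D \<xi> i t x = (\<xi> (x + t *\<^sub>R axis i 1) - \<xi> x) / t" for \<xi> :: "real^2 \<Rightarrow> real" and i t x
  have DD: "(LINT x|lborel. D \<phi> i s x * D \<psi> j t x) =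
     (J (s *\<^sub>R axis i 1) (t *\<^sub>R axis j 1) - J (s *\<^sub>R axis i 1) 0 - J 0 (t *\<^sub>R axis j 1) + J 0 0) / (s * t)" for i j s t
  proof -
    let ?a = "s *\<^sub>R axis i 1" and ?b = "t *\<^sub>R axis j 1"
    have "(LINT x|lborel. D \<phi> i s x * D \<psi> j t x) =
      (LINT x|lborel. (\<phi> (x + ?a) * \<psi> (x + ?b) - \<phi> (x + ?a) * \<psi> (x + 0) - \<phi> (x + 0) * \<psi> (x + ?b) + \<phi> (x + 0) * \<psi> (x + 0)) / (s * t))"
      unfolding D_def by (intro Bochner_Integration.integral_cong) (auto simp: algebra_simps diff_divide_distrib add_divide_distrib)
    also have "\<dots> = (J ?a ?b - J ?a 0 - J 0 ?b + J 0 0) / (s * t)"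
      unfolding J_def integral_divide_zero
      using intJ[of ?a ?b] intJ[of ?a 0] intJ[of 0 ?b] intJ[of 0 0] by simp
    finally show ?thesis .
  qed
  define h :: "nat \<Rightarrow> real" where "h n = inverse (real (Suc n))" for n
  have h: "h \<longlonglongrightarrow> 0" "h n > 0" "h n \<le> 1" for n
    using LIMSEQ_inverse_real_of_nat by (auto simp: h_def[abs_def] inverse_eq_divide)
  have h': "(\<lambda>n. - h n) \<longlonglongrightarrow> 0" using tendsto_minus[OF h(1)] by simp
  \<comment> \<open>\<open>J\<close> depends only on the difference of its two shifts. Forward steps
    in the directions 1, 2 and backward steps in the directions 2, 1 lead to the same four
    differences, so the two integrals agree although their limits are different products of
    derivatives.\<close>
  have swap: "(LINT x|lborel. D \<phi> 1 (h n) x * D \<psi> 2 (h n) x) = (LINT x|lborel. D \<phi> 2 (- h n) x * D \<psi> 1 (- h n) x)" for n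
  proof -
    let ?c = "h n *\<^sub>R ?e1" and ?d = "h n *\<^sub>R ?e2"
    have "J (- ?d) (- ?c) = J ?c ?d" using J_shift[of "- ?d" "?c + ?d" "- ?c"] by simp
    moreover have "J (- ?d) 0 = J 0 ?d" using J_shift[of "- ?d" "?d" 0] by simp
    moreover have "J 0 (- ?c) = J ?c 0" using J_shift[of 0 "?c" "- ?c"] by simp
    ultimately show ?thesis unfolding DD by simp
  qed
  \<comment> \<open>Steps of length at most 1 keep the supports of all quotients of \<phi> in the
    ball of radius R + 1.\<close>
  have lim: "(\<lambda>n. LINT x|lborel. D \<phi> i (s n) x * D \<psi> j (s n) x) \<longlonglongrightarrow>
      (LINT x|lborel. partial_deriv i \<phi> x * partial_deriv j \<psi> x)"
    if s: "s \<longlonglongrightarrow> 0" "\<And>n. s n \<noteq> 0" "\<And>n. \<bar>s n\<bar> \<le> 1" for s i j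
  proof (rule integral_dominated_convergence[where w="\<lambda>x. indicator (cball 0 (R + 1)) x * (C1 * C2)"])
    show "integrable lborel (\<lambda>x::real^2. indicator (cball 0 (R + 1)) x * (C1 * C2))"
    proof (rule integrable_lborel_bounded_support[OF _ bounded_cball[of 0 "R + 1"], of _ "C1 * C2"])
      show "(\<lambda>x::real^2. indicator (cball 0 (R + 1)) x * (C1 * C2)) \<in> borel_measurable borel"
        by (intro borel_measurable_times borel_measurable_indicator) auto
    qed (use C1(1) C2(1) in \<open>auto simp: indicator_def\<close>)
    show "AE x in lborel. (\<lambda>n. D \<phi> i (s n) x * D \<psi> j (s n) x) \<longlonglongrightarrow> partial_deriv i \<phi> x * partial_deriv j \<psi> x"
      unfolding D_def partial_deriv_def
      by (intro AE_I2 tendsto_mult diff_quotient_tendsto s smooth_differentiable test_functions_smooth[OF \<phi>]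
          test_functions_smooth[OF \<psi>])
    show "AE x in lborel. norm (D \<phi> i (s n) x * D \<psi> j (s n) x) \<le> indicator (cball 0 (R + 1)) x * (C1 * C2)" for n
    proof (rule AE_I2)
      fix x
      have "\<bar>D \<phi> i (s n) x\<bar> \<le> C1" "\<bar>D \<psi> j (s n) x\<bar> \<le> C2"
        unfolding D_def using C1(2)[of x "s n" i] C2(2)[of x "s n" j] s(2)[of n]
        by (simp_all add: abs_divide divide_le_eq)
      then have "\<bar>D \<phi> i (s n) x\<bar> * \<bar>D \<psi> j (s n) x\<bar> \<le> C1 * C2" by (intro mult_mono) auto
      moreover have "D \<phi> i (s n) x = 0" if "x \<notin> cball 0 (R + 1)"
      proof -
        have "norm x \<le> norm (x + s n *\<^sub>R axis i 1) + norm (s n *\<^sub>R (axis i 1 :: real^2))"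
          using norm_triangle_ineq4[of "x + s n *\<^sub>R axis i 1" "s n *\<^sub>R axis i 1"] by simp
        then have "norm (x + s n *\<^sub>R axis i 1) > R" using that s(3)[of n] by simp
        then have "x + s n *\<^sub>R axis i 1 \<notin> \<Omega>" "x \<notin> \<Omega>" using R that by fastforce+
        then show ?thesis using test_functions_zero_outside[OF \<phi>] by (simp add: D_def)
      qed
      ultimately show "norm (D \<phi> i (s n) x * D \<psi> j (s n) x) \<le> indicator (cball 0 (R + 1)) x * (C1 * C2)"
        using C1(1) C2(1) by (cases "x \<in> cball 0 (R + 1)") (auto simp: abs_mult)
    qed
    show "(\<lambda>x. D \<phi> i (s n) x * D \<psi> j (s n) x) \<in> borel_measurable lborel" for n
      unfolding D_def by measurable
  qed measurable
  have "(LINT x|lborel. partial_deriv 1 \<phi> x * partial_deriv 2 \<psi> x) = (LINT x|lborel. partial_deriv 2 \<phi> x * partial_deriv 1 \<psi> x)"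
  proof (rule LIMSEQ_unique)
    show "(\<lambda>n. LINT x|lborel. D \<phi> 1 (h n) x * D \<psi> 2 (h n) x) \<longlonglongrightarrow> (LINT x|lborel. partial_deriv 1 \<phi> x * partial_deriv 2 \<psi> x)"
      by (rule lim[OF h(1)]) (use h in \<open>auto simp: less_imp_neq abs_of_pos\<close>, use h(2) in \<open>auto simp: less_le\<close>)
    show "(\<lambda>n. LINT x|lborel. D \<phi> 1 (h n) x * D \<psi> 2 (h n) x) \<longlonglongrightarrow> (LINT x|lborel. partial_deriv 2 \<phi> x * partial_deriv 1 \<psi> x)"
      unfolding swap by (rule lim[OF h']) (use h in \<open>auto simp: abs_of_pos\<close>, use h(2) in \<open>auto simp: less_le\<close>)
  qed
  moreover have "L2_inner \<Omega> (partial_deriv i \<phi>) (partial_deriv j \<psi>) = (LINT x|lborel. partial_deriv i \<phi> x * partial_deriv j \<psi> x)" for i j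
  proof -
    have *: "(\<lambda>x. indicator \<Omega> x * (partial_deriv i \<phi> x * partial_deriv j \<psi> x)) = (\<lambda>x. partial_deriv i \<phi> x * partial_deriv j \<psi> x)"
      using test_functions_zero_outside[OF test_functions_partial_deriv[OF \<phi>]] by (auto simp: indicator_def fun_eq_iff)
    show ?thesis by (subst L2_inner_lborel) (simp_all only: *, measurable)
  qed
  ultimately show ?thesis by simp
qed

text \<open>The bilinear form vanishes on test functions and is bounded by the gradient norms, so
  density applies. Being antisymmetric, it allows both arguments to be replaced by test functions
  with linearity in the first argument alone.\<close>

lemma H10_curl_identity:
  assumes u: "u \<in> H10 \<Omega>" and v: "v \<in> H10 \<Omega>"
  shows "L2_inner \<Omega> (grad \<Omega> u) (\<lambda>x. rot (grad \<Omega> v x)) = 0"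
proof -
  define b where "b u v = L2_inner \<Omega> (grad \<Omega> u) (\<lambda>x. rot (grad \<Omega> v x))" for u v
  have H1: "w \<in> Hk 1 \<Omega>" if "w \<in> H10 \<Omega> \<or> w \<in> test_functions \<Omega>" for w
    using that H10_H1 test_functions_H1 by auto
  have b_anti: "b u v = - b v u" for u v
  proof -
    have "(\<lambda>x. grad \<Omega> u x \<bullet> rot (grad \<Omega> v x)) = (\<lambda>x. - (grad \<Omega> v x \<bullet> rot (grad \<Omega> u x)))"
      by (simp add: inner_rot fun_eq_iff)
    then show ?thesis by (simp add: b_def L2_inner_def)
  qed
  have b_diff: "b (\<lambda>x. u x - v x) w = b u w - b v w" if "u \<in> Hk 1 \<Omega>" "v \<in> Hk 1 \<Omega>" "w \<in> Hk 1 \<Omega>" for u v w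
    unfolding b_def using that by (intro L2_inner_grad_diff rot_L2 grad_L2)
  have b_le: "\<bar>b u v\<bar> \<le> L2_norm \<Omega> (grad \<Omega> u) * L2_norm \<Omega> (grad \<Omega> v)" if "u \<in> Hk 1 \<Omega>" "v \<in> Hk 1 \<Omega>" for u v
    using L2_inner_le_norm[OF grad_L2[OF that(1)] rot_L2[OF grad_L2[OF that(2)]]] by (simp add: b_def L2_norm_rot)
  have b_test: "b \<phi> \<psi> = 0" if "\<phi> \<in> test_functions \<Omega>" "\<psi> \<in> test_functions \<Omega>" for \<phi> \<psi>
  proof -
    have L2: "partial_deriv i \<xi> \<in> L2 \<Omega>" if "\<xi> \<in> test_functions \<Omega>" for i \<xi>
      by (rule test_functions_L2[OF test_functions_partial_deriv[OF that]])
    have "b \<phi> \<psi> = (LINT x|lebesgue_on \<Omega>. partial_deriv 1 \<phi> x * partial_deriv 2 \<psi> x - partial_deriv 2 \<phi> x * partial_deriv 1 \<psi> x)"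
      unfolding b_def L2_inner_def
    proof (rule integral_cong_AE)
      show "(\<lambda>x. grad \<Omega> \<phi> x \<bullet> rot (grad \<Omega> \<psi> x)) \<in> borel_measurable (lebesgue_on \<Omega>)"
        using that by (intro borel_measurable_inner L2_measurable rot_L2 grad_L2 H1) auto
      show "(\<lambda>x. partial_deriv 1 \<phi> x * partial_deriv 2 \<psi> x - partial_deriv 2 \<phi> x * partial_deriv 1 \<psi> x) \<in> borel_measurable (lebesgue_on \<Omega>)"
        using that by (intro borel_measurable_diff borel_measurable_times L2_measurable L2)
      show "AE x in lebesgue_on \<Omega>. grad \<Omega> \<phi> x \<bullet> rot (grad \<Omega> \<psi> x) =
          partial_deriv 1 \<phi> x * partial_deriv 2 \<psi> x - partial_deriv 2 \<phi> x * partial_deriv 1 \<psi> x"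
        using grad_test_function[OF that(1)] grad_test_function[OF that(2)]
        by eventually_elim (simp add: inner_rot)
    qed
    also have "\<dots> = L2_inner \<Omega> (partial_deriv 1 \<phi>) (partial_deriv 2 \<psi>) - L2_inner \<Omega> (partial_deriv 2 \<phi>) (partial_deriv 1 \<psi>)"
      using L2_integrable_inner[OF L2[OF that(1)] L2[OF that(2)]] by (simp add: L2_inner_def)
    finally show ?thesis using test_functions_curl_identity[OF that] by simp
  qed
  \<comment> \<open>The cap e \<le> 1 bounds the quadratic remainder e^2 by e.\<close>
  have b_bound: "\<bar>b u v\<bar> \<le> e * (L2_norm \<Omega> (grad \<Omega> v) + L2_norm \<Omega> (grad \<Omega> u) + 1)" if e: "0 < e" "e \<le> 1" for e
  proof -
    obtain \<phi> where \<phi>: "\<phi> \<in> test_functions \<Omega>" "L2_norm \<Omega> (grad \<Omega> (\<lambda>x. u x - \<phi> x)) \<le> e"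
      using H10_approx[OF u e(1)] by blast
    obtain \<psi> where \<psi>: "\<psi> \<in> test_functions \<Omega>" "L2_norm \<Omega> (grad \<Omega> (\<lambda>x. v x - \<psi> x)) \<le> e"
      using H10_approx[OF v e(1)] by blast
    have H: "u \<in> Hk 1 \<Omega>" "v \<in> Hk 1 \<Omega>" "\<phi> \<in> Hk 1 \<Omega>" "\<psi> \<in> Hk 1 \<Omega>" using u v \<phi> \<psi> H1 by auto
    have "b u v = b (\<lambda>x. u x - \<phi> x) v - b (\<lambda>x. v x - \<psi> x) \<phi>"
      using b_diff[OF H(1,3,2)] b_diff[OF H(2,4,3)] b_anti[of v \<phi>] b_test[OF \<psi>(1) \<phi>(1)] by simp
    also have "\<bar>\<dots>\<bar> \<le> \<bar>b (\<lambda>x. u x - \<phi> x) v\<bar> + \<bar>b (\<lambda>x. v x - \<psi> x) \<phi>\<bar>" by simp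
    also have "\<dots> \<le> e * L2_norm \<Omega> (grad \<Omega> v) + e * L2_norm \<Omega> (grad \<Omega> \<phi>)"
      using b_le[OF Hk_diff[OF H(1,3)] H(2)] b_le[OF Hk_diff[OF H(2,4)] H(3)] \<phi>(2) \<psi>(2)
      by (intro add_mono) (auto elim!: order_trans intro!: mult_right_mono)
    also have "L2_norm \<Omega> (grad \<Omega> \<phi>) = L2_norm \<Omega> (\<lambda>x. grad \<Omega> u x - grad \<Omega> (\<lambda>x. u x - \<phi> x) x)"
      using grad_diff_AE[OF H(1,3)] H
      by (intro L2_norm_cong_AE grad_L2 L2_diff Hk_diff) (auto elim: eventually_mono)
    also have "\<dots> \<le> L2_norm \<Omega> (grad \<Omega> u) + L2_norm \<Omega> (grad \<Omega> (\<lambda>x. u x - \<phi> x))"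
      by (intro L2_norm_triangle_diff grad_L2 Hk_diff H)
    finally have "\<bar>b u v\<bar> \<le> e * L2_norm \<Omega> (grad \<Omega> v) + e * (L2_norm \<Omega> (grad \<Omega> u) + L2_norm \<Omega> (grad \<Omega> (\<lambda>x. u x - \<phi> x)))"
      using e(1) by (simp add: mult_left_mono)
    also have "\<dots> \<le> e * L2_norm \<Omega> (grad \<Omega> v) + e * (L2_norm \<Omega> (grad \<Omega> u) + 1)"
      using e \<phi>(2) by (intro add_mono mult_left_mono) auto
    finally show ?thesis by (simp add: algebra_simps)
  qed
  have "\<bar>b u v\<bar> \<le> 0"
  proof (rule field_le_epsilon)
    fix e :: real assume e: "e > 0"
    define N where "N = L2_norm \<Omega> (grad \<Omega> v) + L2_norm \<Omega> (grad \<Omega> u) + 1"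
    have N: "N > 0" by (simp add: N_def add_nonneg_pos)
    have "\<bar>b u v\<bar> \<le> min 1 (e / N) * N"
      unfolding N_def by (rule b_bound) (use e N in \<open>auto simp: N_def\<close>)
    also have "\<dots> \<le> e / N * N" using N by (intro mult_right_mono) auto
    finally show "\<bar>b u v\<bar> \<le> 0 + e" using N by simp
  qed
  then show ?thesis by (simp add: b_def)
qed

end

section \<open>The discrete inverse Laplacian\<close>

lemma sum_fun_apply: "(\<Sum>i\<in>A. f i) x = (\<Sum>i\<in>A. f i x)"
  by (induction A rule: infinite_finite_induct) auto

text \<open>Functions with pointwise operations become a vector space, so that the number of
  independent functions in a finite span can be bounded.\<close>

interpretation real_fun: vector_space "\<lambda>(c::real) (f :: 'a \<Rightarrow> real) x. c * f x"
  by unfold_locales (auto simp: fun_eq_iff algebra_simps)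

context bounded_domain
begin

lemma Hk_sum:
  assumes "finite A" "\<And>i. i \<in> A \<Longrightarrow> f i \<in> Hk 1 \<Omega>"
  shows "(\<lambda>x. \<Sum>i\<in>A. c i * f i x) \<in> Hk 1 \<Omega>"
  using assms
proof (induction A rule: finite_induct)
  case empty
  have "(\<lambda>x. 0) \<in> Hk 1 \<Omega>"
    by (rule H1I[of _ "\<lambda>i x. 0"]) (auto simp: L2_zero has_weak_deriv_def L2_inner_def)
  then show ?case by simp
next
  case (insert i A)
  then show ?case by (auto intro!: Hk_add Hk_cmult)
qed

text \<open>A null function has the weak derivative 0, whatever representative is chosen. This
  allows a linear relation that holds only on the open cells to be tested in the gradient inner
  product.\<close>

lemma L2_inner_grad_null:
  assumes "u \<in> L2 \<Omega>" "AE x in lebesgue_on \<Omega>. u x = 0" "g \<in> L2 \<Omega>"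
  shows "L2_inner \<Omega> (grad \<Omega> u) g = 0"
proof -
  have "L2_inner \<Omega> u \<phi> = 0" if "\<phi> \<in> test_functions \<Omega>" for \<phi>
    using L2_inner_cong_AE[OF assms(1) L2_zero test_functions_L2[OF that] assms(2)] by (simp add: L2_inner_def)
  then have weak: "has_weak_deriv \<Omega> (mi_single 1 i) u (\<lambda>x. 0)" for i
    by (auto simp: has_weak_deriv_def test_functions_mi_deriv L2_inner_def)
  have "u \<in> Hk 1 \<Omega>" by (rule H1I[OF assms(1) L2_zero weak])
  moreover have "AE x in lebesgue_on \<Omega>. grad \<Omega> u x = 0"
    using grad_eq_AE[OF L2_zero weak] by eventually_elim (simp add: vec_eq_iff)
  ultimately show ?thesis
    using L2_inner_cong_AE[OF grad_L2 L2_zero assms(3)] by (simp add: L2_inner_def)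
qed

lemma L2_inner_grad_sum:
  assumes "finite A" "\<And>i. i \<in> A \<Longrightarrow> f i \<in> Hk 1 \<Omega>" "g \<in> L2 \<Omega>"
  shows "L2_inner \<Omega> (grad \<Omega> (\<lambda>x. \<Sum>i\<in>A. c i * f i x)) g = (\<Sum>i\<in>A. c i * L2_inner \<Omega> (grad \<Omega> (f i)) g)"
  using assms(1,2)
proof (induction A rule: finite_induct)
  case empty
  show ?case using L2_inner_grad_null[OF L2_zero _ assms(3)] by simp
next
  case (insert i A)
  have "L2_inner \<Omega> (grad \<Omega> (\<lambda>x. c i * f i x + (\<Sum>i\<in>A. c i * f i x))) g =
    L2_inner \<Omega> (grad \<Omega> (\<lambda>x. c i * f i x)) g + L2_inner \<Omega> (grad \<Omega> (\<lambda>x. \<Sum>i\<in>A. c i * f i x)) g"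
    using insert assms(3) by (intro L2_inner_grad_add Hk_cmult Hk_sum) auto
  then show ?case
    using insert assms(3) by (simp add: L2_inner_grad_cmult)
qed

lemma L20_add: "u \<in> L20 \<Omega> \<Longrightarrow> v \<in> L20 \<Omega> \<Longrightarrow> (\<lambda>x. u x + v x) \<in> L20 \<Omega>"
  by (simp add: L20_def L2_add L2_integrable[OF finite_measure_domain])

lemma L20_cmult: "u \<in> L20 \<Omega> \<Longrightarrow> (\<lambda>x. c * u x) \<in> L20 \<Omega>"
  by (simp add: L20_def L2_mult)

lemma L20_diff: "u \<in> L20 \<Omega> \<Longrightarrow> v \<in> L20 \<Omega> \<Longrightarrow> (\<lambda>x. u x - v x) \<in> L20 \<Omega>"
  by (simp add: L20_def L2_diff L2_integrable[OF finite_measure_domain])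

lemma Vh0_add: "u \<in> Vh0 \<Omega> T k \<Longrightarrow> v \<in> Vh0 \<Omega> T k \<Longrightarrow> (\<lambda>x. u x + v x) \<in> Vh0 \<Omega> T k"
  by (simp add: Vh0_def lagrange_space_add L20_add)

lemma Vh0_cmult: "u \<in> Vh0 \<Omega> T k \<Longrightarrow> (\<lambda>x. c * u x) \<in> Vh0 \<Omega> T k"
  by (simp add: Vh0_def lagrange_space_cmult L20_cmult)

lemma Vh0_diff: "u \<in> Vh0 \<Omega> T k \<Longrightarrow> v \<in> Vh0 \<Omega> T k \<Longrightarrow> (\<lambda>x. u x - v x) \<in> Vh0 \<Omega> T k"
  by (simp add: Vh0_def lagrange_space_diff L20_diff)

lemma Vh0_zero: "(\<lambda>x. 0) \<in> Vh0 \<Omega> T k"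
  by (simp add: Vh0_def lagrange_space_const L20_def L2_zero)

lemma Vh0_sum:
  assumes "finite A" "\<And>i. i \<in> A \<Longrightarrow> f i \<in> Vh0 \<Omega> T k"
  shows "(\<lambda>x. \<Sum>i\<in>A. c i * f i x) \<in> Vh0 \<Omega> T k"
  using assms
proof (induction A rule: finite_induct)
  case empty
  show ?case by (simp add: Vh0_zero)
next
  case (insert i A)
  have "(\<lambda>x. c i * f i x + (\<Sum>i\<in>A. c i * f i x)) \<in> Vh0 \<Omega> T k"
    by (rule Vh0_add[OF Vh0_cmult]) (use insert in auto)
  then show ?case using insert by simp
qed

end

section \<open>Finite dimension and representation of functionals\<close>

context mesh
begin

text \<open>Selecting one cell for each point makes it unnecessary that distinct cells have disjoint
  interiors.\<close>

definition shape_function :: "(real^2) set \<times> multi_index \<Rightarrow> real^2 \<Rightarrow> real" where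
  "shape_function p x = (if x \<in> skeleton_complement \<and> (SOME K. K \<in> T \<and> x \<in> interior K) = fst p
     then \<Prod>i\<in>UNIV. (x $ i) ^ snd p i else 0)"

text \<open>Members of \<open>lagrange_space\<close> are unconstrained off the closure of \<Omega>,
  so the space itself has no finite spanning set. The cut-off to the open cells changes a function
  only on a null subset of \<Omega> and leaves a combination of finitely many cellwise
  monomials.\<close>

lemma restricted_lagrange_in_span:
  assumes "v \<in> lagrange_space \<Omega> T k"
  shows "(\<lambda>x. if x \<in> skeleton_complement then v x else 0)
    \<in> real_fun.span (shape_function ` (T \<times> {\<alpha>. mi_order \<alpha> \<le> k}))"
proof -
  have "\<exists>a. \<forall>x\<in>K. v x = (\<Sum>\<alpha>\<in>{\<alpha>. mi_order \<alpha> \<le> k}. a \<alpha> * (\<Prod>i\<in>UNIV. (x $ i) ^ \<alpha> i))" if "K \<in> T" for K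
  proof -
    have "\<exists>p\<in>poly_deg_le k. \<forall>x\<in>K. v x = p x"
      using assms that by (simp add: lagrange_space_def)
    then obtain p where p: "p \<in> poly_deg_le k" "\<forall>x\<in>K. v x = p x" by (elim bexE)
    obtain a where "p = (\<lambda>x. \<Sum>\<alpha>\<in>{\<alpha>. mi_order \<alpha> \<le> k}. a \<alpha> * (\<Prod>i\<in>UNIV. (x $ i) ^ \<alpha> i))"
      using p(1) unfolding poly_deg_le_def by (elim CollectE exE)
    then show ?thesis using p(2) by (intro exI[of _ a]) simp
  qed
  then have "\<exists>a. \<forall>K\<in>T. \<forall>x\<in>K. v x = (\<Sum>\<alpha>\<in>{\<alpha>. mi_order \<alpha> \<le> k}. a K \<alpha> * (\<Prod>i\<in>UNIV. (x $ i) ^ \<alpha> i))"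
    by (intro bchoice) simp
  then obtain a where "\<forall>K\<in>T. \<forall>x\<in>K. v x = (\<Sum>\<alpha>\<in>{\<alpha>. mi_order \<alpha> \<le> k}. a K \<alpha> * (\<Prod>i\<in>UNIV. (x $ i) ^ \<alpha> i))"
    by (elim exE)
  then have a: "v x = (\<Sum>\<alpha>\<in>{\<alpha>. mi_order \<alpha> \<le> k}. a K \<alpha> * (\<Prod>i\<in>UNIV. (x $ i) ^ \<alpha> i))"
    if "K \<in> T" "x \<in> K" for K x
    using that by simp
  have "(\<lambda>x. if x \<in> skeleton_complement then v x else 0) =
    (\<Sum>p\<in>T \<times> {\<alpha>. mi_order \<alpha> \<le> k}. (\<lambda>x. a (fst p) (snd p) * shape_function p x))"
  proof
    fix x
    show "(if x \<in> skeleton_complement then v x else 0) =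
      (\<Sum>p\<in>T \<times> {\<alpha>. mi_order \<alpha> \<le> k}. (\<lambda>x. a (fst p) (snd p) * shape_function p x)) x"
    proof (cases "x \<in> skeleton_complement")
      case True
      define K where "K = (SOME K. K \<in> T \<and> x \<in> interior K)"
      have "\<exists>K. K \<in> T \<and> x \<in> interior K" using True by (auto simp: skeleton_complement_def)
      from someI_ex[OF this] have K: "K \<in> T" "x \<in> K" using interior_subset by (auto simp: K_def)
      have "(\<Sum>p\<in>T \<times> {\<alpha>. mi_order \<alpha> \<le> k}. a (fst p) (snd p) * shape_function p x) =
        (\<Sum>K'\<in>T. \<Sum>\<alpha>\<in>{\<alpha>. mi_order \<alpha> \<le> k}. a K' \<alpha> * shape_function (K', \<alpha>) x)"
        by (simp add: sum.cartesian_product split_beta)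
      also have "\<dots> = (\<Sum>K'\<in>T. if K' = K then \<Sum>\<alpha>\<in>{\<alpha>. mi_order \<alpha> \<le> k}. a K' \<alpha> * (\<Prod>i\<in>UNIV. (x $ i) ^ \<alpha> i) else 0)"
        using True by (intro sum.cong refl) (auto simp: shape_function_def K_def[symmetric])
      also have "\<dots> = v x"
        using K a[OF K] finite_mesh by simp
      finally show ?thesis using True by (simp add: sum_fun_apply)
    next
      case False
      then show ?thesis by (simp add: sum_fun_apply shape_function_def)
    qed
  qed
  also have "\<dots> \<in> real_fun.span (shape_function ` (T \<times> {\<alpha>. mi_order \<alpha> \<le> k}))"
    by (intro real_fun.span_sum real_fun.span_scale real_fun.span_base) auto
  finally show ?thesis .
qed

text \<open>Orthonormality refers to the gradient inner product, the form that the discrete inverse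
  Laplacian inverts.\<close>

definition orthonormal_family :: "nat \<Rightarrow> nat \<Rightarrow> (nat \<Rightarrow> real^2 \<Rightarrow> real) \<Rightarrow> bool" where
  "orthonormal_family k N f \<longleftrightarrow> (\<forall>i<N. f i \<in> Vh0 \<Omega> T k) \<and>
     (\<forall>i<N. \<forall>j<N. L2_inner \<Omega> (grad \<Omega> (f i)) (grad \<Omega> (f j)) = (if i = j then 1 else 0))"

lemma AE_skeleton_complement: "AE x in lebesgue_on \<Omega>. x \<in> skeleton_complement"
proof -
  obtain M where "lipschitz_function \<Omega> (\<lambda>x. 0) M skeleton_complement"
    using lagrange_lipschitz_function[OF lagrange_space_const] by blast
  then interpret lipschitz_function \<Omega> "\<lambda>x. 0" M skeleton_complement .
  show ?thesis
    using AE_completion[OF AE_S] domain_lebesgue by (simp add: AE_restrict_space_iff)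
qed

text \<open>A linear relation between the cut-off functions holds almost everywhere for the
  \<open>f i\<close> themselves, and the gradient inner product with \<open>f j\<close> isolates the
  coefficient \<open>c j\<close>. So the cut-off functions are independent in a finite span.\<close>

lemma orthonormal_family_bound:
  assumes "orthonormal_family k N f"
  shows "N \<le> card (shape_function ` (T \<times> {\<alpha>. mi_order \<alpha> \<le> k}))"
proof -
  let ?R = "\<lambda>i x. if x \<in> skeleton_complement then f i x else 0"
  have f: "f i \<in> Vh0 \<Omega> T k" "f i \<in> Hk 1 \<Omega>" if "i < N" for i
    using assms that Vh0_H1 by (auto simp: orthonormal_family_def)
  have zero: "c j = 0" if c: "\<And>x. (\<Sum>i<N. c i * ?R i x) = 0" and j: "j < N" for c :: "nat \<Rightarrow> real" and j
  proof -
    let ?s = "\<lambda>x. \<Sum>i<N. c i * f i x"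
    have "?s x = 0" if "x \<in> skeleton_complement" for x using c[of x] that by simp
    then have "AE x in lebesgue_on \<Omega>. ?s x = 0"
      using AE_skeleton_complement by (auto elim: eventually_mono)
    moreover have "?s \<in> L2 \<Omega>" using f by (intro Hk_imp_L2[of _ 1] Hk_sum) auto
    ultimately have "0 = L2_inner \<Omega> (grad \<Omega> ?s) (grad \<Omega> (f j))"
      using f j by (intro L2_inner_grad_null[symmetric] grad_L2) auto
    also have "\<dots> = (\<Sum>i<N. c i * L2_inner \<Omega> (grad \<Omega> (f i)) (grad \<Omega> (f j)))"
      using f j by (intro L2_inner_grad_sum grad_L2) auto
    also have "\<dots> = (\<Sum>i<N. if i = j then c j else 0)"
      using assms j by (intro sum.cong refl) (auto simp: orthonormal_family_def)
    also have "\<dots> = c j" using j by simp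
    finally show ?thesis by simp
  qed
  \<comment> \<open>Independence is a property of sets, so repetitions are excluded separately: two
    equal members would satisfy the relation with coefficients 1 and -1.\<close>
  have inj: "inj_on ?R {..<N}"
  proof (rule inj_onI, rule ccontr)
    fix i j assume ij: "i \<in> {..<N}" "j \<in> {..<N}" "?R i = ?R j" "i \<noteq> j"
    define c :: "nat \<Rightarrow> real" where "c l = (if l = i then 1 else if l = j then -1 else 0)" for l
    have "(\<Sum>l<N. c l * ?R l x) = 0" for x
    proof -
      have "(\<Sum>l<N. c l * ?R l x) = (\<Sum>l<N. (if l = i then ?R i x else 0) - (if l = j then ?R j x else 0))"
        using ij(4) by (intro sum.cong) (auto simp: c_def)
      also have "\<dots> = ?R i x - ?R j x"
        using ij(1,2) by (simp add: sum_subtractf)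
      also have "\<dots> = 0" using fun_cong[OF ij(3), of x] by simp
      finally show ?thesis .
    qed
    from zero[OF this, of i] ij show False by (simp add: c_def)
  qed
  have "\<not> real_fun.dependent (?R ` {..<N})"
  proof
    assume "real_fun.dependent (?R ` {..<N})"
    then obtain u where u: "\<exists>v\<in>?R ` {..<N}. u v \<noteq> 0" "(\<Sum>v\<in>?R ` {..<N}. (\<lambda>x. u v * v x)) = 0"
      by (subst (asm) real_fun.dependent_finite) auto
    have "(\<Sum>i<N. u (?R i) * ?R i x) = 0" for x
    proof -
      have "(\<Sum>i<N. u (?R i) * ?R i x) = (\<Sum>v\<in>?R ` {..<N}. u v * v x)"
        by (subst sum.reindex[OF inj]) simp
      also have "\<dots> = (\<Sum>v\<in>?R ` {..<N}. (\<lambda>x. u v * v x)) x"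
        by (simp add: sum_fun_apply)
      also have "\<dots> = 0" using u(2) by simp
      finally show ?thesis .
    qed
    from zero[of "\<lambda>i. u (?R i)", OF this] u(1) show False by auto
  qed
  moreover have "?R ` {..<N} \<subseteq> real_fun.span (shape_function ` (T \<times> {\<alpha>. mi_order \<alpha> \<le> k}))"
    using f(1) restricted_lagrange_in_span by (auto simp: Vh0_def)
  moreover have "finite (shape_function ` (T \<times> {\<alpha>. mi_order \<alpha> \<le> k}))"
    using finite_mesh finite_mi_order_le by auto
  ultimately have "card (?R ` {..<N}) \<le> card (shape_function ` (T \<times> {\<alpha>. mi_order \<alpha> \<le> k}))"
    using real_fun.independent_span_bound by blast
  then show ?thesis by (simp add: card_image[OF inj])
qed

text \<open>Poincare's inequality makes the gradient form definite on the mean-free finite element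
  functions, up to null functions.\<close>

lemma Vh0_null:
  assumes "v \<in> Vh0 \<Omega> T k" "L2_inner \<Omega> (grad \<Omega> v) (grad \<Omega> v) = 0" "g \<in> L2 \<Omega>"
  shows "L2_inner \<Omega> g v = 0"
proof -
  obtain C where C: "\<And>v M S. lipschitz_function \<Omega> v M S \<Longrightarrow> (LINT x|lebesgue_on \<Omega>. v x) = 0 \<Longrightarrow>
      L2_norm \<Omega> v \<le> C * L2_norm \<Omega> (grad \<Omega> v)"
    using poincare_constant[OF nonempty_domain convex_domain] by metis
  obtain M where "lipschitz_function \<Omega> v M skeleton_complement"
    using lagrange_lipschitz_function assms(1) by (auto simp: Vh0_def)
  from C[OF this] have "L2_norm \<Omega> v = 0"
    using assms(1,2) L2_norm_nonneg[of \<Omega> v] by (simp add: Vh0_def L20_def L2_norm_def)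
  then have "L2_inner \<Omega> v v = 0" by (simp flip: L2_norm_power2)
  moreover have "v \<in> L2 \<Omega>" using assms(1) by (simp add: Vh0_def L20_def)
  ultimately show ?thesis using L2_inner_zero_norm(1)[OF assms(3)] by blast
qed

text \<open>The functional is represented in an orthonormal family of maximal length, which spans
  \<open>V\<^sub>h\<^sub>,\<^sub>0\<close> up to null functions.\<close>

lemma disc_inv_laplace_exists:
  assumes g: "g \<in> L2 \<Omega>"
  shows "\<exists>w. w \<in> Vh0 \<Omega> T k \<and>
    (\<forall>v\<in>Vh0 \<Omega> T k. L2_inner \<Omega> (grad \<Omega> w) (grad \<Omega> v) = L2_inner \<Omega> g v)"
proof -
  let ?P = "\<lambda>N. \<exists>f. orthonormal_family k N f"
  have "?P 0" by (simp add: orthonormal_family_def)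
  then have "\<exists>N. ?P N \<and> (\<forall>y. ?P y \<longrightarrow> y \<le> N)"
    using orthonormal_family_bound by (intro Nat.ex_has_greatest_nat) auto
  then obtain N f where f: "orthonormal_family k N f" and max: "\<And>y. ?P y \<Longrightarrow> y \<le> N" by blast
  have fV: "f i \<in> Vh0 \<Omega> T k" "f i \<in> Hk 1 \<Omega>" "f i \<in> L2 \<Omega>" if "i < N" for i
    using f that Vh0_H1 by (auto simp: orthonormal_family_def Vh0_def L20_def)
  define w where "w x = (\<Sum>i<N. L2_inner \<Omega> g (f i) * f i x)" for x
  have "w \<in> Vh0 \<Omega> T k" unfolding w_def using fV by (intro Vh0_sum) auto
  moreover have "L2_inner \<Omega> (grad \<Omega> w) (grad \<Omega> v) = L2_inner \<Omega> g v" if v: "v \<in> Vh0 \<Omega> T k" for v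
  proof -
    have vH: "v \<in> Hk 1 \<Omega>" and vL: "v \<in> L2 \<Omega>" using v Vh0_H1 by (auto simp: Vh0_def L20_def)
    define b where "b i = L2_inner \<Omega> (grad \<Omega> (f i)) (grad \<Omega> v)" for i
    define s where "s x = (\<Sum>i<N. b i * f i x)" for x
    define r where "r x = v x - s x" for x
    have s: "s \<in> Vh0 \<Omega> T k" unfolding s_def using fV by (intro Vh0_sum) auto
    then have sH: "s \<in> Hk 1 \<Omega>" using Vh0_H1 by auto
    have r: "r \<in> Vh0 \<Omega> T k" unfolding r_def using v s by (rule Vh0_diff)
    then have rH: "r \<in> Hk 1 \<Omega>" using Vh0_H1 by auto
    have orth: "L2_inner \<Omega> (grad \<Omega> r) (grad \<Omega> (f j)) = 0" if j: "j < N" for j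
    proof -
      have "L2_inner \<Omega> (grad \<Omega> s) (grad \<Omega> (f j)) = (\<Sum>i<N. b i * L2_inner \<Omega> (grad \<Omega> (f i)) (grad \<Omega> (f j)))"
        unfolding s_def[abs_def] using fV j by (intro L2_inner_grad_sum grad_L2) auto
      also have "\<dots> = (\<Sum>i<N. if i = j then b j else 0)"
        using f j by (intro sum.cong refl) (auto simp: orthonormal_family_def)
      also have "\<dots> = b j" using j by simp
      finally show ?thesis
        unfolding r_def[abs_def] using vH sH fV(2)[OF j]
        by (subst L2_inner_grad_diff) (auto simp: grad_L2 b_def L2_inner_commute)
    qed
    \<comment> \<open>Otherwise the remainder r, scaled to unit gradient norm, would prolong the
      family beyond its maximal length.\<close>
    have "L2_inner \<Omega> (grad \<Omega> r) (grad \<Omega> r) = 0"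
    proof (rule ccontr)
      assume "L2_inner \<Omega> (grad \<Omega> r) (grad \<Omega> r) \<noteq> 0"
      then have pos: "L2_inner \<Omega> (grad \<Omega> r) (grad \<Omega> r) > 0"
        using L2_inner_nonneg[of \<Omega> "grad \<Omega> r"] by simp
      define t where "t = 1 / sqrt (L2_inner \<Omega> (grad \<Omega> r) (grad \<Omega> r))"
      define f' where "f' i = (if i = N then (\<lambda>x. t * r x) else f i)" for i
      have tr: "L2_inner \<Omega> (grad \<Omega> (\<lambda>x. t * r x)) q = t * L2_inner \<Omega> (grad \<Omega> r) q" if "q \<in> L2 \<Omega>" for q
        using rH that by (rule L2_inner_grad_cmult)
      have tt: "t * (t * L2_inner \<Omega> (grad \<Omega> r) (grad \<Omega> r)) = 1"
        using pos by (simp add: t_def)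
      have "orthonormal_family k (Suc N) f'"
        unfolding orthonormal_family_def
      proof (intro conjI allI impI)
        fix i assume "i < Suc N"
        then show "f' i \<in> Vh0 \<Omega> T k" using fV r by (auto simp: f'_def less_Suc_eq intro: Vh0_cmult)
        fix j assume j: "j < Suc N"
        have trr: "L2_inner \<Omega> (grad \<Omega> (\<lambda>x. t * r x)) (grad \<Omega> (\<lambda>x. t * r x)) = 1"
          using tr[OF grad_L2[OF Hk_cmult[OF rH]], of t] tr[OF grad_L2[OF rH]] tt
            L2_inner_commute[of \<Omega> "grad \<Omega> r" "grad \<Omega> (\<lambda>x. t * r x)"] by simp
        have trf: "L2_inner \<Omega> (grad \<Omega> (\<lambda>x. t * r x)) (grad \<Omega> (f l)) = 0" if "l < N" for l
          using tr[OF grad_L2[OF fV(2)[OF that]]] orth[OF that] by simp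
        show "L2_inner \<Omega> (grad \<Omega> (f' i)) (grad \<Omega> (f' j)) = (if i = j then 1 else 0)"
        proof -
          have "L2_inner \<Omega> (grad \<Omega> (f l)) (grad \<Omega> (\<lambda>x. t * r x)) = 0" if "l < N" for l
            using trf[OF that] by (simp add: L2_inner_commute)
          then show ?thesis
            using \<open>i < Suc N\<close> j f trr trf by (auto simp: f'_def less_Suc_eq orthonormal_family_def)
        qed
      qed
      then show False using max[of "Suc N"] by auto
    qed
    then have "L2_inner \<Omega> g r = 0" by (rule Vh0_null[OF r _ g])
    then have "L2_inner \<Omega> g v = L2_inner \<Omega> g s"
      unfolding r_def[abs_def] using L2_inner_diff_right[OF vL Hk_imp_L2[OF sH] g] by simp
    also have "\<dots> = (\<Sum>i<N. b i * L2_inner \<Omega> g (f i))"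
      unfolding s_def[abs_def] using fV by (subst L2_inner_sum_right) (auto simp: g L2_mult L2_inner_mult_right)
    also have "\<dots> = L2_inner \<Omega> (grad \<Omega> w) (grad \<Omega> v)"
      unfolding w_def[abs_def] using fV vH
      by (subst L2_inner_grad_sum) (auto simp: grad_L2 b_def mult.commute)
    finally show ?thesis by simp
  qed
  ultimately show ?thesis by blast
qed

lemma disc_inv_laplace:
  assumes "g \<in> L2 \<Omega>"
  shows "disc_inv_laplace \<Omega> T k g \<in> Vh0 \<Omega> T k"
    and "v \<in> Vh0 \<Omega> T k \<Longrightarrow>
      L2_inner \<Omega> (grad \<Omega> (disc_inv_laplace \<Omega> T k g)) (grad \<Omega> v) = L2_inner \<Omega> g v"
  using someI_ex[OF disc_inv_laplace_exists[OF assms, of k]] unfolding disc_inv_laplace_def[symmetric] by auto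

end

lemma Hk_norm_nonneg: "0 \<le> Hk_norm k \<Omega> u"
  by (simp add: Hk_norm_def sum_nonneg)

section \<open>The convex splitting step\<close>

lemma C1_differentiable_on_UNIV_deriv:
  assumes "f C1_differentiable_on UNIV"
  shows "(f has_real_derivative deriv f x) (at x)" "continuous_on UNIV (deriv f)"
proof -
  obtain D where D: "\<And>x. (f has_vector_derivative D x) (at x)" "continuous_on UNIV D"
    using assms by (auto simp: C1_differentiable_on_def)
  then have *: "(f has_real_derivative D x) (at x)" for x
    by (simp add: has_real_derivative_iff_has_vector_derivative)
  then have "deriv f = D" by (auto intro: DERIV_imp_deriv)
  with * D(2) show "(f has_real_derivative deriv f x) (at x)" "continuous_on UNIV (deriv f)" by simp_all
qed

text \<open>The sum of the tangent inequalities at a and at b.\<close>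

lemma convex_deriv_monotone:
  assumes "convex_on UNIV f" "f C1_differentiable_on UNIV"
  shows "0 \<le> (deriv f a - deriv f b) * (a - b)"
proof -
  have "f x - f c \<ge> deriv f c * (x - c)" for x c
    by (rule convex_on_imp_above_tangent[OF assms(1)])
       (use C1_differentiable_on_UNIV_deriv(1)[OF assms(2)] in \<open>auto\<close>)
  from this[of a b] this[of b a] show ?thesis by (simp add: algebra_simps)
qed

context bounded_domain
begin

section \<open>Essential range and the nonlinearity\<close>

text \<open>A value outside the essential range lies in an interval with null preimage, which
  shrinks to one with rational centre and radius. The exceptional points are thus covered by
  countably many null sets.\<close>

lemma AE_in_ess_range:
  assumes "f \<in> borel_measurable (lebesgue_on \<Omega>)"
  shows "AE x in lebesgue_on \<Omega>. f x \<in> ess_range \<Omega> f"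
proof -
  define N where "N p = {x \<in> \<Omega>. \<bar>f x - fst p\<bar> < snd p}" for p :: "real \<times> real"
  define P where "P = {p \<in> \<rat> \<times> \<rat>. emeasure (lebesgue_on \<Omega>) (N p) = 0}"
  have N: "N p \<in> sets (lebesgue_on \<Omega>)" for p
  proof -
    have "{x \<in> space (lebesgue_on \<Omega>). \<bar>f x - fst p\<bar> < snd p} \<in> sets (lebesgue_on \<Omega>)"
      using assms by measurable
    then show ?thesis by (simp add: N_def space_restrict_space)
  qed
  have "countable P" unfolding P_def
    by (rule countable_subset[of _ "\<rat> \<times> \<rat>"]) (auto intro: countable_SIGMA countable_rat)
  moreover have "AE x in lebesgue_on \<Omega>. x \<notin> N p" if "p \<in> P" for p
    using that N by (intro AE_not_in) (auto simp: P_def null_sets_def)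
  ultimately have "AE x in lebesgue_on \<Omega>. \<forall>p\<in>P. x \<notin> N p"
    by (simp add: AE_ball_countable)
  moreover have "AE x in lebesgue_on \<Omega>. x \<in> \<Omega>"
    by (rule AE_I2) (simp add: space_restrict_space)
  ultimately show ?thesis
  proof eventually_elim
    fix x assume x: "\<forall>p\<in>P. x \<notin> N p" "x \<in> \<Omega>"
    show "f x \<in> ess_range \<Omega> f"
    proof (rule ccontr)
      assume "f x \<notin> ess_range \<Omega> f"
      then obtain e where e: "e > 0" "emeasure (lebesgue_on \<Omega>) {y \<in> \<Omega>. \<bar>f y - f x\<bar> < e} = 0"
        by (auto simp: ess_range_def not_less)
      \<comment> \<open>With r < e/2 and f(x) < q < f(x) + r, the interval of radius r around q
        contains f(x) and lies in that of radius e around f(x).\<close>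
      obtain r where r: "r \<in> \<rat>" "0 < r" "r < e / 2"
        using Rats_dense_in_real[of 0 "e / 2"] e(1) by auto
      obtain q where q: "q \<in> \<rat>" "f x < q" "q < f x + r"
        using Rats_dense_in_real[of "f x" "f x + r"] r(2) by auto
      have sub: "N (q, r) \<subseteq> N (f x, e)"
        using q r by (auto simp: N_def)
      have "emeasure (lebesgue_on \<Omega>) (N (q, r)) \<le> emeasure (lebesgue_on \<Omega>) (N (f x, e))"
        by (rule emeasure_mono[OF sub N])
      then have "emeasure (lebesgue_on \<Omega>) (N (q, r)) = 0"
        using e(2) by (simp add: N_def)
      then have "(q, r) \<in> P" using q r by (simp add: P_def)
      moreover have "x \<in> N (q, r)" using q x(2) by (simp add: N_def)
      ultimately show False using x(1) by blast
    qed
  qed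
qed

text \<open>The Lipschitz bound is available on I only. Comparison with a reference point s in I
  yields the linear growth |g(f)| \<le> |g(s)| + |L| |f - s|, which is square-integrable because
  \<Omega> has finite measure; measurability comes from continuity of g on the whole line. For empty
  I the assumption on f makes \<Omega> a null set.\<close>

lemma composition_L2:
  fixes g :: "real \<Rightarrow> real" and f :: "real^2 \<Rightarrow> real"
  assumes "continuous_on UNIV g" "\<forall>r\<in>I. \<forall>s\<in>I. \<bar>g r - g s\<bar> \<le> L * \<bar>r - s\<bar>"
    and f: "f \<in> L2 \<Omega>" "AE x in lebesgue_on \<Omega>. f x \<in> I"
  shows "(\<lambda>x. g (f x)) \<in> L2 \<Omega>"
proof (cases "I = {}")
  case True
  with f(2) have "AE x in lebesgue_on \<Omega>. False" by simp
  moreover have "(\<lambda>x. g (f x)) \<in> borel_measurable (lebesgue_on \<Omega>)"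
    by (rule borel_measurable_continuous_on[OF assms(1) L2_measurable[OF f(1)]])
  ultimately show ?thesis
    by (intro L2_bounded[OF finite_measure_domain, of _ 0]) (auto elim: eventually_mono)
next
  case False
  then obtain s where s: "s \<in> I" by blast
  have meas: "(\<lambda>x. g (f x)) \<in> borel_measurable (lebesgue_on \<Omega>)"
    by (rule borel_measurable_continuous_on[OF assms(1) L2_measurable[OF f(1)]])
  have "(\<lambda>x. \<bar>g s\<bar> + \<bar>L\<bar> * \<bar>f x - s\<bar>) \<in> L2 \<Omega>"
  proof (intro L2_add L2_const[OF finite_measure_domain] L2_mult)
    show "(\<lambda>x. \<bar>f x - s\<bar>) \<in> L2 \<Omega>"
      using L2_norm_fun[OF L2_diff[OF f(1) L2_const[OF finite_measure_domain, of s]]] by simp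
  qed
  then show ?thesis
  proof (rule L2_bounded_cong_AE[OF meas])
    show "AE x in lebesgue_on \<Omega>. norm (g (f x)) \<le> norm (\<bar>g s\<bar> + \<bar>L\<bar> * \<bar>f x - s\<bar>)"
      using f(2)
    proof eventually_elim
      fix x assume "f x \<in> I"
      then have "\<bar>g (f x) - g s\<bar> \<le> L * \<bar>f x - s\<bar>" using assms(2) s by blast
      also have "\<dots> \<le> \<bar>L\<bar> * \<bar>f x - s\<bar>" by (intro mult_right_mono) auto
      finally show "norm (g (f x)) \<le> norm (\<bar>g s\<bar> + \<bar>L\<bar> * \<bar>f x - s\<bar>)" by simp
    qed
  qed
qed

lemma composition_diff_le:
  fixes g :: "real \<Rightarrow> real" and a b :: "real^2 \<Rightarrow> real"
  assumes "continuous_on UNIV g" "\<forall>r\<in>I. \<forall>s\<in>I. \<bar>g r - g s\<bar> \<le> L * \<bar>r - s\<bar>" "0 \<le> L"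
    and a: "a \<in> L2 \<Omega>" "AE x in lebesgue_on \<Omega>. a x \<in> I"
    and b: "b \<in> L2 \<Omega>" "AE x in lebesgue_on \<Omega>. b x \<in> I"
  shows "L2_norm \<Omega> (\<lambda>x. g (a x) - g (b x)) \<le> L * L2_norm \<Omega> (\<lambda>x. a x - b x)"
proof -
  have "L2_norm \<Omega> (\<lambda>x. g (a x) - g (b x)) \<le> L2_norm \<Omega> (\<lambda>x. L * (a x - b x))"
  proof (rule L2_norm_mono_AE)
    show "(\<lambda>x. g (a x) - g (b x)) \<in> L2 \<Omega>"
      by (intro L2_diff composition_L2[OF assms(1,2)] a b)
    show "(\<lambda>x. L * (a x - b x)) \<in> L2 \<Omega>" by (intro L2_mult L2_diff a b)
    show "AE x in lebesgue_on \<Omega>. norm (g (a x) - g (b x)) \<le> norm (L * (a x - b x))"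
      using a(2) b(2) by eventually_elim (use assms(2,3) in \<open>auto simp: abs_mult\<close>)
  qed
  then show ?thesis using assms(3) by (simp add: L2_norm_mult)
qed

section \<open>Mean values and constants\<close>

definition mean :: "(real^2 \<Rightarrow> real) \<Rightarrow> real" where
  "mean u = L2_inner \<Omega> u (\<lambda>_. 1) / L2_inner \<Omega> (\<lambda>_. 1) (\<lambda>_. 1 :: real)"

lemma one_L2: "(\<lambda>_. 1 :: real) \<in> L2 \<Omega>"
  by (rule L2_const[OF finite_measure_domain])

lemma domain_measure_pos:
  assumes "\<Omega> \<noteq> {}"
  shows "0 < L2_norm \<Omega> (\<lambda>_. 1 :: real)"
proof (rule ccontr)
  assume "\<not> 0 < L2_norm \<Omega> (\<lambda>_. 1 :: real)"
  then have "L2_norm \<Omega> (\<lambda>_. 1 :: real) = 0" using L2_norm_nonneg[of \<Omega> "\<lambda>_. 1 :: real"] by linarith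
  then have "L2_inner \<Omega> (\<lambda>_. 1 :: real) (\<lambda>_. 1) = 0" by (simp flip: L2_norm_power2)
  from L2_inner_zero_norm(2)[OF one_L2 one_L2 this] have "AE x in lebesgue_on \<Omega>. False" by simp
  then have "AE x in lebesgue. x \<notin> \<Omega>" using domain_lebesgue by (simp add: AE_restrict_space_iff)
  then have "\<Omega> \<in> null_sets lebesgue" using domain_lebesgue by (simp add: AE_iff_null_sets)
  then show False using open_not_negligible[OF open_domain assms] by (simp add: negligible_iff_null_sets)
qed

text \<open>|mean u| times the norm of 1 is the norm of the constant \<open>mean u\<close>.
  \<open>mean_le\<close> bounds it by the norm of u, while the equation \<open>abs_mean\<close>
  serves where the integral of u is known from an equation tested with 1.\<close>

lemma
  assumes "\<Omega> \<noteq> {}" "u \<in> L2 \<Omega>"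
  shows diff_mean_L20: "(\<lambda>x. u x - mean u) \<in> L20 \<Omega>"
    and mean_le: "\<bar>mean u\<bar> * L2_norm \<Omega> (\<lambda>_. 1 :: real) \<le> L2_norm \<Omega> u"
    and abs_mean: "\<bar>mean u\<bar> * L2_norm \<Omega> (\<lambda>_. 1 :: real) = \<bar>L2_inner \<Omega> u (\<lambda>_. 1)\<bar> / L2_norm \<Omega> (\<lambda>_. 1 :: real)"
proof -
  let ?w = "L2_norm \<Omega> (\<lambda>_. 1 :: real)"
  have w: "?w > 0" by (rule domain_measure_pos[OF assms(1)])
  have ww: "L2_inner \<Omega> (\<lambda>_. 1 :: real) (\<lambda>_. 1) = ?w\<^sup>2" by (simp add: L2_norm_power2)
  have "L2_inner \<Omega> (\<lambda>x. u x - mean u) (\<lambda>_. 1) = L2_inner \<Omega> u (\<lambda>_. 1) - L2_inner \<Omega> (\<lambda>_. mean u) (\<lambda>_. 1)"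
    by (intro L2_inner_diff_left L2_const[OF finite_measure_domain] assms)
  also have "L2_inner \<Omega> (\<lambda>_. mean u) (\<lambda>_. 1) = mean u * ?w\<^sup>2"
    using L2_inner_mult_left[of \<Omega> "mean u" "\<lambda>_. 1" "\<lambda>_. 1"] by (simp add: ww)
  also have "L2_inner \<Omega> u (\<lambda>_. 1) - mean u * ?w\<^sup>2 = 0"
    using w by (simp add: mean_def ww)
  finally show "(\<lambda>x. u x - mean u) \<in> L20 \<Omega>"
    using assms(2) by (simp add: L20_def L2_diff L2_const[OF finite_measure_domain] integral_eq_L2_inner_1)
  show *: "\<bar>mean u\<bar> * ?w = \<bar>L2_inner \<Omega> u (\<lambda>_. 1)\<bar> / ?w"
    using w by (simp add: mean_def ww power2_eq_square abs_divide abs_mult)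
  show "\<bar>mean u\<bar> * ?w \<le> L2_norm \<Omega> u"
    unfolding * using L2_inner_le_norm[OF assms(2) one_L2] w by (simp add: divide_le_eq)
qed

lemma L2_norm_const: "L2_norm \<Omega> (\<lambda>_. a :: real) = \<bar>a\<bar> * L2_norm \<Omega> (\<lambda>_. 1 :: real)"
  using L2_norm_mult[of \<Omega> a "\<lambda>_. 1"] by simp

lemma L2_norm_diff_mean_le:
  assumes "\<Omega> \<noteq> {}" "u \<in> L2 \<Omega>"
  shows "L2_norm \<Omega> (\<lambda>x. u x - mean u) \<le> 2 * L2_norm \<Omega> u"
  using L2_norm_triangle_diff[OF assms(2) L2_const[OF finite_measure_domain, of "mean u"]] mean_le[OF assms]
  unfolding L2_norm_const[of "mean u"] by simp

text \<open>Constants have Lipschitz constant 0, and \<open>pd_bound\<close> then forces the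
  gradient to vanish.\<close>

lemma const_H1: "(\<lambda>x. a) \<in> Hk 1 \<Omega>"
  and grad_const_AE: "AE x in lebesgue_on \<Omega>. grad \<Omega> (\<lambda>x. a) x = 0"
proof -
  have "0-lipschitz_on \<Omega> (\<lambda>x. a)" by (rule lipschitz_on_constant)
  then interpret lipschitz_function \<Omega> "\<lambda>x. a" 0 \<Omega>
    using open_domain by unfold_locales auto
  show "(\<lambda>x. a) \<in> Hk 1 \<Omega>" by (rule v_H1)
  have "pd i x = 0" for i x using pd_bound[of i x] by simp
  then show "AE x in lebesgue_on \<Omega>. grad \<Omega> (\<lambda>x. a) x = 0"
    using grad_v_AE by (auto simp: vec_eq_iff elim!: eventually_mono)
qed

lemma grad_diff_const:
  assumes "u \<in> Hk 1 \<Omega>"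
  shows "L2_norm \<Omega> (grad \<Omega> (\<lambda>x. u x - a)) = L2_norm \<Omega> (grad \<Omega> u)"
proof (rule L2_norm_cong_AE[OF grad_L2[OF Hk_diff[OF assms const_H1]] grad_L2[OF assms]])
  show "AE x in lebesgue_on \<Omega>. grad \<Omega> (\<lambda>x. u x - a) x = grad \<Omega> u x"
    using grad_diff_AE[OF assms const_H1, of a] grad_const_AE[of a] by eventually_elim simp
qed

end

section \<open>Error estimate for the convex splitting step\<close>

text \<open>For s \<le> X there is nothing to absorb. Otherwise X^2 \<le> s X, so the right-hand
  side is at most 2 K s X, and division by s > 0 leaves s \<le> (4 K / \<kappa>) X.\<close>

lemma quadratic_absorb:
  fixes s X K \<kappa> :: real
  assumes "\<kappa> > 0" "K \<ge> 0" "X \<ge> 0" "s \<ge> 0" "\<kappa> * s\<^sup>2 / 2 \<le> K * (s * X + X\<^sup>2)"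
  shows "s \<le> (1 + 4 * K / \<kappa>) * X"
proof (cases "s \<le> X")
  case True
  have "X * 1 \<le> X * (1 + 4 * K / \<kappa>)" using assms by (intro mult_left_mono) auto
  with True show ?thesis by (simp add: mult.commute)
next
  case False
  then have "X * X \<le> s * X" using assms(3) by (intro mult_right_mono) auto
  then have "K * (s * X + X\<^sup>2) \<le> K * (2 * s * X)"
    using assms(2) by (intro mult_left_mono) (auto simp: power2_eq_square mult.commute)
  with assms(5) have "s * (\<kappa> * s) \<le> s * (4 * K * X)"
    by (simp add: power2_eq_square algebra_simps)
  then have "\<kappa> * s \<le> 4 * K * X" using False assms(3) by (simp add: mult_le_cancel_left)
  then have "s \<le> 4 * K / \<kappa> * X" using assms(1) by (simp add: field_simps)
  then show ?thesis using assms(3) by (simp add: distrib_right)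
qed

context mesh
begin

text \<open>The two tested error equations share the indefinite coupling term
  \<open>(c\<^sup>* - c\<^sub>h, \<mu>\<^sup>* - \<mu>\<^sub>h)\<close>, which cancels in their difference. The explicit part of the nonlinearity only
  sees \<open>c\<^sup>n - c\<^sub>h\<^sup>n\<close>.\<close>

lemma convex_splitting_estimate:
  fixes m \<epsilon> \<tau> L P :: real and k :: nat
  defines "K \<equiv> P + m * \<tau> + \<epsilon>\<^sup>2 + L + L * P"
  defines "C \<equiv> 1 + 4 * K / min (\<epsilon>\<^sup>2) (m * \<tau>)"
  assumes pos: "m > 0" "\<epsilon> > 0" "\<tau> > 0" "L > 0" "P > 0"
    and poincare: "\<And>v. v \<in> Vh0 \<Omega> T k \<Longrightarrow> L2_norm \<Omega> v \<le> P * L2_norm \<Omega> (grad \<Omega> v)"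
    and C1: "fc C1_differentiable_on UNIV" "fe C1_differentiable_on UNIV" and conv: "convex_on UNIV fc"
    and lipI: "\<forall>r\<in>I. \<forall>s\<in>I. \<bar>deriv fc r - deriv fc s\<bar> + \<bar>deriv fe r - deriv fe s\<bar> \<le> L * \<bar>r - s\<bar>"
    and cn: "cn \<in> Hk 1 \<Omega>"
    and step: "convex_splitting_step \<Omega> (Hk 1 \<Omega>) m \<epsilon> \<tau> fc fe cn c \<mu>"
    and cnh: "cnh \<in> lagrange_space \<Omega> T k"
    and mass: "(LINT x|lebesgue_on \<Omega>. cnh x) = (LINT x|lebesgue_on \<Omega>. cn x)"
    and steph: "convex_splitting_step \<Omega> (lagrange_space \<Omega> T k) m \<epsilon> \<tau> fc fe cnh ch \<mu>h"
    and range: "ess_range \<Omega> c \<union> ess_range \<Omega> ch \<union> ess_range \<Omega> cn \<union> ess_range \<Omega> cnh \<subseteq> I"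
    and vs: "vs \<in> lagrange_space \<Omega> T k" and ms: "ms \<in> lagrange_space \<Omega> T k"
  shows "disc_neg_norm \<Omega> T k (\<lambda>x. c x - ch x) + Hk_norm 1 \<Omega> (\<lambda>x. c x - ch x) + Hk_norm 1 \<Omega> (\<lambda>x. \<mu> x - \<mu>h x)
    \<le> (4 + 2 * P * C + P + P * P * C + 2 * C + 2 * L + L * P * C) *
      (2 * Hk_norm 1 \<Omega> (\<lambda>x. c x - vs x) + Hk_norm 1 \<Omega> (\<lambda>x. \<mu> x - ms x) + L2_norm \<Omega> (\<lambda>x. cn x - cnh x))"
proof -
  let ?n = "L2_norm \<Omega>" and ?ip = "L2_inner \<Omega>"
  have c: "c \<in> Hk 1 \<Omega>" and \<mu>: "\<mu> \<in> Hk 1 \<Omega>"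
    and eq1: "\<And>v. v \<in> Hk 1 \<Omega> \<Longrightarrow> ?ip (\<lambda>x. (c x - cn x) / \<tau>) v + m * L2_inner \<Omega> (grad \<Omega> \<mu>) (grad \<Omega> v) = 0"
    and eq2: "\<And>w. w \<in> Hk 1 \<Omega> \<Longrightarrow> ?ip \<mu> w - \<epsilon>\<^sup>2 * L2_inner \<Omega> (grad \<Omega> c) (grad \<Omega> w)
      - ?ip (\<lambda>x. deriv fc (c x) - deriv fe (cn x)) w = 0"
    using step unfolding convex_splitting_step_def by blast+
  have ch: "ch \<in> lagrange_space \<Omega> T k" and \<mu>h: "\<mu>h \<in> lagrange_space \<Omega> T k"
    and eq1h: "\<And>v. v \<in> lagrange_space \<Omega> T k \<Longrightarrow> ?ip (\<lambda>x. (ch x - cnh x) / \<tau>) v + m * L2_inner \<Omega> (grad \<Omega> \<mu>h) (grad \<Omega> v) = 0"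
    and eq2h: "\<And>w. w \<in> lagrange_space \<Omega> T k \<Longrightarrow> ?ip \<mu>h w - \<epsilon>\<^sup>2 * L2_inner \<Omega> (grad \<Omega> ch) (grad \<Omega> w)
      - ?ip (\<lambda>x. deriv fc (ch x) - deriv fe (cnh x)) w = 0"
    using steph unfolding convex_splitting_step_def by blast+
  have H: "ch \<in> Hk 1 \<Omega>" "\<mu>h \<in> Hk 1 \<Omega>" "cnh \<in> Hk 1 \<Omega>" "vs \<in> Hk 1 \<Omega>" "ms \<in> Hk 1 \<Omega>"
    using ch \<mu>h cnh vs ms lagrange_H1 by blast+
  note L2s = Hk_imp_L2[OF c] Hk_imp_L2[OF \<mu>] Hk_imp_L2[OF cn] H[THEN Hk_imp_L2]
  \<comment> \<open>The shift of \<open>vs\<close> by the mean of c - vs stays in the finite element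
    space and makes \<rho> mean-free. With conservation of mass, \<theta> becomes mean-free too, so
    that Poincare's inequality applies to it.\<close>
  define a where "a = mean (\<lambda>x. c x - vs x)"
  define e where "e = (\<lambda>x. c x - ch x)"
  define en where "en = (\<lambda>x. cn x - cnh x)"
  define \<eta> where "\<eta> = (\<lambda>x. \<mu> x - \<mu>h x)"
  define \<rho> where "\<rho> = (\<lambda>x. c x - vs x - a)"
  define \<theta> where "\<theta> = (\<lambda>x. vs x + a - ch x)"
  define \<sigma> where "\<sigma> = (\<lambda>x. \<mu> x - ms x)"
  define \<phi> where "\<phi> = (\<lambda>x. ms x - \<mu>h x)"
  define dc where "dc = (\<lambda>x. deriv fc (c x) - deriv fc (ch x))"
  define de where "de = (\<lambda>x. deriv fe (cn x) - deriv fe (cnh x))"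
  have split: "e = (\<lambda>x. \<rho> x + \<theta> x)" "\<eta> = (\<lambda>x. \<sigma> x + \<phi> x)"
    by (auto simp: e_def \<rho>_def \<theta>_def \<eta>_def \<sigma>_def \<phi>_def)
  have V: "\<theta> \<in> lagrange_space \<Omega> T k" "\<phi> \<in> lagrange_space \<Omega> T k"
    unfolding \<theta>_def \<phi>_def by (intro lagrange_space_add lagrange_space_diff lagrange_space_const vs ms ch \<mu>h)+
  have HH: "\<rho> \<in> Hk 1 \<Omega>" "\<theta> \<in> Hk 1 \<Omega>" "\<sigma> \<in> Hk 1 \<Omega>" "\<phi> \<in> Hk 1 \<Omega>" "e \<in> Hk 1 \<Omega>" "\<eta> \<in> Hk 1 \<Omega>"
    unfolding \<rho>_def \<theta>_def \<sigma>_def \<phi>_def e_def \<eta>_def by (intro Hk_add Hk_diff c \<mu> H const_H1)+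
  note LL = HH[THEN Hk_imp_L2] and GG = HH[THEN grad_L2]
  have en: "en \<in> L2 \<Omega>" unfolding en_def by (intro L2_diff L2s)

  have inI: "AE x in lebesgue_on \<Omega>. u x \<in> I" if "u \<in> L2 \<Omega>" "ess_range \<Omega> u \<subseteq> I" for u
    using AE_in_ess_range[OF L2_measurable[OF that(1)]] by eventually_elim (use that(2) in blast)
  have I: "AE x in lebesgue_on \<Omega>. c x \<in> I" "AE x in lebesgue_on \<Omega>. ch x \<in> I"
    "AE x in lebesgue_on \<Omega>. cn x \<in> I" "AE x in lebesgue_on \<Omega>. cnh x \<in> I"
    using range by (intro inI L2s; auto)+
  have lc: "\<forall>r\<in>I. \<forall>s\<in>I. \<bar>deriv fc r - deriv fc s\<bar> \<le> L * \<bar>r - s\<bar>"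
    and le: "\<forall>r\<in>I. \<forall>s\<in>I. \<bar>deriv fe r - deriv fe s\<bar> \<le> L * \<bar>r - s\<bar>"
    using lipI by (meson abs_ge_zero add_increasing add_increasing2 order_trans le_add_same_cancel1 le_add_same_cancel2)+
  note cc = C1_differentiable_on_UNIV_deriv(2)[OF C1(1)] C1_differentiable_on_UNIV_deriv(2)[OF C1(2)]
  have NL: "(\<lambda>x. deriv fc (c x)) \<in> L2 \<Omega>" "(\<lambda>x. deriv fc (ch x)) \<in> L2 \<Omega>"
    "(\<lambda>x. deriv fe (cn x)) \<in> L2 \<Omega>" "(\<lambda>x. deriv fe (cnh x)) \<in> L2 \<Omega>"
    by (rule composition_L2[OF cc(1) lc L2s(1) I(1)] composition_L2[OF cc(1) lc L2s(4) I(2)]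
        composition_L2[OF cc(2) le L2s(3) I(3)] composition_L2[OF cc(2) le L2s(6) I(4)])+
  have dcL: "dc \<in> L2 \<Omega>" and deL: "de \<in> L2 \<Omega>"
    unfolding dc_def de_def by (intro L2_diff NL)+
  have dc_le: "?n dc \<le> L * ?n e"
    unfolding dc_def e_def using pos(4) by (intro composition_diff_le[OF cc(1) lc _ L2s(1) I(1) L2s(4) I(2)]) simp
  have de_le: "?n de \<le> L * ?n en"
    unfolding de_def en_def using pos(4) by (intro composition_diff_le[OF cc(2) le _ L2s(3) I(3) L2s(6) I(4)]) simp
  have mono: "0 \<le> ?ip dc e"
    unfolding L2_inner_def dc_def e_def
    by (intro Bochner_Integration.integral_nonneg) (simp add: convex_deriv_monotone[OF conv C1(1)])

  have err1: "?ip (\<lambda>x. e x - en x) v + m * \<tau> * L2_inner \<Omega> (grad \<Omega> \<eta>) (grad \<Omega> v) = 0"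
    if v: "v \<in> lagrange_space \<Omega> T k" for v
  proof -
    have vH: "v \<in> Hk 1 \<Omega>" using v lagrange_H1 by blast
    note vL = Hk_imp_L2[OF vH]
    have 1: "?ip (\<lambda>x. (c x - cn x) / \<tau>) v = (?ip c v - ?ip cn v) / \<tau>"
      using L2_inner_mult_left[of \<Omega> "1 / \<tau>" "\<lambda>x. c x - cn x" v] L2_inner_diff_left[OF L2s(1) L2s(3) vL] by simp
    have 2: "?ip (\<lambda>x. (ch x - cnh x) / \<tau>) v = (?ip ch v - ?ip cnh v) / \<tau>"
      using L2_inner_mult_left[of \<Omega> "1 / \<tau>" "\<lambda>x. ch x - cnh x" v] L2_inner_diff_left[OF L2s(4) L2s(6) vL] by simp
    have 3: "?ip (\<lambda>x. e x - en x) v = ?ip c v - ?ip cn v - (?ip ch v - ?ip cnh v)"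
      unfolding e_def en_def using vL by (simp add: L2_inner_diff_left L2_diff L2s)
    have 4: "L2_inner \<Omega> (grad \<Omega> \<eta>) (grad \<Omega> v) = L2_inner \<Omega> (grad \<Omega> \<mu>) (grad \<Omega> v) - L2_inner \<Omega> (grad \<Omega> \<mu>h) (grad \<Omega> v)"
      unfolding \<eta>_def by (rule L2_inner_grad_diff[OF \<mu> H(2) grad_L2[OF vH]])
    have "?ip c v - ?ip cn v + m * \<tau> * L2_inner \<Omega> (grad \<Omega> \<mu>) (grad \<Omega> v) = 0"
      using eq1[OF vH] pos(3) unfolding 1 by (simp add: field_simps)
    moreover have "?ip ch v - ?ip cnh v + m * \<tau> * L2_inner \<Omega> (grad \<Omega> \<mu>h) (grad \<Omega> v) = 0"
      using eq1h[OF v] pos(3) unfolding 2 by (simp add: field_simps)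
    ultimately show ?thesis unfolding 3 4 by (simp add: algebra_simps)
  qed
  have err2: "?ip \<eta> w = \<epsilon>\<^sup>2 * L2_inner \<Omega> (grad \<Omega> e) (grad \<Omega> w) + ?ip dc w - ?ip de w"
    if w: "w \<in> lagrange_space \<Omega> T k" for w
  proof -
    have wH: "w \<in> Hk 1 \<Omega>" using w lagrange_H1 by blast
    note wL = Hk_imp_L2[OF wH]
    have "?ip \<eta> w = ?ip \<mu> w - ?ip \<mu>h w"
      unfolding \<eta>_def by (rule L2_inner_diff_left[OF L2s(2) L2s(5) wL])
    moreover have "L2_inner \<Omega> (grad \<Omega> e) (grad \<Omega> w) = L2_inner \<Omega> (grad \<Omega> c) (grad \<Omega> w) - L2_inner \<Omega> (grad \<Omega> ch) (grad \<Omega> w)"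
      unfolding e_def by (rule L2_inner_grad_diff[OF c H(1) grad_L2[OF wH]])
    moreover have "?ip dc w = ?ip (\<lambda>x. deriv fc (c x)) w - ?ip (\<lambda>x. deriv fc (ch x)) w"
      unfolding dc_def by (rule L2_inner_diff_left[OF NL(1) NL(2) wL])
    moreover have "?ip de w = ?ip (\<lambda>x. deriv fe (cn x)) w - ?ip (\<lambda>x. deriv fe (cnh x)) w"
      unfolding de_def by (rule L2_inner_diff_left[OF NL(3) NL(4) wL])
    ultimately show ?thesis
      using eq2[OF wH] eq2h[OF w] L2_inner_diff_left[OF NL(1) NL(3) wL] L2_inner_diff_left[OF NL(2) NL(4) wL]
      by (simp only: right_diff_distrib)
  qed

  have one: "(\<lambda>_. 1) \<in> lagrange_space \<Omega> T k" by (rule lagrange_space_const)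
  have grad_one: "L2_inner \<Omega> g (grad \<Omega> (\<lambda>_. 1)) = 0" if "g \<in> L2 \<Omega>" for g
    using L2_inner_cong_AE[OF grad_L2[OF const_H1] L2_zero that grad_const_AE]
    by (simp add: L2_inner_commute[of \<Omega> g]) (simp add: L2_inner_def)
  have en0: "?ip en (\<lambda>_. 1) = 0"
    using mass L2_inner_diff_left[OF L2s(3) L2s(6) one_L2]
    by (simp add: en_def integral_eq_L2_inner_1)
  \<comment> \<open>Tested with 1, the evolution equation loses its gradient term, and e inherits
    the mean of \<open>en\<close>, which is 0.\<close>
  have e0: "?ip e (\<lambda>_. 1) = 0"
    using err1[OF one] grad_one[OF GG(6)] L2_inner_diff_left[OF LL(5) en one_L2] en0 by simp
  have \<rho>0: "\<rho> \<in> L20 \<Omega>"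
    using diff_mean_L20[OF nonempty_domain L2_diff[OF L2s(1) L2s(7)]] by (simp add: \<rho>_def a_def)
  have \<rho>1: "?ip \<rho> (\<lambda>_. 1) = 0" using \<rho>0 by (simp add: L20_def integral_eq_L2_inner_1)
  have \<theta>1: "?ip \<theta> (\<lambda>_. 1) = 0"
    using e0 \<rho>1 L2_inner_add_left[OF LL(1) LL(2) one_L2] by (simp add: split)
  have \<theta>V: "\<theta> \<in> Vh0 \<Omega> T k"
    using V(1) LL(2) \<theta>1 by (simp add: Vh0_def L20_def integral_eq_L2_inner_1)

  \<comment> \<open>The factor 2 in R pays for the subtraction of the mean in the L^2 norm of
    \<rho>.\<close>
  define A B R S N where "A = ?n (grad \<Omega> \<theta>)" and "B = ?n (grad \<Omega> \<phi>)"
    and "R = 2 * Hk_norm 1 \<Omega> (\<lambda>x. c x - vs x)" and "S = Hk_norm 1 \<Omega> \<sigma>" and "N = ?n en"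
  define X where "X = R + S + N"
  have cvs: "(\<lambda>x. c x - vs x) \<in> Hk 1 \<Omega>" by (intro Hk_diff c H)
  have nn: "0 \<le> A" "0 \<le> B" "0 \<le> R" "0 \<le> S" "0 \<le> N"
    by (simp_all add: A_def B_def R_def S_def N_def Hk_norm_nonneg)
  have \<rho>R: "?n \<rho> \<le> R"
    using L2_norm_diff_mean_le[OF nonempty_domain Hk_imp_L2[OF cvs]] L2_norm_le_Hk_norm[OF cvs]
    by (simp add: \<rho>_def a_def R_def)
  have g\<rho>R: "?n (grad \<Omega> \<rho>) \<le> R"
    using grad_diff_const[OF cvs, of a] L2_norm_grad_le_Hk_norm[OF cvs] L2_norm_nonneg[of \<Omega> "grad \<Omega> (\<lambda>x. c x - vs x)"]
    unfolding \<rho>_def R_def by linarith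
  have \<sigma>S: "?n \<sigma> \<le> S" "?n (grad \<Omega> \<sigma>) \<le> S"
    using L2_norm_le_Hk_norm[OF HH(3)] L2_norm_grad_le_Hk_norm[OF HH(3)] by (simp_all add: S_def)
  have \<theta>A: "?n \<theta> \<le> P * A" using poincare[OF \<theta>V] by (simp add: A_def)
  have eRA: "?n e \<le> R + P * A"
    using L2_norm_triangle[OF LL(1) LL(2)] \<rho>R \<theta>A by (simp add: split)

  \<comment> \<open>The mean of \<phi> is not under control yet. As \<rho> - en is mean-free, only
    the mean-free part \<open>\<phi>'\<close> of \<phi> counts in their product, and Poincare's
    inequality bounds it by B.\<close>
  define b where "b = mean \<phi>"
  define \<phi>' where "\<phi>' = (\<lambda>x. \<phi> x - b)"
  have \<phi>'V: "\<phi>' \<in> Vh0 \<Omega> T k"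
    using diff_mean_L20[OF nonempty_domain LL(4)] lagrange_space_diff[OF V(2) lagrange_space_const[of b]]
    by (simp add: Vh0_def \<phi>'_def b_def)
  have \<phi>'L: "\<phi>' \<in> L2 \<Omega>" using \<phi>'V by (simp add: Vh0_def L20_def)
  have \<phi>'B: "?n \<phi>' \<le> P * B"
    using poincare[OF \<phi>'V] grad_diff_const[OF HH(4), of b] by (simp add: \<phi>'_def B_def)
  have \<rho>en: "(\<lambda>x. \<rho> x - en x) \<in> L2 \<Omega>" by (intro L2_diff LL en)
  have \<rho>en\<phi>: "?ip (\<lambda>x. \<rho> x - en x) \<phi> = ?ip (\<lambda>x. \<rho> x - en x) \<phi>'"
  proof -
    have "?ip (\<lambda>x. \<rho> x - en x) (\<lambda>_. b) = b * ?ip (\<lambda>x. \<rho> x - en x) (\<lambda>_. 1)"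
      using L2_inner_mult_right[of \<Omega> "\<lambda>x. \<rho> x - en x" b "\<lambda>_. 1"] by simp
    also have "\<dots> = 0" using L2_inner_diff_left[OF LL(1) en one_L2] \<rho>1 en0 by simp
    finally show ?thesis
      unfolding \<phi>'_def using L2_inner_diff_right[OF LL(4) L2_const[OF finite_measure_domain, of b] \<rho>en] by simp
  qed
  have t1: "\<bar>?ip (\<lambda>x. \<rho> x - en x) \<phi>\<bar> \<le> (R + N) * (P * B)"
  proof -
    have "\<bar>?ip (\<lambda>x. \<rho> x - en x) \<phi>'\<bar> \<le> ?n (\<lambda>x. \<rho> x - en x) * ?n \<phi>'"
      by (rule L2_inner_le_norm[OF \<rho>en \<phi>'L])
    also have "\<dots> \<le> (R + N) * (P * B)"
      using L2_norm_triangle_diff[OF LL(1) en] \<rho>R \<phi>'B nn by (intro mult_mono) (auto simp: N_def)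
    finally show ?thesis by (simp add: \<rho>en\<phi>)
  qed
  have t2: "\<bar>L2_inner \<Omega> (grad \<Omega> \<sigma>) (grad \<Omega> \<phi>)\<bar> \<le> S * B"
    using L2_inner_le_norm[OF GG(3) GG(4)] mult_right_mono[OF \<sigma>S(2) nn(2)] by (simp add: B_def)
  have t3: "\<bar>?ip \<sigma> \<theta>\<bar> \<le> S * (P * A)"
    using L2_inner_le_norm[OF LL(3) LL(2)] mult_mono[OF \<sigma>S(1) \<theta>A nn(4) L2_norm_nonneg] by linarith
  have t4: "\<bar>L2_inner \<Omega> (grad \<Omega> \<rho>) (grad \<Omega> \<theta>)\<bar> \<le> R * A"
    using L2_inner_le_norm[OF GG(1) GG(2)] mult_right_mono[OF g\<rho>R nn(1)] by (simp add: A_def)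
  \<comment> \<open>Monotonicity gives (dc, e) \<ge> 0, so -(dc, \<theta>) \<le> (dc, \<rho>), which
    contains the small factor \<rho>. The direct bound ||dc|| ||\<theta>|| would produce a multiple
    L P^2 of A^2, which \<epsilon>^2 A^2 need not absorb.\<close>
  have t5: "- ?ip dc \<theta> \<le> L * (R + P * A) * R"
  proof -
    have "?ip dc e = ?ip dc \<rho> + ?ip dc \<theta>"
      unfolding split(1) by (rule L2_inner_add_right[OF LL(1) LL(2) dcL])
    then have "- ?ip dc \<theta> \<le> \<bar>?ip dc \<rho>\<bar>" using mono by simp
    also have "\<dots> \<le> ?n dc * ?n \<rho>" by (rule L2_inner_le_norm[OF dcL LL(1)])
    also have "\<dots> \<le> L * (R + P * A) * R"
    proof (rule mult_mono[OF _ \<rho>R])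
      show "?n dc \<le> L * (R + P * A)"
        by (rule order_trans[OF dc_le mult_left_mono[OF eRA]]) (use pos(4) in simp)
      show "0 \<le> L * (R + P * A)" using pos nn by simp
    qed simp
    finally show ?thesis .
  qed
  have t6: "?ip de \<theta> \<le> L * N * (P * A)"
  proof -
    have "?ip de \<theta> \<le> ?n de * ?n \<theta>" using L2_inner_le_norm[OF deL LL(2)] by simp
    also have "\<dots> \<le> L * N * (P * A)"
      using de_le \<theta>A pos nn by (intro mult_mono) (auto simp: N_def)
    finally show ?thesis .
  qed

  have id1: "?ip \<theta> \<phi> = - ?ip (\<lambda>x. \<rho> x - en x) \<phi> - m * \<tau> * L2_inner \<Omega> (grad \<Omega> \<sigma>) (grad \<Omega> \<phi>) - m * \<tau> * B\<^sup>2"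
  proof -
    have "(\<lambda>x. e x - en x) = (\<lambda>x. (\<rho> x - en x) + \<theta> x)" by (simp add: split fun_eq_iff)
    then have "?ip (\<lambda>x. e x - en x) \<phi> = ?ip (\<lambda>x. \<rho> x - en x) \<phi> + ?ip \<theta> \<phi>"
      using L2_inner_add_left[OF \<rho>en LL(2) LL(4)] by simp
    moreover have "L2_inner \<Omega> (grad \<Omega> \<eta>) (grad \<Omega> \<phi>) = L2_inner \<Omega> (grad \<Omega> \<sigma>) (grad \<Omega> \<phi>) + B\<^sup>2"
      unfolding split(2) B_def L2_norm_power2 by (rule L2_inner_grad_add[OF HH(3) HH(4) GG(4)])
    ultimately show ?thesis using err1[OF V(2)] by (simp add: algebra_simps)
  qed
  have id2: "?ip \<theta> \<phi> = - ?ip \<sigma> \<theta> + \<epsilon>\<^sup>2 * L2_inner \<Omega> (grad \<Omega> \<rho>) (grad \<Omega> \<theta>) + \<epsilon>\<^sup>2 * A\<^sup>2 + ?ip dc \<theta> - ?ip de \<theta>"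
  proof -
    have "?ip \<eta> \<theta> = ?ip \<sigma> \<theta> + ?ip \<phi> \<theta>"
      unfolding split(2) by (rule L2_inner_add_left[OF LL(3) LL(4) LL(2)])
    moreover have "L2_inner \<Omega> (grad \<Omega> e) (grad \<Omega> \<theta>) = L2_inner \<Omega> (grad \<Omega> \<rho>) (grad \<Omega> \<theta>) + A\<^sup>2"
      unfolding split(1) A_def L2_norm_power2 by (rule L2_inner_grad_add[OF HH(1) HH(2) GG(2)])
    ultimately show ?thesis using err2[OF V(1)] L2_inner_commute[of \<Omega> \<theta> \<phi>] by (simp add: algebra_simps)
  qed
  have energy: "\<epsilon>\<^sup>2 * A\<^sup>2 + m * \<tau> * B\<^sup>2 \<le> (R + N) * (P * B) + m * \<tau> * (S * B) + S * (P * A) + \<epsilon>\<^sup>2 * (R * A)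
      + L * (R + P * A) * R + L * N * (P * A)"
  proof -
    have "- (m * \<tau> * L2_inner \<Omega> (grad \<Omega> \<sigma>) (grad \<Omega> \<phi>)) \<le> m * \<tau> * (S * B)"
      using mult_left_mono[of "- L2_inner \<Omega> (grad \<Omega> \<sigma>) (grad \<Omega> \<phi>)" "S * B" "m * \<tau>"] t2 pos by simp
    moreover have "- (\<epsilon>\<^sup>2 * L2_inner \<Omega> (grad \<Omega> \<rho>) (grad \<Omega> \<theta>)) \<le> \<epsilon>\<^sup>2 * (R * A)"
      using mult_left_mono[of "- L2_inner \<Omega> (grad \<Omega> \<rho>) (grad \<Omega> \<theta>)" "R * A" "\<epsilon>\<^sup>2"] t4 by simp
    ultimately show ?thesis
      using id1 id2 t1 t3 t5 t6 by linarith
  qed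
  define \<kappa> where "\<kappa> = min (\<epsilon>\<^sup>2) (m * \<tau>)"
  have \<kappa>: "\<kappa> > 0" "\<kappa> \<le> \<epsilon>\<^sup>2" "\<kappa> \<le> m * \<tau>" using pos by (auto simp: \<kappa>_def)
  have X: "R \<le> X" "S \<le> X" "N \<le> X" "R + N \<le> X" "0 \<le> X" using nn by (auto simp: X_def)
  have AB: "A + B \<le> C * X"
    unfolding C_def \<kappa>_def[symmetric]
  proof (rule quadratic_absorb[OF \<kappa>(1) _ X(5)])
    show "0 \<le> K" unfolding K_def using pos by (intro add_nonneg_nonneg) auto
    show "0 \<le> A + B" using nn by simp
    have "(A + B)\<^sup>2 \<le> 2 * (A\<^sup>2 + B\<^sup>2)"
      using sum_squares_bound[of A B] by (simp add: power2_sum)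
    then have "\<kappa> * (A + B)\<^sup>2 / 2 \<le> \<kappa> * (A\<^sup>2 + B\<^sup>2)" using \<kappa>(1) by simp
    also have "\<dots> \<le> \<epsilon>\<^sup>2 * A\<^sup>2 + m * \<tau> * B\<^sup>2"
      using \<kappa> by (simp add: distrib_left add_mono mult_right_mono)
    also note energy
    \<comment> \<open>This explains the five summands of K: P belongs to the L^2 coupling terms, m
      \<tau> and \<epsilon>^2 to the approximation errors of the gradients, L and L P to the
      nonlinearity.\<close>
    also have "(R + N) * (P * B) + m * \<tau> * (S * B) + S * (P * A) + \<epsilon>\<^sup>2 * (R * A) + L * (R + P * A) * R + L * N * (P * A)
      \<le> P * ((A + B) * X + X\<^sup>2) + m * \<tau> * ((A + B) * X + X\<^sup>2) + \<epsilon>\<^sup>2 * ((A + B) * X + X\<^sup>2)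
        + L * ((A + B) * X + X\<^sup>2) + L * P * ((A + B) * X + X\<^sup>2)"
    proof -
      have E: "(A + B) * X + X\<^sup>2 = X * A + X * B + X * X"
        by (simp add: power2_eq_square algebra_simps)
      have le: "(R + N) * B \<le> X * B" "S * A \<le> X * A" "S * B \<le> X * B" "R * A \<le> X * A" "(R + N) * A \<le> X * A"
        using X nn by (intro mult_right_mono; simp)+
      have "R * R \<le> X * X" using X nn by (intro mult_mono) auto
      moreover have "0 \<le> X * A" "0 \<le> X * B" "0 \<le> X * X" using X nn by auto
      ultimately have 1: "(R + N) * B + S * A \<le> (A + B) * X + X\<^sup>2"
        and 2: "S * B \<le> (A + B) * X + X\<^sup>2" "R * A \<le> (A + B) * X + X\<^sup>2" "R * R \<le> (A + B) * X + X\<^sup>2"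
        and 3: "(R + N) * A \<le> (A + B) * X + X\<^sup>2"
        unfolding E using le by linarith+
      have "P * ((R + N) * B + S * A) \<le> P * ((A + B) * X + X\<^sup>2)" using 1 pos by (intro mult_left_mono) auto
      moreover have "m * \<tau> * (S * B) \<le> m * \<tau> * ((A + B) * X + X\<^sup>2)" using 2 pos by (intro mult_left_mono) auto
      moreover have "\<epsilon>\<^sup>2 * (R * A) \<le> \<epsilon>\<^sup>2 * ((A + B) * X + X\<^sup>2)" using 2 by (intro mult_left_mono) auto
      moreover have "L * (R * R) \<le> L * ((A + B) * X + X\<^sup>2)" using 2 pos by (intro mult_left_mono) auto
      moreover have "L * P * ((R + N) * A) \<le> L * P * ((A + B) * X + X\<^sup>2)" using 3 pos by (intro mult_left_mono) auto
      ultimately show ?thesis by (simp add: algebra_simps)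
    qed
    also have "\<dots> = K * ((A + B) * X + X\<^sup>2)" by (simp add: K_def algebra_simps)
    finally show "\<kappa> * (A + B)\<^sup>2 / 2 \<le> K * ((A + B) * X + X\<^sup>2)" .
  qed
  have AC: "A \<le> C * X" and BC: "B \<le> C * X" using AB nn by auto

  have ne: "?n e \<le> (1 + P * C) * X"
  proof -
    have "P * A \<le> P * (C * X)" using AC pos by (intro mult_left_mono) auto
    then show ?thesis using eRA X(1) by (simp add: algebra_simps)
  qed
  \<comment> \<open>The inverse Laplacian w of e, tested with itself, gives ||\<nabla>w||^2 = (e, w)
    \<le> ||e|| P ||\<nabla>w||, and one factor ||\<nabla>w|| cancels.\<close>
  have dneg: "disc_neg_norm \<Omega> T k e \<le> P * ?n e"
  proof -
    let ?w = "disc_inv_laplace \<Omega> T k e"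
    note w = disc_inv_laplace[OF LL(5), where k=k]
    have wL: "?w \<in> L2 \<Omega>" using w(1) by (simp add: Vh0_def L20_def)
    have "(?n (grad \<Omega> ?w))\<^sup>2 = ?ip e ?w" using w(2)[OF w(1)] by (simp add: L2_norm_power2)
    also have "\<dots> \<le> ?n e * ?n ?w" using L2_inner_le_norm[OF LL(5) wL] by simp
    also have "\<dots> \<le> ?n e * (P * ?n (grad \<Omega> ?w))" by (intro mult_left_mono poincare w(1)) simp
    finally have "?n (grad \<Omega> ?w) * ?n (grad \<Omega> ?w) \<le> (P * ?n e) * ?n (grad \<Omega> ?w)"
      by (simp add: power2_eq_square mult_ac)
    then show ?thesis
      unfolding disc_neg_norm_def using pos(5)
      by (cases "?n (grad \<Omega> ?w) = 0") (auto simp: mult_le_cancel_right less_le)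
  qed
  have ge: "?n (grad \<Omega> e) \<le> R + A"
  proof -
    have "?n (grad \<Omega> e) = ?n (\<lambda>x. grad \<Omega> \<rho> x + grad \<Omega> \<theta> x)"
      unfolding split(1) by (rule L2_norm_cong_AE[OF grad_L2[OF Hk_add[OF HH(1) HH(2)]] L2_add[OF GG(1) GG(2)] grad_add_AE[OF HH(1) HH(2)]])
    also have "\<dots> \<le> ?n (grad \<Omega> \<rho>) + ?n (grad \<Omega> \<theta>)" by (rule L2_norm_triangle[OF GG(1) GG(2)])
    finally show ?thesis using g\<rho>R by (simp add: A_def)
  qed
  have He: "Hk_norm 1 \<Omega> e \<le> (2 + P * C + C) * X"
    using Hk_norm_le[OF HH(5)] ne ge AC X(1) by (simp add: algebra_simps)

  let ?w = "L2_norm \<Omega> (\<lambda>_. 1 :: real)"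
  have w: "?w > 0" by (rule domain_measure_pos[OF nonempty_domain])
  \<comment> \<open>The energy estimate controls only the gradient of \<phi>. Its mean follows from
    the potential equation tested with 1, where the gradient term vanishes.\<close>
  have mean\<phi>: "\<bar>b\<bar> * ?w \<le> L * ?n e + L * N + S"
  proof -
    have "?ip \<phi> (\<lambda>_. 1) = ?ip dc (\<lambda>_. 1) - ?ip de (\<lambda>_. 1) - ?ip \<sigma> (\<lambda>_. 1)"
      using err2[OF one] grad_one[OF GG(5)] L2_inner_add_left[OF LL(3) LL(4) one_L2] by (simp add: split(2))
    then have "\<bar>?ip \<phi> (\<lambda>_. 1)\<bar> \<le> ?n dc * ?w + ?n de * ?w + ?n \<sigma> * ?w"
      using L2_inner_le_norm[OF dcL one_L2] L2_inner_le_norm[OF deL one_L2] L2_inner_le_norm[OF LL(3) one_L2] by linarith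
    also have "\<dots> \<le> (L * ?n e) * ?w + (L * N) * ?w + S * ?w"
      using dc_le de_le \<sigma>S(1) w by (intro add_mono mult_right_mono) (auto simp: N_def)
    also have "\<dots> = (L * ?n e + L * N + S) * ?w" by (simp add: algebra_simps)
    finally show ?thesis
      using abs_mean[OF nonempty_domain LL(4)] w by (simp add: b_def divide_le_eq)
  qed
  have n\<phi>: "?n \<phi> \<le> P * B + L * ?n e + L * N + S"
  proof -
    have "?n \<phi> = ?n (\<lambda>x. \<phi>' x + b)" by (simp add: \<phi>'_def)
    also have "\<dots> \<le> ?n \<phi>' + ?n (\<lambda>_. b)" by (rule L2_norm_triangle[OF \<phi>'L L2_const[OF finite_measure_domain]])
    also have "?n (\<lambda>_. b) = \<bar>b\<bar> * ?w" by (rule L2_norm_const)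
    finally show ?thesis using \<phi>'B mean\<phi> by simp
  qed
  have H\<eta>: "Hk_norm 1 \<Omega> \<eta> \<le> S + (?n \<phi> + B)"
    using Hk_norm_add[OF HH(3) HH(4)] Hk_norm_le[OF HH(4)] by (simp add: split(2) S_def B_def)
  have "Hk_norm 1 \<Omega> \<eta> \<le> (2 + P * C + C + 2 * L + L * P * C) * X"
  proof -
    have "L * ?n e \<le> L * ((1 + P * C) * X)" using ne pos by (intro mult_left_mono) auto
    moreover have "L * N \<le> L * X" using X pos by (intro mult_left_mono) auto
    moreover have "P * B \<le> P * (C * X)" using BC pos by (intro mult_left_mono) auto
    ultimately show ?thesis using H\<eta> n\<phi> X(2) BC by (simp add: algebra_simps)
  qed
  moreover have "disc_neg_norm \<Omega> T k e \<le> P * ((1 + P * C) * X)"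
    by (rule order_trans[OF dneg mult_left_mono[OF ne]]) (use pos in simp)
  ultimately have "disc_neg_norm \<Omega> T k e + Hk_norm 1 \<Omega> e + Hk_norm 1 \<Omega> \<eta>
    \<le> P * ((1 + P * C) * X) + (2 + P * C + C) * X + (2 + P * C + C + 2 * L + L * P * C) * X"
    using He by simp
  also have "\<dots> \<le> (4 + 2 * P * C + P + P * P * C + 2 * C + 2 * L + L * P * C) * X"
    by (simp add: algebra_simps)
  finally show ?thesis by (simp add: X_def R_def S_def N_def e_def \<eta>_def \<sigma>_def en_def)
qed

end

section \<open>The auxiliary problem\<close>

text \<open>The pointwise counterpart of \<open>sym_grad\<close>: identities are proved for single
  matrices and integrated afterwards.\<close>

definition sym_part :: "real^2^2 \<Rightarrow> real^2^2" where
  "sym_part J = (1/2) *\<^sub>R (J + transpose J)"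

lemma sym_part_diff: "sym_part (J - K) = sym_part J - sym_part K"
  by (simp add: sym_part_def vec_eq_iff transpose_def field_simps)

lemma trace_2: "trace (J :: real^2^2) = J $ 1 $ 1 + J $ 2 $ 2"
  by (simp add: trace_def sum_2)

text \<open>The subtracted term is the determinant of J. For the Jacobian of a field with components
  in \<open>H10 \<Omega>\<close> its integral vanishes by the curl identity.\<close>

lemma sym_part_inner:
  "sym_part J \<bullet> sym_part J = (1/2) * (J \<bullet> J) + (1/2) * (trace J)\<^sup>2 - (J $ 1) \<bullet> rot (J $ 2)"
  unfolding inner_rot trace_2
  by (simp add: sym_part_def inner_vec_def sum_2 transpose_def power2_eq_square field_simps)

lemma sym_grad_eq: "sym_grad \<Omega> u x = sym_part (jacobian \<Omega> u x)"
  by (simp add: sym_grad_def sym_part_def)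

lemma divergence_eq: "divergence \<Omega> u x = trace (jacobian \<Omega> u x)"
  by (simp add: divergence_def trace_def jacobian_def)

text \<open>The form equals a^2 + (a - b)^2 and is positive definite; it dominates (a + b)^2 / 8,
  and one factor a + b cancels.\<close>

lemma quadratic_form_bound:
  fixes a b Y :: real
  assumes "0 \<le> a" "0 \<le> b" "0 \<le> Y" "2 * a\<^sup>2 - 2 * a * b + b\<^sup>2 \<le> (a + b) * Y"
  shows "a + b \<le> 8 * Y"
proof (cases "a + b = 0")
  case True
  with assms(3) show ?thesis by simp
next
  case False
  \<comment> \<open>Completing the square: 7 (8 (2 a^2 - 2 a b + b^2) - (a + b)^2) = (7 b - 9 a)^2 +
    24 a^2.\<close>
  have "0 \<le> (7 * b - 9 * a)\<^sup>2 + 24 * a\<^sup>2" by simp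
  then have "(a + b) * (a + b) \<le> 8 * (2 * a\<^sup>2 - 2 * a * b + b\<^sup>2)"
    by (simp add: power2_eq_square algebra_simps)
  with assms(4) have "(a + b) * (a + b) \<le> (a + b) * (8 * Y)" by simp
  then show ?thesis using False assms(1,2) by (simp add: mult_le_cancel_left)
qed

context bounded_domain
begin

section \<open>Korn's identity and its consequences\<close>

lemma jacobian_L2:
  assumes "u \<in> vec_space (Hk 1 \<Omega>)" shows "jacobian \<Omega> u \<in> L2 \<Omega>"
  unfolding L2_vec_iff[of "jacobian \<Omega> u"] using assms by (simp add: jacobian_def grad_L2 vec_space_def)

lemma matrix_entry_L2: "J \<in> L2 \<Omega> \<Longrightarrow> (\<lambda>x. (J x :: real^2^2) $ i $ j) \<in> L2 \<Omega>"
  using L2_vec_iff[of J \<Omega>] L2_vec_iff[of "\<lambda>x. J x $ i" \<Omega>] by blast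

lemma trace_L2:
  assumes "J \<in> L2 \<Omega>" shows "(\<lambda>x. trace (J x :: real^2^2)) \<in> L2 \<Omega>"
  unfolding trace_2 by (intro L2_add matrix_entry_L2 assms)

lemma sym_part_L2:
  assumes "J \<in> L2 \<Omega>" shows "(\<lambda>x. sym_part (J x)) \<in> L2 \<Omega>"
proof -
  have "(\<lambda>x. sym_part (J x) $ i $ j) \<in> L2 \<Omega>" for i j
    using L2_mult[OF L2_add[OF matrix_entry_L2[OF assms, of i j] matrix_entry_L2[OF assms, of j i]], of "1/2"]
    by (simp add: sym_part_def transpose_def)
  then have "(\<lambda>x. sym_part (J x) $ i) \<in> L2 \<Omega>" for i
    using L2_vec_iff[of "\<lambda>x. sym_part (J x) $ i"] by blast
  then show ?thesis using L2_vec_iff[of "\<lambda>x. sym_part (J x)"] by blast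
qed

lemma sym_grad_L2:
  assumes "u \<in> vec_space (Hk 1 \<Omega>)" shows "sym_grad \<Omega> u \<in> L2 \<Omega>"
  using sym_part_L2[OF jacobian_L2[OF assms]] by (simp add: sym_grad_eq[abs_def])

lemma divergence_L2:
  assumes "u \<in> vec_space (Hk 1 \<Omega>)" shows "divergence \<Omega> u \<in> L2 \<Omega>"
  using trace_L2[OF jacobian_L2[OF assms]] by (simp add: divergence_eq[abs_def])

lemma jacobian_diff_AE:
  assumes "u \<in> vec_space (Hk 1 \<Omega>)" "v \<in> vec_space (Hk 1 \<Omega>)"
  shows "AE x in lebesgue_on \<Omega>. jacobian \<Omega> (\<lambda>x. u x - v x) x = jacobian \<Omega> u x - jacobian \<Omega> v x"
proof -
  have "AE x in lebesgue_on \<Omega>. \<forall>i\<in>UNIV.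
      grad \<Omega> (\<lambda>y. u y $ i - v y $ i) x = grad \<Omega> (\<lambda>y. u y $ i) x - grad \<Omega> (\<lambda>y. v y $ i) x"
    using assms by (intro AE_finite_allI grad_diff_AE) (auto simp: vec_space_def)
  then show ?thesis by eventually_elim (simp add: jacobian_def vec_eq_iff)
qed

lemma vec_space_H1_diff:
  assumes "u \<in> vec_space (Hk 1 \<Omega>)" "v \<in> vec_space (Hk 1 \<Omega>)"
  shows "(\<lambda>x. u x - v x) \<in> vec_space (Hk 1 \<Omega>)"
  using assms by (auto simp: vec_space_def intro: Hk_diff)

lemma
  assumes "u \<in> vec_space (Hk 1 \<Omega>)" "v \<in> vec_space (Hk 1 \<Omega>)"
  shows L2_inner_sym_grad_diff: "g \<in> L2 \<Omega> \<Longrightarrow> L2_inner \<Omega> (sym_grad \<Omega> (\<lambda>x. u x - v x)) g =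
      L2_inner \<Omega> (sym_grad \<Omega> u) g - L2_inner \<Omega> (sym_grad \<Omega> v) g"
    and L2_inner_divergence_diff: "q \<in> L2 \<Omega> \<Longrightarrow> L2_inner \<Omega> (divergence \<Omega> (\<lambda>x. u x - v x)) q =
      L2_inner \<Omega> (divergence \<Omega> u) q - L2_inner \<Omega> (divergence \<Omega> v) q"
    and L2_norm_jacobian_diff: "L2_norm \<Omega> (jacobian \<Omega> (\<lambda>x. u x - v x)) \<le>
      L2_norm \<Omega> (jacobian \<Omega> u) + L2_norm \<Omega> (jacobian \<Omega> v)"
proof -
  note d = vec_space_H1_diff[OF assms]
  have "AE x in lebesgue_on \<Omega>. sym_grad \<Omega> (\<lambda>x. u x - v x) x = sym_grad \<Omega> u x - sym_grad \<Omega> v x"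
    using jacobian_diff_AE[OF assms] by eventually_elim (simp add: sym_grad_eq sym_part_diff)
  then show "L2_inner \<Omega> (sym_grad \<Omega> (\<lambda>x. u x - v x)) g =
      L2_inner \<Omega> (sym_grad \<Omega> u) g - L2_inner \<Omega> (sym_grad \<Omega> v) g" if "g \<in> L2 \<Omega>"
    using L2_inner_cong_AE[OF sym_grad_L2[OF d] L2_diff[OF sym_grad_L2[OF assms(1)] sym_grad_L2[OF assms(2)]] that]
      L2_inner_diff_left[OF sym_grad_L2[OF assms(1)] sym_grad_L2[OF assms(2)] that] by simp
  have "AE x in lebesgue_on \<Omega>. divergence \<Omega> (\<lambda>x. u x - v x) x = divergence \<Omega> u x - divergence \<Omega> v x"
    using jacobian_diff_AE[OF assms] by eventually_elim (simp add: divergence_eq trace_2)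
  then show "L2_inner \<Omega> (divergence \<Omega> (\<lambda>x. u x - v x)) q =
      L2_inner \<Omega> (divergence \<Omega> u) q - L2_inner \<Omega> (divergence \<Omega> v) q" if "q \<in> L2 \<Omega>"
    using L2_inner_cong_AE[OF divergence_L2[OF d] L2_diff[OF divergence_L2[OF assms(1)] divergence_L2[OF assms(2)]] that]
      L2_inner_diff_left[OF divergence_L2[OF assms(1)] divergence_L2[OF assms(2)] that] by simp
  have "L2_norm \<Omega> (jacobian \<Omega> (\<lambda>x. u x - v x)) = L2_norm \<Omega> (\<lambda>x. jacobian \<Omega> u x - jacobian \<Omega> v x)"
    by (rule L2_norm_cong_AE[OF jacobian_L2[OF d] L2_diff[OF jacobian_L2[OF assms(1)] jacobian_L2[OF assms(2)]]
          jacobian_diff_AE[OF assms]])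
  also have "\<dots> \<le> L2_norm \<Omega> (jacobian \<Omega> u) + L2_norm \<Omega> (jacobian \<Omega> v)"
    by (intro L2_norm_triangle_diff jacobian_L2 assms)
  finally show "L2_norm \<Omega> (jacobian \<Omega> (\<lambda>x. u x - v x)) \<le>
      L2_norm \<Omega> (jacobian \<Omega> u) + L2_norm \<Omega> (jacobian \<Omega> v)" .
qed

text \<open>The curl identity removes \<open>\<partial>\<^sub>1 z\<^sub>1 \<partial>\<^sub>2 z\<^sub>2 - \<partial>\<^sub>2 z\<^sub>1 \<partial>\<^sub>1 z\<^sub>2\<close>, which makes the factor
  in \<open>\<parallel>div z\<parallel> \<le> \<parallel>Dz\<parallel>\<close> equal to one. The pointwise bound has the factor \<open>\<surd>2\<close>, for which
  the quadratic form of the auxiliary problem degenerates.\<close>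

lemma korn_identity:
  assumes "z \<in> vec_space (H10 \<Omega>)"
  shows "(L2_norm \<Omega> (sym_grad \<Omega> z))\<^sup>2 =
    (1/2) * (L2_norm \<Omega> (jacobian \<Omega> z))\<^sup>2 + (1/2) * (L2_norm \<Omega> (divergence \<Omega> z))\<^sup>2"
proof -
  have z: "z \<in> vec_space (Hk 1 \<Omega>)" using assms H10_H1 by (auto simp: vec_space_def)
  let ?g = "\<lambda>i. grad \<Omega> (\<lambda>y. z y $ i)"
  have g: "?g i \<in> L2 \<Omega>" for i using z by (simp add: grad_L2 vec_space_def)
  have "(L2_norm \<Omega> (sym_grad \<Omega> z))\<^sup>2 = (LINT x|lebesgue_on \<Omega>. (1/2) * (jacobian \<Omega> z x \<bullet> jacobian \<Omega> z x)
      + (1/2) * (divergence \<Omega> z x \<bullet> divergence \<Omega> z x) - ?g 1 x \<bullet> rot (?g 2 x))"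
    unfolding L2_norm_power2 L2_inner_def
    by (intro Bochner_Integration.integral_cong refl)
       (simp add: sym_grad_eq sym_part_inner divergence_eq power2_eq_square, simp add: jacobian_def)
  also have "\<dots> = (1/2) * L2_inner \<Omega> (jacobian \<Omega> z) (jacobian \<Omega> z) + (1/2) * L2_inner \<Omega> (divergence \<Omega> z) (divergence \<Omega> z)
      - L2_inner \<Omega> (?g 1) (\<lambda>x. rot (?g 2 x))"
    using L2_integrable_inner[OF jacobian_L2[OF z] jacobian_L2[OF z]]
      L2_integrable_inner[OF divergence_L2[OF z] divergence_L2[OF z]]
      L2_integrable_inner[OF g rot_L2[OF g], of 1 2]
    by (simp add: L2_inner_def)
  also have "L2_inner \<Omega> (?g 1) (\<lambda>x. rot (?g 2 x)) = 0"
    using assms by (intro H10_curl_identity) (auto simp: vec_space_def)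
  finally show ?thesis by (simp add: L2_norm_power2)
qed

text \<open>Pointwise |J|^2 - (tr J)^2 + 2 det J is the square of J12 - J21, and the determinant
  integrates to 0, so ||div z|| \<le> ||\<nabla>z||. By Korn's identity ||Dz||^2 is the average of
  the two squares and lies between them. In the third bound the factor 2 stands for the root of
  2.\<close>

lemma
  assumes "z \<in> vec_space (H10 \<Omega>)"
  shows divergence_le_sym_grad: "L2_norm \<Omega> (divergence \<Omega> z) \<le> L2_norm \<Omega> (sym_grad \<Omega> z)"
    and sym_grad_le_jacobian: "L2_norm \<Omega> (sym_grad \<Omega> z) \<le> L2_norm \<Omega> (jacobian \<Omega> z)"
    and jacobian_le_sym_grad: "L2_norm \<Omega> (jacobian \<Omega> z) \<le> 2 * L2_norm \<Omega> (sym_grad \<Omega> z)"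
proof -
  have z: "z \<in> vec_space (Hk 1 \<Omega>)" using assms H10_H1 by (auto simp: vec_space_def)
  note korn = korn_identity[OF assms]
  have tr: "(L2_norm \<Omega> (divergence \<Omega> z))\<^sup>2 \<le> (L2_norm \<Omega> (jacobian \<Omega> z))\<^sup>2"
  proof -
    let ?g = "\<lambda>i. grad \<Omega> (\<lambda>y. z y $ i)"
    have g: "?g i \<in> L2 \<Omega>" for i using z by (simp add: grad_L2 vec_space_def)
    have "0 \<le> (LINT x|lebesgue_on \<Omega>. (jacobian \<Omega> z x $ 1 $ 2 - jacobian \<Omega> z x $ 2 $ 1)\<^sup>2)" by simp
    also have "\<dots> = (LINT x|lebesgue_on \<Omega>. jacobian \<Omega> z x \<bullet> jacobian \<Omega> z x - divergence \<Omega> z x \<bullet> divergence \<Omega> z x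
        + 2 * (?g 1 x \<bullet> rot (?g 2 x)))"
      by (intro Bochner_Integration.integral_cong refl)
         (simp add: divergence_eq trace_2 inner_vec_def sum_2 jacobian_def rot_def power2_eq_square algebra_simps)
    also have "\<dots> = L2_inner \<Omega> (jacobian \<Omega> z) (jacobian \<Omega> z) - L2_inner \<Omega> (divergence \<Omega> z) (divergence \<Omega> z)
        + 2 * L2_inner \<Omega> (?g 1) (\<lambda>x. rot (?g 2 x))"
      using L2_integrable_inner[OF jacobian_L2[OF z] jacobian_L2[OF z]]
        L2_integrable_inner[OF divergence_L2[OF z] divergence_L2[OF z]]
        L2_integrable_inner[OF g rot_L2[OF g], of 1 2]
      by (simp add: L2_inner_def)
    also have "L2_inner \<Omega> (?g 1) (\<lambda>x. rot (?g 2 x)) = 0"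
      using assms by (intro H10_curl_identity) (auto simp: vec_space_def)
    finally show ?thesis by (simp add: L2_norm_power2)
  qed
  show "L2_norm \<Omega> (divergence \<Omega> z) \<le> L2_norm \<Omega> (sym_grad \<Omega> z)"
  proof (rule power2_le_imp_le)
    show "(L2_norm \<Omega> (divergence \<Omega> z))\<^sup>2 \<le> (L2_norm \<Omega> (sym_grad \<Omega> z))\<^sup>2" using korn tr by linarith
  qed simp
  show "L2_norm \<Omega> (sym_grad \<Omega> z) \<le> L2_norm \<Omega> (jacobian \<Omega> z)"
  proof (rule power2_le_imp_le)
    show "(L2_norm \<Omega> (sym_grad \<Omega> z))\<^sup>2 \<le> (L2_norm \<Omega> (jacobian \<Omega> z))\<^sup>2" using korn tr by linarith
  qed simp
  show "L2_norm \<Omega> (jacobian \<Omega> z) \<le> 2 * L2_norm \<Omega> (sym_grad \<Omega> z)"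
  proof (rule power2_le_imp_le)
    show "(L2_norm \<Omega> (jacobian \<Omega> z))\<^sup>2 \<le> (2 * L2_norm \<Omega> (sym_grad \<Omega> z))\<^sup>2"
      unfolding power_mult_distrib korn by simp
  qed simp
qed

lemma Hk_norm_vec_eq:
  assumes "z \<in> vec_space (Hk 1 \<Omega>)"
  shows "(Hk_norm_vec 1 \<Omega> z)\<^sup>2 = (\<Sum>i\<in>UNIV. (L2_norm \<Omega> (\<lambda>x. z x $ i))\<^sup>2) + (L2_norm \<Omega> (jacobian \<Omega> z))\<^sup>2"
proof -
  have "(L2_norm \<Omega> (jacobian \<Omega> z))\<^sup>2 = (\<Sum>i\<in>UNIV. (L2_norm \<Omega> (grad \<Omega> (\<lambda>y. z y $ i)))\<^sup>2)"
    using L2_inner_vec[OF jacobian_L2[OF assms] jacobian_L2[OF assms]] by (simp add: L2_norm_power2 jacobian_def)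
  moreover have "(Hk_norm_vec 1 \<Omega> z)\<^sup>2 = (\<Sum>i\<in>UNIV. (Hk_norm 1 \<Omega> (\<lambda>x. z x $ i))\<^sup>2)"
    by (simp add: Hk_norm_vec_def sum_nonneg)
  moreover have "(Hk_norm 1 \<Omega> (\<lambda>x. z x $ i))\<^sup>2 = (L2_norm \<Omega> (\<lambda>x. z x $ i))\<^sup>2 + (L2_norm \<Omega> (grad \<Omega> (\<lambda>y. z y $ i)))\<^sup>2" for i
    using assms by (simp add: vec_space_def Hk_norm_1)
  ultimately show ?thesis by (simp add: sum.distrib)
qed

lemma L2_norm_jacobian_le:
  assumes "z \<in> vec_space (Hk 1 \<Omega>)"
  shows "L2_norm \<Omega> (jacobian \<Omega> z) \<le> Hk_norm_vec 1 \<Omega> z"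
proof (rule power2_le_imp_le)
  show "(L2_norm \<Omega> (jacobian \<Omega> z))\<^sup>2 \<le> (Hk_norm_vec 1 \<Omega> z)\<^sup>2"
    unfolding Hk_norm_vec_eq[OF assms] by (simp add: sum_nonneg)
  show "0 \<le> Hk_norm_vec 1 \<Omega> z" by (simp add: Hk_norm_vec_def sum_nonneg)
qed

text \<open>Friedrichs' inequality for each component; the estimate C^2 + 1 \<le> (C + 1)^2 removes
  the root.\<close>

lemma Hk_norm_vec_le:
  assumes "z \<in> vec_space (H10 \<Omega>)" "C > 0"
    and C: "\<And>u. u \<in> H10 \<Omega> \<Longrightarrow> L2_norm \<Omega> u \<le> C * L2_norm \<Omega> (grad \<Omega> u)"
  shows "Hk_norm_vec 1 \<Omega> z \<le> (C + 1) * L2_norm \<Omega> (jacobian \<Omega> z)"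
proof (rule power2_le_imp_le)
  have z: "z \<in> vec_space (Hk 1 \<Omega>)" using assms(1) H10_H1 by (auto simp: vec_space_def)
  have J: "(L2_norm \<Omega> (jacobian \<Omega> z))\<^sup>2 = (\<Sum>i\<in>UNIV. (L2_norm \<Omega> (grad \<Omega> (\<lambda>y. z y $ i)))\<^sup>2)"
    using L2_inner_vec[OF jacobian_L2[OF z] jacobian_L2[OF z]] by (simp add: L2_norm_power2 jacobian_def)
  have "(L2_norm \<Omega> (\<lambda>x. z x $ i))\<^sup>2 \<le> C\<^sup>2 * (L2_norm \<Omega> (grad \<Omega> (\<lambda>y. z y $ i)))\<^sup>2" for i
    using power_mono[OF C[of "\<lambda>x. z x $ i"] L2_norm_nonneg, of 2] assms(1)
    by (simp add: vec_space_def power_mult_distrib)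
  then have "(\<Sum>i\<in>UNIV. (L2_norm \<Omega> (\<lambda>x. z x $ i))\<^sup>2) \<le> C\<^sup>2 * (L2_norm \<Omega> (jacobian \<Omega> z))\<^sup>2"
    unfolding J sum_distrib_left by (intro sum_mono)
  then have "(Hk_norm_vec 1 \<Omega> z)\<^sup>2 \<le> (C\<^sup>2 + 1) * (L2_norm \<Omega> (jacobian \<Omega> z))\<^sup>2"
    unfolding Hk_norm_vec_eq[OF z] by (simp add: distrib_right)
  also have "\<dots> \<le> (C + 1)\<^sup>2 * (L2_norm \<Omega> (jacobian \<Omega> z))\<^sup>2"
    using assms(2) by (intro mult_right_mono) (auto simp: power2_eq_square algebra_simps)
  finally show "(Hk_norm_vec 1 \<Omega> z)\<^sup>2 \<le> ((C + 1) * L2_norm \<Omega> (jacobian \<Omega> z))\<^sup>2"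
    by (simp add: power_mult_distrib)
  show "0 \<le> (C + 1) * L2_norm \<Omega> (jacobian \<Omega> z)" using assms(2) by simp
qed

end

section \<open>Error estimate for the auxiliary problem\<close>

lemma auxiliary_pairD:
  assumes "auxiliary_pair \<Omega> Q U r p u"
  shows "p \<in> Q" "u \<in> U"
    "\<And>q. q \<in> Q \<Longrightarrow> L2_inner \<Omega> (\<lambda>x. 2 * p x + divergence \<Omega> u x) q = L2_inner \<Omega> r q"
    "\<And>z. z \<in> U \<Longrightarrow> L2_inner \<Omega> (sym_grad \<Omega> u) (sym_grad \<Omega> z) + L2_inner \<Omega> p (divergence \<Omega> z) = 0"
  using assms by (simp_all add: auxiliary_pair_def)

context bounded_domain
begin

lemma vec_space_H10_diff:
  assumes "u \<in> vec_space (H10 \<Omega>)" "v \<in> vec_space (H10 \<Omega>)"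
  shows "(\<lambda>x. u x - v x) \<in> vec_space (H10 \<Omega>)"
  using assms by (auto simp: vec_space_def intro: H10_diff)

lemma Uh_diff:
  assumes "u \<in> Uh \<Omega> T k" "v \<in> Uh \<Omega> T k"
  shows "(\<lambda>x. u x - v x) \<in> Uh \<Omega> T k"
  using assms by (auto simp: Uh_def vec_space_def intro: H10_diff lagrange_space_diff)

lemma Uh_H10: "Uh \<Omega> T k \<subseteq> vec_space (H10 \<Omega>)"
  by (auto simp: Uh_def vec_space_def)

lemma vec_space_H10_H1: "vec_space (H10 \<Omega>) \<subseteq> vec_space (Hk 1 \<Omega>)"
  using H10_H1 by (auto simp: vec_space_def)

lemma laplace_L2:
  assumes "c \<in> Hk 2 \<Omega>" shows "laplace \<Omega> c \<in> L2 \<Omega>"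
  unfolding laplace_def[abs_def]
  by (intro L2_sum weak_deriv_L2[OF assms]) (simp_all add: mi_order_single)

text \<open>The equations are tested with the discrete errors \<theta> and \<zeta>. The term
  (\<theta>, div \<zeta>) occurs in both with the same sign, so their sum is 2 ||\<theta>||^2 +
  ||D\<zeta>||^2 + 2 (\<theta>, div \<zeta>), and ||div \<zeta>|| \<le> ||D\<zeta>|| reduces it to
  the form of \<open>quadratic_form_bound\<close>. The only deviation from Galerkin orthogonality is
  the difference of the right-hand sides.\<close>

lemma auxiliary_estimate:
  assumes F: "F > 0" "\<And>u. u \<in> H10 \<Omega> \<Longrightarrow> L2_norm \<Omega> u \<le> F * L2_norm \<Omega> (grad \<Omega> u)"
    and aux: "auxiliary_pair \<Omega> (L20 \<Omega>) (vec_space (H10 \<Omega>)) r p u"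
    and auxh: "auxiliary_pair \<Omega> (Vh0 \<Omega> T kp) (Uh \<Omega> T ku) rh ph uh"
    and r: "r \<in> L2 \<Omega>" and rh: "rh \<in> Vh0 \<Omega> T kp"
    and qh: "qh \<in> Vh0 \<Omega> T kp" and zh: "zh \<in> Uh \<Omega> T ku"
  shows "L2_norm \<Omega> (\<lambda>x. p x - ph x) + Hk_norm_vec 1 \<Omega> (\<lambda>x. u x - uh x) \<le>
    33 * (F + 1) * (L2_norm \<Omega> (\<lambda>x. p x - qh x) + Hk_norm_vec 1 \<Omega> (\<lambda>x. u x - zh x) + L2_norm \<Omega> (\<lambda>x. r x - rh x))"
proof -
  let ?n = "L2_norm \<Omega>" and ?ip = "L2_inner \<Omega>"
  note eq = auxiliary_pairD[OF aux] and eqh = auxiliary_pairD[OF auxh]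
  have VL: "v \<in> L20 \<Omega>" "v \<in> L2 \<Omega>" if "v \<in> Vh0 \<Omega> T kp" for v
    using that by (auto simp: Vh0_def L20_def)
  have p: "p \<in> L2 \<Omega>" using eq(1) by (simp add: L20_def)
  have uh: "uh \<in> vec_space (H10 \<Omega>)" and zh': "zh \<in> vec_space (H10 \<Omega>)" using eqh(2) zh Uh_H10 by auto
  define \<theta> where "\<theta> = (\<lambda>x. ph x - qh x)"
  define \<zeta> where "\<zeta> = (\<lambda>x. uh x - zh x)"
  define \<alpha> where "\<alpha> = (\<lambda>x. p x - qh x)"
  define \<beta> where "\<beta> = (\<lambda>x. u x - zh x)"
  define \<rho> where "\<rho> = (\<lambda>x. r x - rh x)"
  have \<theta>: "\<theta> \<in> Vh0 \<Omega> T kp" unfolding \<theta>_def by (rule Vh0_diff[OF eqh(1) qh])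
  have \<zeta>: "\<zeta> \<in> Uh \<Omega> T ku" unfolding \<zeta>_def by (rule Uh_diff[OF eqh(2) zh])
  have \<zeta>0: "\<zeta> \<in> vec_space (H10 \<Omega>)" using \<zeta> Uh_H10 by auto
  have \<beta>0: "\<beta> \<in> vec_space (H10 \<Omega>)" unfolding \<beta>_def by (rule vec_space_H10_diff[OF eq(2) zh'])
  have H1: "u \<in> vec_space (Hk 1 \<Omega>)" "uh \<in> vec_space (Hk 1 \<Omega>)" "zh \<in> vec_space (Hk 1 \<Omega>)"
    "\<zeta> \<in> vec_space (Hk 1 \<Omega>)" "\<beta> \<in> vec_space (Hk 1 \<Omega>)"
    using eq(2) uh zh' \<zeta>0 \<beta>0 vec_space_H10_H1 by blast+
  note D = H1[THEN sym_grad_L2] and V = H1[THEN divergence_L2]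
  have \<theta>L: "\<theta> \<in> L2 \<Omega>" and phL: "ph \<in> L2 \<Omega>" and qhL: "qh \<in> L2 \<Omega>" and rhL: "rh \<in> L2 \<Omega>"
    using VL \<theta> eqh(1) qh rh by blast+
  have \<alpha>L: "\<alpha> \<in> L2 \<Omega>" and \<rho>L: "\<rho> \<in> L2 \<Omega>"
    unfolding \<alpha>_def \<rho>_def by (intro L2_diff p qhL r rhL)+
  \<comment> \<open>Both problems can be tested with \<theta>, since discrete pressures are
    mean-free and square-integrable.\<close>
  have i1: "2 * ?ip \<theta> \<theta> + ?ip (divergence \<Omega> \<zeta>) \<theta> = 2 * ?ip \<alpha> \<theta> + ?ip (divergence \<Omega> \<beta>) \<theta> - ?ip \<rho> \<theta>"
  proof -
    have "2 * ?ip p \<theta> + ?ip (divergence \<Omega> u) \<theta> = ?ip r \<theta>"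
      using eq(3)[OF VL(1)[OF \<theta>]] L2_inner_add_left[OF L2_mult[OF p, of 2] V(1) \<theta>L] by (simp add: L2_inner_mult_left)
    moreover have "2 * ?ip ph \<theta> + ?ip (divergence \<Omega> uh) \<theta> = ?ip rh \<theta>"
      using eqh(3)[OF \<theta>] L2_inner_add_left[OF L2_mult[OF phL, of 2] V(2) \<theta>L] by (simp add: L2_inner_mult_left)
    moreover have "?ip \<theta> \<theta> = ?ip ph \<theta> - ?ip qh \<theta>"
      using L2_inner_diff_left[OF phL qhL \<theta>L] by (simp add: \<theta>_def)
    moreover have "?ip \<alpha> \<theta> = ?ip p \<theta> - ?ip qh \<theta>"
      unfolding \<alpha>_def by (rule L2_inner_diff_left[OF p qhL \<theta>L])
    moreover have "?ip \<rho> \<theta> = ?ip r \<theta> - ?ip rh \<theta>"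
      unfolding \<rho>_def by (rule L2_inner_diff_left[OF r rhL \<theta>L])
    moreover have "?ip (divergence \<Omega> \<zeta>) \<theta> = ?ip (divergence \<Omega> uh) \<theta> - ?ip (divergence \<Omega> zh) \<theta>"
      unfolding \<zeta>_def by (rule L2_inner_divergence_diff[OF H1(2,3) \<theta>L])
    moreover have "?ip (divergence \<Omega> \<beta>) \<theta> = ?ip (divergence \<Omega> u) \<theta> - ?ip (divergence \<Omega> zh) \<theta>"
      unfolding \<beta>_def by (rule L2_inner_divergence_diff[OF H1(1,3) \<theta>L])
    ultimately show ?thesis by linarith
  qed
  have i2: "L2_inner \<Omega> (sym_grad \<Omega> \<zeta>) (sym_grad \<Omega> \<zeta>) + ?ip \<theta> (divergence \<Omega> \<zeta>) =
      L2_inner \<Omega> (sym_grad \<Omega> \<beta>) (sym_grad \<Omega> \<zeta>) + ?ip \<alpha> (divergence \<Omega> \<zeta>)"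
  proof -
    have "L2_inner \<Omega> (sym_grad \<Omega> u) (sym_grad \<Omega> \<zeta>) + ?ip p (divergence \<Omega> \<zeta>) = 0" by (rule eq(4)[OF \<zeta>0])
    moreover have "L2_inner \<Omega> (sym_grad \<Omega> uh) (sym_grad \<Omega> \<zeta>) + ?ip ph (divergence \<Omega> \<zeta>) = 0" by (rule eqh(4)[OF \<zeta>])
    moreover have "?ip \<theta> (divergence \<Omega> \<zeta>) = ?ip ph (divergence \<Omega> \<zeta>) - ?ip qh (divergence \<Omega> \<zeta>)"
      unfolding \<theta>_def by (rule L2_inner_diff_left[OF phL qhL V(4)])
    moreover have "?ip \<alpha> (divergence \<Omega> \<zeta>) = ?ip p (divergence \<Omega> \<zeta>) - ?ip qh (divergence \<Omega> \<zeta>)"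
      unfolding \<alpha>_def by (rule L2_inner_diff_left[OF p qhL V(4)])
    moreover have "L2_inner \<Omega> (sym_grad \<Omega> \<zeta>) (sym_grad \<Omega> \<zeta>) =
        L2_inner \<Omega> (sym_grad \<Omega> uh) (sym_grad \<Omega> \<zeta>) - L2_inner \<Omega> (sym_grad \<Omega> zh) (sym_grad \<Omega> \<zeta>)"
      using L2_inner_sym_grad_diff[OF H1(2,3) D(4)] by (simp add: \<zeta>_def)
    moreover have "L2_inner \<Omega> (sym_grad \<Omega> \<beta>) (sym_grad \<Omega> \<zeta>) =
        L2_inner \<Omega> (sym_grad \<Omega> u) (sym_grad \<Omega> \<zeta>) - L2_inner \<Omega> (sym_grad \<Omega> zh) (sym_grad \<Omega> \<zeta>)"
      unfolding \<beta>_def by (rule L2_inner_sym_grad_diff[OF H1(1,3) D(4)])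
    ultimately show ?thesis by linarith
  qed
  define a b A E R where "a = ?n \<theta>" and "b = L2_norm \<Omega> (sym_grad \<Omega> \<zeta>)" and "A = ?n \<alpha>"
    and "E = L2_norm \<Omega> (jacobian \<Omega> \<beta>)" and "R = ?n \<rho>"
  have nn: "0 \<le> a" "0 \<le> b" "0 \<le> A" "0 \<le> E" "0 \<le> R" by (simp_all add: a_def b_def A_def E_def R_def)
  have div\<zeta>: "?n (divergence \<Omega> \<zeta>) \<le> b" unfolding b_def by (rule divergence_le_sym_grad[OF \<zeta>0])
  have sym\<beta>: "L2_norm \<Omega> (sym_grad \<Omega> \<beta>) \<le> E" unfolding E_def by (rule sym_grad_le_jacobian[OF \<beta>0])
  have div\<beta>: "?n (divergence \<Omega> \<beta>) \<le> E" using divergence_le_sym_grad[OF \<beta>0] sym\<beta> by linarith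
  have b1: "\<bar>?ip \<theta> (divergence \<Omega> \<zeta>)\<bar> \<le> a * b"
    using L2_inner_le_norm[OF \<theta>L V(4)] mult_left_mono[OF div\<zeta> nn(1)] by (simp add: a_def)
  have b2: "\<bar>?ip \<alpha> \<theta>\<bar> \<le> A * a"
    using L2_inner_le_norm[OF \<alpha>L \<theta>L] by (simp add: a_def A_def)
  have b3: "\<bar>?ip (divergence \<Omega> \<beta>) \<theta>\<bar> \<le> E * a"
    using L2_inner_le_norm[OF V(5) \<theta>L] mult_right_mono[OF div\<beta> nn(1)] by (simp add: a_def)
  have b4: "\<bar>?ip \<rho> \<theta>\<bar> \<le> R * a"
    using L2_inner_le_norm[OF \<rho>L \<theta>L] by (simp add: a_def R_def)
  have b5: "\<bar>L2_inner \<Omega> (sym_grad \<Omega> \<beta>) (sym_grad \<Omega> \<zeta>)\<bar> \<le> E * b"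
    using L2_inner_le_norm[OF D(5) D(4)] mult_right_mono[OF sym\<beta> nn(2)] by (simp add: b_def)
  have b6: "\<bar>?ip \<alpha> (divergence \<Omega> \<zeta>)\<bar> \<le> A * b"
    using L2_inner_le_norm[OF \<alpha>L V(4)] mult_left_mono[OF div\<zeta> nn(3)] by (simp add: A_def)
  have "2 * a\<^sup>2 - 2 * (a * b) + b\<^sup>2 \<le> 2 * (A * a) + E * a + R * a + E * b + A * b"
    using i1 i2 b1 b2 b3 b4 b5 b6 L2_inner_commute[of \<Omega> \<theta> "divergence \<Omega> \<zeta>"]
    unfolding a_def b_def L2_norm_power2 by linarith
  also have "\<dots> \<le> (a + b) * (2 * (A + E + R))"
  proof -
    have "0 \<le> E * a" "0 \<le> R * a" "0 \<le> E * b" "0 \<le> A * b" "0 \<le> R * b" using nn by auto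
    then show ?thesis by (simp add: algebra_simps)
  qed
  finally have "a + b \<le> 8 * (2 * (A + E + R))"
    by (intro quadratic_form_bound) (use nn in \<open>auto simp: mult.assoc\<close>)
  then have ab: "a + b \<le> 16 * (A + E + R)" by simp
  have n1: "?n (\<lambda>x. p x - ph x) \<le> A + a"
  proof -
    have "(\<lambda>x. p x - ph x) = (\<lambda>x. \<alpha> x - \<theta> x)" by (auto simp: \<alpha>_def \<theta>_def)
    then show ?thesis using L2_norm_triangle_diff[OF \<alpha>L \<theta>L] by (simp add: A_def a_def)
  qed
  have n2: "Hk_norm_vec 1 \<Omega> (\<lambda>x. u x - uh x) \<le> (F + 1) * (E + 2 * b)"
  proof -
    have diff: "(\<lambda>x. u x - uh x) = (\<lambda>x. \<beta> x - \<zeta> x)" by (auto simp: \<beta>_def \<zeta>_def)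
    have "L2_norm \<Omega> (jacobian \<Omega> (\<lambda>x. u x - uh x)) \<le> E + 2 * b"
      using L2_norm_jacobian_diff[OF H1(5,4)] jacobian_le_sym_grad[OF \<zeta>0]
      unfolding diff by (simp add: E_def b_def)
    then have "(F + 1) * L2_norm \<Omega> (jacobian \<Omega> (\<lambda>x. u x - uh x)) \<le> (F + 1) * (E + 2 * b)"
      using F(1) by (intro mult_left_mono) auto
    with Hk_norm_vec_le[OF vec_space_H10_diff[OF eq(2) uh] F] show ?thesis by (rule order_trans)
  qed
  have "?n (\<lambda>x. p x - ph x) + Hk_norm_vec 1 \<Omega> (\<lambda>x. u x - uh x) \<le> (F + 1) * (A + a) + (F + 1) * (E + 2 * b)"
  proof -
    have "1 * (A + a) \<le> (F + 1) * (A + a)" using F(1) nn by (intro mult_right_mono) auto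
    then show ?thesis using n1 n2 by simp
  qed
  also have "\<dots> = (F + 1) * (A + a + E + 2 * b)" by (simp add: algebra_simps)
  \<comment> \<open>From a + b \<le> 16 (A + E + R) one gets A + a + E + 2 b \<le> (1 + 2 * 16) (A +
    E + R), hence 33.\<close>
  also have "\<dots> \<le> (F + 1) * (33 * (A + E + R))"
    using F(1) ab nn by (intro mult_left_mono) auto
  also have "\<dots> \<le> (F + 1) * (33 * (A + Hk_norm_vec 1 \<Omega> \<beta> + R))"
    using F(1) L2_norm_jacobian_le[OF H1(5)] by (intro mult_left_mono) (auto simp: E_def)
  also have "\<dots> = 33 * (F + 1) * (A + Hk_norm_vec 1 \<Omega> \<beta> + R)" by (simp only: mult_ac)
  finally show ?thesis by (simp only: A_def R_def \<alpha>_def \<beta>_def \<rho>_def)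
qed

end

section \<open>Combination with the approximation properties\<close>

text \<open>The existence of a minimiser is not assumed, hence the slack d; the lower bound 0 gives
  the real infimum its usual meaning.\<close>

lemma INF_le_imp_ex:
  fixes f :: "'a \<Rightarrow> real"
  assumes "(INF x\<in>A. f x) \<le> b" "A \<noteq> {}" "\<And>x. x \<in> A \<Longrightarrow> 0 \<le> f x" "0 < d"
  obtains x where "x \<in> A" "f x \<le> b + d"
proof -
  have "bdd_below (f ` A)" using assms(3) by (intro bdd_belowI[of _ 0]) auto
  moreover have "(INF x\<in>A. f x) < b + d" using assms(1,4) by simp
  ultimately obtain x where "x \<in> A" "f x < b + d"
    using cINF_less_iff[OF assms(2)] by blast
  then show thesis by (intro that[of x]) auto
qed

theorem theorem6p5:
  fixes \<Omega> :: "(real^2) set" and m \<epsilon> \<tau> L :: real and fc fe :: "real \<Rightarrow> real"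
    and I H :: "real set" and T :: "real \<Rightarrow> (real^2) set set" and rc rp ru :: nat
  assumes "convex_polygonal_domain \<Omega>"
    and "m > 0" and "\<epsilon> > 0" and "\<tau> > 0"
    and "fc C1_differentiable_on UNIV" and "fe C1_differentiable_on UNIV"
    and "convex_on UNIV fc" and "convex_on UNIV fe"
    and "is_interval I" and "L > 0"
    and "\<forall>r\<in>I. \<forall>s\<in>I. \<bar>deriv fc r - deriv fc s\<bar> + \<bar>deriv fe r - deriv fe s\<bar> \<le> L * \<bar>r - s\<bar>"
    and "shape_regular_family \<Omega> H T"
    and "rc \<ge> 1" and "rp \<ge> 1" and "ru \<ge> 1"
    and "approximation_properties \<Omega> H T rc rp ru"
  shows "\<exists>C>0. \<forall>h\<in>H. \<forall>cn c \<mu> cnh ch \<mu>h p u rh ph uh.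
    cn \<in> Hk 1 \<Omega> \<longrightarrow>
    convex_splitting_step \<Omega> (Hk 1 \<Omega>) m \<epsilon> \<tau> fc fe cn c \<mu> \<longrightarrow>
    cnh \<in> lagrange_space \<Omega> (T h) rc \<longrightarrow>
    (LINT x|lebesgue_on \<Omega>. cnh x) = (LINT x|lebesgue_on \<Omega>. cn x) \<longrightarrow>
    convex_splitting_step \<Omega> (lagrange_space \<Omega> (T h) rc) m \<epsilon> \<tau> fc fe cnh ch \<mu>h \<longrightarrow>
    ess_range \<Omega> c \<union> ess_range \<Omega> ch \<union> ess_range \<Omega> cn \<union> ess_range \<Omega> cnh \<subseteq> I \<longrightarrow>
    c \<in> Hk (rc + 1) \<Omega> \<longrightarrow> \<mu> \<in> Hk (rc + 1) \<Omega> \<longrightarrow> c \<in> Hk 2 \<Omega> \<longrightarrow> normal_deriv_zero \<Omega> c \<longrightarrow>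
    auxiliary_pair \<Omega> (L20 \<Omega>) (vec_space (H10 \<Omega>)) (\<lambda>x. - laplace \<Omega> c x) p u \<longrightarrow>
    rh \<in> Vh0 \<Omega> (T h) rp \<longrightarrow>
    (\<forall>qh\<in>Vh0 \<Omega> (T h) rp. L2_inner \<Omega> rh qh = L2_inner \<Omega> (grad \<Omega> ch) (grad \<Omega> qh)) \<longrightarrow>
    auxiliary_pair \<Omega> (Vh0 \<Omega> (T h) rp) (Uh \<Omega> (T h) ru) rh ph uh \<longrightarrow>
    p \<in> Hk (rp + 1) \<Omega> \<inter> L20 \<Omega> \<longrightarrow>
    u \<in> vec_space (Hk (ru + 1) \<Omega> \<inter> H10 \<Omega>) \<longrightarrow>
    disc_neg_norm \<Omega> (T h) rc (\<lambda>x. c x - ch x)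
      + Hk_norm 1 \<Omega> (\<lambda>x. c x - ch x)
      + Hk_norm 1 \<Omega> (\<lambda>x. \<mu> x - \<mu>h x)
      + L2_norm \<Omega> (\<lambda>x. p x - ph x)
      + Hk_norm_vec 1 \<Omega> (\<lambda>x. u x - uh x)
    \<le> C * (h ^ rc * Hk_norm (rc + 1) \<Omega> c
      + h ^ rc * Hk_norm (rc + 1) \<Omega> \<mu>
      + h ^ (rp + 1) * Hk_norm (rp + 1) \<Omega> p
      + h ^ ru * Hk_norm_vec (ru + 1) \<Omega> u
      + disc_neg_norm \<Omega> (T h) rc (\<lambda>x. cn x - cnh x)
      + L2_norm \<Omega> (\<lambda>x. cn x - cnh x)
      + L2_norm \<Omega> (\<lambda>x. - laplace \<Omega> c x - rh x))"
proof -
  interpret bounded_domain \<Omega>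
    using assms(1) by unfold_locales (simp_all add: convex_polygonal_domain_def)
  have dom: "\<Omega> \<noteq> {}" "convex \<Omega>" using assms(1) by (simp_all add: convex_polygonal_domain_def)
  obtain P where P: "P > 0" "\<And>v M S. lipschitz_function \<Omega> v M S \<Longrightarrow> (LINT x|lebesgue_on \<Omega>. v x) = 0 \<Longrightarrow>
      L2_norm \<Omega> v \<le> P * L2_norm \<Omega> (grad \<Omega> v)"
    using poincare_constant[OF dom] by metis
  obtain F where F: "F > 0" "\<And>u. u \<in> H10 \<Omega> \<Longrightarrow> L2_norm \<Omega> u \<le> F * L2_norm \<Omega> (grad \<Omega> u)"
    using poincare_friedrichs_constant by blast
  obtain Ca where Ca: "\<forall>h\<in>H.
        (\<forall>v\<in>Hk (rc + 1) \<Omega>.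
           (INF vh\<in>lagrange_space \<Omega> (T h) rc. Hk_norm 1 \<Omega> (\<lambda>x. v x - vh x))
             \<le> Ca * h ^ rc * Hk_norm (rc + 1) \<Omega> v) \<and>
        (\<forall>q\<in>Hk (rp + 1) \<Omega> \<inter> L20 \<Omega>.
           (INF qh\<in>Vh0 \<Omega> (T h) rp. L2_norm \<Omega> (\<lambda>x. q x - qh x))
             \<le> Ca * h ^ (rp + 1) * Hk_norm (rp + 1) \<Omega> q) \<and>
        (\<forall>z\<in>vec_space (Hk (ru + 1) \<Omega> \<inter> H10 \<Omega>).
           (INF zh\<in>Uh \<Omega> (T h) ru. Hk_norm_vec 1 \<Omega> (\<lambda>x. z x - zh x))
             \<le> Ca * h ^ ru * Hk_norm_vec (ru + 1) \<Omega> z)"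
    using assms(16) by (auto simp: approximation_properties_def)
  define K where "K = 1 + 4 * (P + m * \<tau> + \<epsilon>\<^sup>2 + L + L * P) / min (\<epsilon>\<^sup>2) (m * \<tau>)"
  define G1 where "G1 = 4 + 2 * P * K + P + P * P * K + 2 * K + 2 * L + L * P * K"
  define G2 where "G2 = 33 * (F + 1)"
  have "K > 0" unfolding K_def using assms(2-4,10) P(1) by (intro add_pos_nonneg divide_nonneg_nonneg mult_nonneg_nonneg) auto
  then have G: "G1 > 0" "G2 > 0"
    unfolding G1_def G2_def using assms(10) P(1) F(1) by (auto intro!: add_pos_nonneg)
  \<comment> \<open>|Ca| + 1 takes the place of \<open>Ca\<close>, which has unknown sign and does
    not multiply the data terms N and E. The factor 2 of G1 stems from the doubled approximation
    error of c.\<close>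
  define G where "G = (2 * G1 + G2) * (\<bar>Ca\<bar> + 1)"
  have G0: "G > 0" unfolding G_def using G by (intro mult_pos_pos) auto
  show ?thesis
  proof (intro exI[of _ G] conjI ballI allI impI)
    show "G > 0" by (rule G0)
    fix h cn c \<mu> cnh ch \<mu>h p u rh ph uh
    assume h: "h \<in> H" and cn: "cn \<in> Hk 1 \<Omega>"
      and step: "convex_splitting_step \<Omega> (Hk 1 \<Omega>) m \<epsilon> \<tau> fc fe cn c \<mu>"
      and cnh: "cnh \<in> lagrange_space \<Omega> (T h) rc"
      and mass: "(LINT x|lebesgue_on \<Omega>. cnh x) = (LINT x|lebesgue_on \<Omega>. cn x)"
      and steph: "convex_splitting_step \<Omega> (lagrange_space \<Omega> (T h) rc) m \<epsilon> \<tau> fc fe cnh ch \<mu>h"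
      and range: "ess_range \<Omega> c \<union> ess_range \<Omega> ch \<union> ess_range \<Omega> cn \<union> ess_range \<Omega> cnh \<subseteq> I"
      and c: "c \<in> Hk (rc + 1) \<Omega>" and \<mu>: "\<mu> \<in> Hk (rc + 1) \<Omega>" and c2: "c \<in> Hk 2 \<Omega>"
      and aux: "auxiliary_pair \<Omega> (L20 \<Omega>) (vec_space (H10 \<Omega>)) (\<lambda>x. - laplace \<Omega> c x) p u"
      and rh: "rh \<in> Vh0 \<Omega> (T h) rp"
      and auxh: "auxiliary_pair \<Omega> (Vh0 \<Omega> (T h) rp) (Uh \<Omega> (T h) ru) rh ph uh"
      and p: "p \<in> Hk (rp + 1) \<Omega> \<inter> L20 \<Omega>"
      and u: "u \<in> vec_space (Hk (ru + 1) \<Omega> \<inter> H10 \<Omega>)"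
    have h0: "h > 0" and conf: "conforming_triangulation \<Omega> (T h)"
      using assms(12) h by (auto simp: shape_regular_family_def)
    interpret mesh \<Omega> "T h" using dom conf by unfold_locales
    have poinc: "L2_norm \<Omega> v \<le> P * L2_norm \<Omega> (grad \<Omega> v)" if v: "v \<in> Vh0 \<Omega> (T h) rc" for v
    proof -
      obtain M where "lipschitz_function \<Omega> v M skeleton_complement"
        using lagrange_lipschitz_function v by (auto simp: Vh0_def)
      then show ?thesis using P(2) v by (auto simp: Vh0_def L20_def)
    qed
    define T1 T2 T3 T4 N E where "T1 = h ^ rc * Hk_norm (rc + 1) \<Omega> c" and "T2 = h ^ rc * Hk_norm (rc + 1) \<Omega> \<mu>"
      and "T3 = h ^ (rp + 1) * Hk_norm (rp + 1) \<Omega> p" and "T4 = h ^ ru * Hk_norm_vec (ru + 1) \<Omega> u"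
      and "N = L2_norm \<Omega> (\<lambda>x. cn x - cnh x)" and "E = L2_norm \<Omega> (\<lambda>x. - laplace \<Omega> c x - rh x)"
    have T0: "0 \<le> T1" "0 \<le> T2" "0 \<le> T3" "0 \<le> T4" "0 \<le> N" "0 \<le> E"
      using h0 by (auto simp: T1_def T2_def T3_def T4_def N_def E_def Hk_norm_nonneg Hk_norm_vec_def sum_nonneg)
    let ?lhs = "disc_neg_norm \<Omega> (T h) rc (\<lambda>x. c x - ch x) + Hk_norm 1 \<Omega> (\<lambda>x. c x - ch x)
      + Hk_norm 1 \<Omega> (\<lambda>x. \<mu> x - \<mu>h x) + L2_norm \<Omega> (\<lambda>x. p x - ph x) + Hk_norm_vec 1 \<Omega> (\<lambda>x. u x - uh x)"
    have "?lhs \<le> G * (T1 + T2 + T3 + T4 + N + E)"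
    proof (rule field_le_epsilon)
      fix e :: real assume e: "e > 0"
      \<comment> \<open>The slack d enters twice for c and once for \<mu>, each with weight G1, and
        once each for p and u with weight G2.\<close>
      define d where "d = e / (3 * G1 + 2 * G2)"
      have d: "d > 0" "(3 * G1 + 2 * G2) * d = e" using e G by (auto simp: d_def)
      have ne: "lagrange_space \<Omega> (T h) rc \<noteq> {}" "Vh0 \<Omega> (T h) rp \<noteq> {}" "Uh \<Omega> (T h) ru \<noteq> {}"
        using cnh rh auxiliary_pairD(2)[OF auxh] by auto
      have "(INF vh\<in>lagrange_space \<Omega> (T h) rc. Hk_norm 1 \<Omega> (\<lambda>x. c x - vh x)) \<le> Ca * T1"
        using Ca h c by (simp add: T1_def mult.assoc)
      then obtain vs where vs: "vs \<in> lagrange_space \<Omega> (T h) rc" "Hk_norm 1 \<Omega> (\<lambda>x. c x - vs x) \<le> Ca * T1 + d"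
        by (rule INF_le_imp_ex[OF _ ne(1) Hk_norm_nonneg d(1)])
      have "(INF vh\<in>lagrange_space \<Omega> (T h) rc. Hk_norm 1 \<Omega> (\<lambda>x. \<mu> x - vh x)) \<le> Ca * T2"
        using Ca h \<mu> by (simp add: T2_def mult.assoc)
      then obtain ms where ms: "ms \<in> lagrange_space \<Omega> (T h) rc" "Hk_norm 1 \<Omega> (\<lambda>x. \<mu> x - ms x) \<le> Ca * T2 + d"
        by (rule INF_le_imp_ex[OF _ ne(1) Hk_norm_nonneg d(1)])
      have "(INF qh\<in>Vh0 \<Omega> (T h) rp. L2_norm \<Omega> (\<lambda>x. p x - qh x)) \<le> Ca * T3"
        using Ca h p unfolding T3_def mult.assoc[symmetric] by blast
      then obtain qh where qh: "qh \<in> Vh0 \<Omega> (T h) rp" "L2_norm \<Omega> (\<lambda>x. p x - qh x) \<le> Ca * T3 + d"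
        by (rule INF_le_imp_ex[OF _ ne(2) L2_norm_nonneg d(1)])
      have "(INF zh\<in>Uh \<Omega> (T h) ru. Hk_norm_vec 1 \<Omega> (\<lambda>x. u x - zh x)) \<le> Ca * T4"
        using Ca h u by (simp add: T4_def mult.assoc)
      then obtain zh where zh: "zh \<in> Uh \<Omega> (T h) ru" "Hk_norm_vec 1 \<Omega> (\<lambda>x. u x - zh x) \<le> Ca * T4 + d"
        by (rule INF_le_imp_ex[OF _ ne(3) _ d(1)]) (simp add: Hk_norm_vec_def sum_nonneg)
      have Ca': "Ca * t \<le> \<bar>Ca\<bar> * t" if "0 \<le> t" for t using that by (intro mult_right_mono) auto
      have "?lhs \<le> G1 * (2 * Hk_norm 1 \<Omega> (\<lambda>x. c x - vs x) + Hk_norm 1 \<Omega> (\<lambda>x. \<mu> x - ms x) + N)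
          + G2 * (L2_norm \<Omega> (\<lambda>x. p x - qh x) + Hk_norm_vec 1 \<Omega> (\<lambda>x. u x - zh x) + E)"
        using convex_splitting_estimate[OF assms(2,3,4,10) P(1) poinc assms(5,6,7,11) cn step cnh mass steph range vs(1) ms(1)]
          auxiliary_estimate[OF F aux auxh L2_uminus[OF laplace_L2[OF c2]] rh qh(1) zh(1)]
        by (simp add: G1_def G2_def K_def N_def E_def)
      also have "\<dots> \<le> G1 * (2 * (\<bar>Ca\<bar> * T1 + d) + (\<bar>Ca\<bar> * T2 + d) + N) + G2 * ((\<bar>Ca\<bar> * T3 + d) + (\<bar>Ca\<bar> * T4 + d) + E)"
        using vs(2) ms(2) qh(2) zh(2) Ca'[OF T0(1)] Ca'[OF T0(2)] Ca'[OF T0(3)] Ca'[OF T0(4)] G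
        by (intro add_mono mult_left_mono) auto
      also have "\<dots> = G1 * (2 * (\<bar>Ca\<bar> * T1) + \<bar>Ca\<bar> * T2 + N) + G2 * (\<bar>Ca\<bar> * T3 + \<bar>Ca\<bar> * T4 + E) + (3 * G1 + 2 * G2) * d"
        by (simp add: algebra_simps)
      also have "\<dots> \<le> G * (T1 + T2 + T3 + T4 + N + E) + e"
      proof -
        define S where "S = (\<bar>Ca\<bar> + 1) * (T1 + T2 + T3 + T4 + N + E)"
        have prods: "0 \<le> \<bar>Ca\<bar> * T1" "0 \<le> \<bar>Ca\<bar> * T2" "0 \<le> \<bar>Ca\<bar> * T3" "0 \<le> \<bar>Ca\<bar> * T4" "0 \<le> \<bar>Ca\<bar> * N" "0 \<le> \<bar>Ca\<bar> * E"
          using T0 by auto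
        have S: "S = \<bar>Ca\<bar> * T1 + \<bar>Ca\<bar> * T2 + \<bar>Ca\<bar> * T3 + \<bar>Ca\<bar> * T4 + \<bar>Ca\<bar> * N + \<bar>Ca\<bar> * E + (T1 + T2 + T3 + T4 + N + E)"
          by (simp add: S_def algebra_simps)
        have "G1 * (2 * (\<bar>Ca\<bar> * T1) + \<bar>Ca\<bar> * T2 + N) \<le> G1 * (2 * S)"
          using G prods T0 unfolding S by (intro mult_left_mono) auto
        moreover have "G2 * (\<bar>Ca\<bar> * T3 + \<bar>Ca\<bar> * T4 + E) \<le> G2 * S"
          using G prods T0 unfolding S by (intro mult_left_mono) auto
        moreover have "G * (T1 + T2 + T3 + T4 + N + E) = G1 * (2 * S) + G2 * S"
          by (simp add: G_def S_def algebra_simps)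
        ultimately show ?thesis using d(2) by linarith
      qed
      finally show "?lhs \<le> G * (T1 + T2 + T3 + T4 + N + E) + e" .
    qed
    also have "\<dots> \<le> G * (T1 + T2 + T3 + T4 + disc_neg_norm \<Omega> (T h) rc (\<lambda>x. cn x - cnh x) + N + E)"
      using G0 by (intro mult_left_mono) (auto simp: disc_neg_norm_def)
    finally show "?lhs \<le> G * (h ^ rc * Hk_norm (rc + 1) \<Omega> c + h ^ rc * Hk_norm (rc + 1) \<Omega> \<mu>
      + h ^ (rp + 1) * Hk_norm (rp + 1) \<Omega> p + h ^ ru * Hk_norm_vec (ru + 1) \<Omega> u
      + disc_neg_norm \<Omega> (T h) rc (\<lambda>x. cn x - cnh x) + L2_norm \<Omega> (\<lambda>x. cn x - cnh x)
      + L2_norm \<Omega> (\<lambda>x. - laplace \<Omega> c x - rh x))"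
      by (simp only: T1_def T2_def T3_def T4_def N_def E_def)
  qed
qed

end
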